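(* If a statistical manifold $(M,g,\nabla)$ is locally embeddable to an $N$-dimensional flat statistical manifold, then for every $\alpha\in\mathbb{R}$ the statistical manifold $(M,g,\nabla^{(\alpha)})$ is locally embeddable to a flat statistical manifold of dimension $2N$.
   Context: All objects are $C^\infty$. A statistical manifold $(M,g,\nabla)$ is a manifold $M$ with a Riemannian metric $g$ and a torsion-free affine connection $\nabla$ such that $\nabla g$ is a totally symmetric $3$-tensor. It is called flat if the curvature of $\nabla$ vanishes ($g$ need not be a flat metric). The dual connection $\nabla^*$ of $\nabla$ is the affine connection characterized by $X\cdot g(Y,Z)=g(\nabla_XY,Z)+g(Y,\nabla^*_XZ)$ for all $X,Y,Z\in\Gamma(TM)$; it is also torsion-free. For $\alpha\in\mathbb{R}$ the $\alpha$-connection is $\nabla^{(\alpha)}:=\frac{1+\alpha}{2}\nabla+\frac{1-\alpha}{2}\nabla^*$, and $(g,\nabla^{(\alpha)})$ is again a statistical structure on $M$. An embedding $f\colon M\to\mathcal{S}$ between statistical manifolds $(M,g,\nabla)$ and $(\mathcal{S},G,D)$ is a statistical embedding if $g(X,Y)=G(f_*X,f_*Y)$ and $g(\nabla_XY,Z)=G(D_X(f_*Y),f_*Z)$ for all $X,Y,Z\in\Gamma(TM)$, where $D$ also denotes the pulled-back connection on $f^*T\mathcal{S}$. A statistical manifold $M$ is locally embeddable to a flat statistical manifold of dimension $N$ if for every $x\in M$ there exist an open neighborhood $U$ of $x$, an $N$-dimensional flat statistical manifold $(\mathcal{S},G,D)$ and a statistical embedding $f\colon U\to\mathcal{S}$.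 *)

theory Defs
  imports "HOL-Analysis.Analysis"
begin

section \<open>Smooth maps between Euclidean spaces\<close>

text \<open>Used only for open \<open>S\<close>.  The domain being finite-dimensional, continuity of all iterated
  directional derivatives is the usual notion of being of class $C^k$.\<close>

primrec Ck_on :: "nat \<Rightarrow> 'e::euclidean_space set \<Rightarrow> ('e \<Rightarrow> 'b::real_normed_vector) \<Rightarrow> bool" where
  "Ck_on 0 S f \<longleftrightarrow> continuous_on S f"
| "Ck_on (Suc k) S f \<longleftrightarrow>
     (\<forall>x\<in>S. f differentiable (at x)) \<and> (\<forall>v. Ck_on k S (\<lambda>x. frechet_derivative f (at x) v))"

definition smooth_on :: "'e::euclidean_space set \<Rightarrow> ('e \<Rightarrow> 'b::real_normed_vector) \<Rightarrow> bool" where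
  "smooth_on S f \<longleftrightarrow> (\<forall>k. Ck_on k S f)"


section \<open>Smooth manifolds\<close>

text \<open>A chart is a pair of its domain and its coordinate map.  The dimension of a manifold with
  points in \<open>'a\<close> and charts in \<open>'e\<close> is \<open>DIM('e)\<close>; the atlas need not be maximal.\<close>

type_synonym ('a, 'e) chart = "'a set \<times> ('a \<Rightarrow> 'e)"

record ('a, 'e) manifold =
  mtop :: "'a topology"
  atlas :: "('a, 'e) chart set"

definition chart_inv :: "('a, 'e) chart \<Rightarrow> 'e \<Rightarrow> 'a" where
  "chart_inv c = inv_into (fst c) (snd c)"

definition smooth_manifold :: "('a, 'e::euclidean_space) manifold \<Rightarrow> bool" where
  "smooth_manifold M \<longleftrightarrow>
     Hausdorff_space (mtop M) \<and> second_countable (mtop M) \<and>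
     (\<Union>c\<in>atlas M. fst c) = topspace (mtop M) \<and>
     (\<forall>c\<in>atlas M. openin (mtop M) (fst c) \<and> open (snd c ` fst c) \<and>
        homeomorphic_map (subtopology (mtop M) (fst c)) (top_of_set (snd c ` fst c)) (snd c)) \<and>
     (\<forall>c\<in>atlas M. \<forall>d\<in>atlas M. smooth_on (snd c ` (fst c \<inter> fst d)) (snd d \<circ> chart_inv c))"

definition chart_at :: "('a, 'e) manifold \<Rightarrow> 'a \<Rightarrow> ('a, 'e) chart" where
  "chart_at M p = (SOME c. c \<in> atlas M \<and> p \<in> fst c)"

definition smooth_fun ::
    "('a, 'e::euclidean_space) manifold \<Rightarrow> 'a set \<Rightarrow> ('a \<Rightarrow> 'b::real_normed_vector) \<Rightarrow> bool" where
  "smooth_fun M U h \<longleftrightarrow> (\<forall>c\<in>atlas M. smooth_on (snd c ` (U \<inter> fst c)) (h \<circ> chart_inv c))"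

definition smooth_map ::
    "('a, 'e::euclidean_space) manifold \<Rightarrow> 'a set \<Rightarrow> ('s, 'n::euclidean_space) manifold
      \<Rightarrow> ('a \<Rightarrow> 's) \<Rightarrow> bool" where
  "smooth_map M U S f \<longleftrightarrow>
     continuous_map (subtopology (mtop M) U) (mtop S) f \<and>
     (\<forall>c\<in>atlas M. \<forall>d\<in>atlas S.
        smooth_on (snd c ` {p \<in> U \<inter> fst c. f p \<in> fst d}) (snd d \<circ> f \<circ> chart_inv c))"


section \<open>Tangent vectors and vector fields\<close>

text \<open>The tangent space at \<open>p\<close> is modelled on \<open>'e\<close>: a vector \<open>v :: 'e\<close> stands for the tangent
  vector at \<open>p\<close> whose components in the distinguished chart \<open>chart_at M p\<close> are \<open>v\<close>.  Components
  in any other chart \<open>c\<close> are obtained through the derivative of the transition map.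
  Since \<open>chart_at M p\<close> may jump with \<open>p\<close>, smoothness of a vector field, which is a function
  \<open>'a \<Rightarrow> 'e\<close>, refers to its components in each fixed chart.\<close>

definition coord_change ::
    "('a, 'e::euclidean_space) chart \<Rightarrow> ('a, 'e) chart \<Rightarrow> 'a \<Rightarrow> 'e \<Rightarrow> 'e" where
  "coord_change c d p v = frechet_derivative (snd d \<circ> chart_inv c) (at (snd c p)) v"

definition comps ::
    "('a, 'e::euclidean_space) manifold \<Rightarrow> ('a, 'e) chart \<Rightarrow> 'a \<Rightarrow> 'e \<Rightarrow> 'e" where
  "comps M c p v = coord_change (chart_at M p) c p v"

definition smooth_vf ::
    "('a, 'e::euclidean_space) manifold \<Rightarrow> 'a set \<Rightarrow> ('a \<Rightarrow> 'e) \<Rightarrow> bool" where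
  "smooth_vf M U X \<longleftrightarrow>
     (\<forall>c\<in>atlas M. smooth_on (snd c ` (U \<inter> fst c)) ((\<lambda>p. comps M c p (X p)) \<circ> chart_inv c))"

text \<open>The vector field on the domain of the chart \<open>c\<close> with constant components \<open>v\<close> in \<open>c\<close>.\<close>

definition coord_field ::
    "('a, 'e::euclidean_space) manifold \<Rightarrow> ('a, 'e) chart \<Rightarrow> 'e \<Rightarrow> 'a \<Rightarrow> 'e" where
  "coord_field M c v p = coord_change c (chart_at M p) p v"

text \<open>The derivative at \<open>p\<close> of a function \<open>h\<close> with values in a vector space along the tangent
  vector \<open>v\<close>, and the differential at \<open>p\<close> of a map \<open>f\<close> between manifolds.\<close>

definition dir_deriv ::
    "('a, 'e::euclidean_space) manifold \<Rightarrow> ('a \<Rightarrow> 'b::real_normed_vector) \<Rightarrow> 'a \<Rightarrow> 'e \<Rightarrow> 'b" where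
  "dir_deriv M h p v =
     frechet_derivative (h \<circ> chart_inv (chart_at M p)) (at (snd (chart_at M p) p)) v"

definition differential ::
    "('a, 'e::euclidean_space) manifold \<Rightarrow> ('s, 'n::euclidean_space) manifold
      \<Rightarrow> ('a \<Rightarrow> 's) \<Rightarrow> 'a \<Rightarrow> 'e \<Rightarrow> 'n" where
  "differential M S f p v = dir_deriv M (snd (chart_at S (f p)) \<circ> f) p v"

definition lie_bracket ::
    "('a, 'e::euclidean_space) manifold \<Rightarrow> ('a \<Rightarrow> 'e) \<Rightarrow> ('a \<Rightarrow> 'e) \<Rightarrow> 'a \<Rightarrow> 'e" where
  "lie_bracket M X Y p =
     dir_deriv M (\<lambda>q. comps M (chart_at M p) q (Y q)) p (X p) -
     dir_deriv M (\<lambda>q. comps M (chart_at M p) q (X q)) p (Y p)"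


section \<open>Metrics and connections\<close>

type_synonym ('a, 'e) metric = "'a \<Rightarrow> 'e \<Rightarrow> 'e \<Rightarrow> real"
type_synonym ('a, 'e) connection = "('a \<Rightarrow> 'e) \<Rightarrow> ('a \<Rightarrow> 'e) \<Rightarrow> 'a \<Rightarrow> 'e"

definition riemannian_metric ::
    "('a, 'e::euclidean_space) manifold \<Rightarrow> ('a, 'e) metric \<Rightarrow> bool" where
  "riemannian_metric M g \<longleftrightarrow>
     (\<forall>p\<in>topspace (mtop M). bilinear (g p) \<and> (\<forall>v w. g p v w = g p w v) \<and>
        (\<forall>v. v \<noteq> 0 \<longrightarrow> 0 < g p v v)) \<and>
     (\<forall>U X Y. openin (mtop M) U \<and> smooth_vf M U X \<and> smooth_vf M U Y \<longrightarrow>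
        smooth_fun M U (\<lambda>p. g p (X p) (Y p)))"

text \<open>Connections are covariant derivatives acting on the vector fields over all open subsets,
  compatibly with restriction.  Thus the same operator serves as the restriction of the connection
  to an open submanifold.  The values of \<open>D X Y\<close> at points where \<open>X\<close> or \<open>Y\<close> is not smooth are
  irrelevant.\<close>

definition affine_connection ::
    "('a, 'e::euclidean_space) manifold \<Rightarrow> ('a, 'e) connection \<Rightarrow> bool" where
  "affine_connection M D \<longleftrightarrow>
     (\<forall>U. openin (mtop M) U \<longrightarrow>
       (\<forall>X Y. smooth_vf M U X \<and> smooth_vf M U Y \<longrightarrow> smooth_vf M U (D X Y)) \<and>
       (\<forall>X X' Y Y'. smooth_vf M U X \<and> smooth_vf M U Y \<and>
          (\<forall>p\<in>U. X p = X' p) \<and> (\<forall>p\<in>U. Y p = Y' p) \<longrightarrow> (\<forall>p\<in>U. D X Y p = D X' Y' p)) \<and>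
       (\<forall>X X' Y. smooth_vf M U X \<and> smooth_vf M U X' \<and> smooth_vf M U Y \<longrightarrow>
          (\<forall>p\<in>U. D (\<lambda>q. X q + X' q) Y p = D X Y p + D X' Y p)) \<and>
       (\<forall>X Y Y'. smooth_vf M U X \<and> smooth_vf M U Y \<and> smooth_vf M U Y' \<longrightarrow>
          (\<forall>p\<in>U. D X (\<lambda>q. Y q + Y' q) p = D X Y p + D X Y' p)) \<and>
       (\<forall>h X Y. smooth_fun M U h \<and> smooth_vf M U X \<and> smooth_vf M U Y \<longrightarrow>
          (\<forall>p\<in>U. D (\<lambda>q. h q *\<^sub>R X q) Y p = h p *\<^sub>R D X Y p)) \<and>
       (\<forall>h X Y. smooth_fun M U h \<and> smooth_vf M U X \<and> smooth_vf M U Y \<longrightarrow>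
          (\<forall>p\<in>U. D X (\<lambda>q. h q *\<^sub>R Y q) p = dir_deriv M h p (X p) *\<^sub>R Y p + h p *\<^sub>R D X Y p)))"

definition torsion_free ::
    "('a, 'e::euclidean_space) manifold \<Rightarrow> ('a, 'e) connection \<Rightarrow> bool" where
  "torsion_free M D \<longleftrightarrow>
     (\<forall>U X Y. openin (mtop M) U \<and> smooth_vf M U X \<and> smooth_vf M U Y \<longrightarrow>
        (\<forall>p\<in>U. D X Y p - D Y X p = lie_bracket M X Y p))"

definition curvature ::
    "('a, 'e::euclidean_space) manifold \<Rightarrow> ('a, 'e) connection
      \<Rightarrow> ('a \<Rightarrow> 'e) \<Rightarrow> ('a \<Rightarrow> 'e) \<Rightarrow> ('a \<Rightarrow> 'e) \<Rightarrow> 'a \<Rightarrow> 'e" where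
  "curvature M D X Y Z p = D X (D Y Z) p - D Y (D X Z) p - D (lie_bracket M X Y) Z p"

definition flat_connection ::
    "('a, 'e::euclidean_space) manifold \<Rightarrow> ('a, 'e) connection \<Rightarrow> bool" where
  "flat_connection M D \<longleftrightarrow>
     (\<forall>U X Y Z. openin (mtop M) U \<and> smooth_vf M U X \<and> smooth_vf M U Y \<and> smooth_vf M U Z \<longrightarrow>
        (\<forall>p\<in>U. curvature M D X Y Z p = 0))"

definition cov_deriv_metric ::
    "('a, 'e::euclidean_space) manifold \<Rightarrow> ('a, 'e) metric \<Rightarrow> ('a, 'e) connection
      \<Rightarrow> ('a \<Rightarrow> 'e) \<Rightarrow> ('a \<Rightarrow> 'e) \<Rightarrow> ('a \<Rightarrow> 'e) \<Rightarrow> 'a \<Rightarrow> real" where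
  "cov_deriv_metric M g D X Y Z p =
     dir_deriv M (\<lambda>q. g q (Y q) (Z q)) p (X p) - g p (D X Y p) (Z p) - g p (Y p) (D X Z p)"

text \<open>Total symmetry is required for the two transpositions that generate all permutations.\<close>

definition statistical_manifold ::
    "('a, 'e::euclidean_space) manifold \<Rightarrow> ('a, 'e) metric \<Rightarrow> ('a, 'e) connection \<Rightarrow> bool" where
  "statistical_manifold M g D \<longleftrightarrow>
     smooth_manifold M \<and> riemannian_metric M g \<and> affine_connection M D \<and> torsion_free M D \<and>
     (\<forall>U X Y Z. openin (mtop M) U \<and> smooth_vf M U X \<and> smooth_vf M U Y \<and> smooth_vf M U Z \<longrightarrow>
        (\<forall>p\<in>U. cov_deriv_metric M g D X Y Z p = cov_deriv_metric M g D Y X Z p \<and>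
                cov_deriv_metric M g D X Y Z p = cov_deriv_metric M g D X Z Y p))"

definition flat_statistical_manifold ::
    "('a, 'e::euclidean_space) manifold \<Rightarrow> ('a, 'e) metric \<Rightarrow> ('a, 'e) connection \<Rightarrow> bool" where
  "flat_statistical_manifold M g D \<longleftrightarrow> statistical_manifold M g D \<and> flat_connection M D"

definition is_dual_connection ::
    "('a, 'e::euclidean_space) manifold \<Rightarrow> ('a, 'e) metric \<Rightarrow> ('a, 'e) connection
      \<Rightarrow> ('a, 'e) connection \<Rightarrow> bool" where
  "is_dual_connection M g D D' \<longleftrightarrow>
     affine_connection M D' \<and>
     (\<forall>U X Y Z. openin (mtop M) U \<and> smooth_vf M U X \<and> smooth_vf M U Y \<and> smooth_vf M U Z \<longrightarrow>
        (\<forall>p\<in>U. dir_deriv M (\<lambda>q. g q (Y q) (Z q)) p (X p) =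
                g p (D X Y p) (Z p) + g p (Y p) (D' X Z p)))"

text \<open>On smooth vector fields the dual connection is unique; the choice only concerns the
  irrelevant values elsewhere.\<close>

definition dual_connection ::
    "('a, 'e::euclidean_space) manifold \<Rightarrow> ('a, 'e) metric \<Rightarrow> ('a, 'e) connection
      \<Rightarrow> ('a, 'e) connection" where
  "dual_connection M g D = (SOME D'. is_dual_connection M g D D')"

definition alpha_connection ::
    "real \<Rightarrow> ('a, 'e::euclidean_space) manifold \<Rightarrow> ('a, 'e) metric \<Rightarrow> ('a, 'e) connection
      \<Rightarrow> ('a, 'e) connection" where
  "alpha_connection \<alpha> M g D X Y p =
     ((1 + \<alpha>) / 2) *\<^sub>R D X Y p + ((1 - \<alpha>) / 2) *\<^sub>R dual_connection M g D X Y p"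


section \<open>Statistical embeddings\<close>

text \<open>A section of the pullback bundle along \<open>f\<close> is a map \<open>W\<close> sending \<open>p\<close> to a tangent vector at
  \<open>f p\<close>.  In a chart of \<open>S\<close> around \<open>f p\<close> the pulled-back connection is given by
  $(D_X W)^a = X(W^a) + \Gamma^a_{bc} (f_* X)^b W^c$.  The Christoffel term is the value at \<open>f p\<close> of
  the covariant derivative of the fields with constant components $W^c(p)$ along $(f_* X)^b(p)$.\<close>

definition pullback_connection ::
    "('a, 'e::euclidean_space) manifold \<Rightarrow> ('s, 'n::euclidean_space) manifold
      \<Rightarrow> ('s, 'n) connection \<Rightarrow> ('a \<Rightarrow> 's) \<Rightarrow> ('a \<Rightarrow> 'e) \<Rightarrow> ('a \<Rightarrow> 'n) \<Rightarrow> 'a \<Rightarrow> 'n" where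
  "pullback_connection M S E f X W p =
     (let d = chart_at S (f p) in
        dir_deriv M (\<lambda>q. comps S d (f q) (W q)) p (X p) +
        E (coord_field S d (differential M S f p (X p))) (coord_field S d (W p)) (f p))"

definition smooth_embedding ::
    "('a, 'e::euclidean_space) manifold \<Rightarrow> 'a set \<Rightarrow> ('s, 'n::euclidean_space) manifold
      \<Rightarrow> ('a \<Rightarrow> 's) \<Rightarrow> bool" where
  "smooth_embedding M U S f \<longleftrightarrow>
     smooth_map M U S f \<and> (\<forall>p\<in>U. inj (differential M S f p)) \<and>
     embedding_map (subtopology (mtop M) U) (mtop S) f"

definition statistical_embedding ::
    "('a, 'e::euclidean_space) manifold \<Rightarrow> ('a, 'e) metric \<Rightarrow> ('a, 'e) connection \<Rightarrow> 'a set
      \<Rightarrow> ('s, 'n::euclidean_space) manifold \<Rightarrow> ('s, 'n) metric \<Rightarrow> ('s, 'n) connection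
      \<Rightarrow> ('a \<Rightarrow> 's) \<Rightarrow> bool" where
  "statistical_embedding M g D U S G E f \<longleftrightarrow>
     smooth_embedding M U S f \<and>
     (\<forall>X Y Z. smooth_vf M U X \<and> smooth_vf M U Y \<and> smooth_vf M U Z \<longrightarrow>
        (\<forall>p\<in>U.
           g p (X p) (Y p) =
             G (f p) (differential M S f p (X p)) (differential M S f p (Y p)) \<and>
           g p (D X Y p) (Z p) =
             G (f p) (pullback_connection M S E f X (\<lambda>q. differential M S f q (Y q)) p)
                     (differential M S f p (Z p))))"

text \<open>The first argument only fixes the type of the points and the model space of the ambient
  manifolds \<open>S\<close>, as HOL cannot quantify existentially over types.  A manifold is second countable,
  so it has at most the cardinality of the continuum; hence up to diffeomorphism every manifold
  modelled on \<open>'n\<close> has its points in \<open>'n\<close>, and \<open>TYPE(('n, 'n) manifold)\<close> is no restriction.\<close>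

definition locally_embeddable ::
    "('s, 'n::euclidean_space) manifold itself \<Rightarrow> nat
      \<Rightarrow> ('a, 'e::euclidean_space) manifold \<Rightarrow> ('a, 'e) metric \<Rightarrow> ('a, 'e) connection \<Rightarrow> bool" where
  "locally_embeddable T N M g D \<longleftrightarrow>
     statistical_manifold M g D \<and> DIM('n) = N \<and>
     (\<forall>x\<in>topspace (mtop M). \<exists>U (S :: ('s, 'n) manifold) G E f.
        openin (mtop M) U \<and> x \<in> U \<and> flat_statistical_manifold S G E \<and>
        statistical_embedding M g D U S G E f)"

end

theory Submission
  imports Defs
begin

text \<open>A flat statistical manifold of dimension \<open>N\<close> has local affine coordinates \<open>u\<close> in which the metric is the
  Hessian of a potential \<open>\<Psi>\<close>; both come from an integrable linear first-order system.  Let \<open>\<eta>\<close> be the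
  gradient of \<open>\<Psi>\<close>.  Pulling \<open>u\<close> and \<open>\<eta>\<close> back to \<open>M\<close> gives \<open>g(\<nabla>\<^sub>X Y, Z) = XYu \<bullet> Z\<eta>\<close>, and by duality
  \<open>g(\<nabla>\<^sup>*\<^sub>X Y, Z) = XY\<eta> \<bullet> Zu\<close>.  For \<open>\<beta> = (1 - \<alpha>)/2\<close> and large \<open>K\<close>, the Hessian of
  \<open>(1 - 2\<beta>) \<Psi>(y) + \<beta> y \<bullet> v + K/2 |v - \<eta>(y)|\<^sup>2\<close> is positive definite near a given point of the graph of
  \<open>\<eta>\<close> in the \<open>2N\<close>-dimensional space, and \<open>(u, \<eta>)\<close> is an embedding that induces
  \<open>(1 - \<beta>) XYu \<bullet> Z\<eta> + \<beta> XY\<eta> \<bullet> Zu\<close>, which is \<open>g(\<nabla>\<^sup>(\<^sup>\<alpha>\<^sup>)\<^sub>X Y, Z)\<close>.\<close>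

section \<open>Calculus of smooth maps\<close>

text \<open>Second derivatives of \<open>(u, \<eta>)\<close> along \<open>M\<close> are not tangent
  to the graph, but the other slot of the Hessian that computes the induced connection always holds
  the tangent vector \<open>(Zu, Z\<eta>)\<close>. So a form that vanishes as soon as one argument
  is tangent to the graph changes nothing, and the Hessian of the square of
  \<open>v - \<eta>(y)\<close> is such a form there. Some such term is necessary: without it the
  Hessian vanishes on pairs of vertical vectors. The term \<open>\<beta> y \<bullet> v\<close>
  supplies \<open>XYu \<bullet> Z\<eta> + XY\<eta> \<bullet> Zu\<close> with weight \<beta>, and
  \<open>1 - 2\<beta>\<close> is forced by the metric, to which this term contributes
  \<open>2\<beta> g\<close>. Only a neighbourhood of one point of the graph matters, so the ambient
  space is an open set of Euclidean space with the ordinary derivative as connection. Two features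
  of the definitions shape the rest. Connections act on fields over all open sets, while an
  embedding is tested only on fields smooth on all of \<open>U\<close>; bump functions bridge the
  gap. Tangent vectors are components in a chart that may jump with the point, so smoothness is
  always proved in a fixed chart.\<close>

abbreviation dd :: "('e::euclidean_space \<Rightarrow> 'b::real_normed_vector) \<Rightarrow> 'e \<Rightarrow> 'e \<Rightarrow> 'b" where
  "dd f x \<equiv> frechet_derivative f (at x)"

text \<open>Holds for non-differentiable functions too: \<open>frechet_derivative\<close> is a
  choice from the predicate \<open>has_derivative\<close>, and that predicate depends only on the
  germ at \<open>x\<close>.\<close>

lemma dd_cong:
  assumes "open S" "x \<in> S" "\<And>y. y \<in> S \<Longrightarrow> f y = g y"
  shows "dd f x = dd g x"
proof -
  have "(f has_derivative f') (at x) \<longleftrightarrow> (g has_derivative f') (at x)" for f'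
    using has_derivative_transform_within_open[of f f' x UNIV S g]
      has_derivative_transform_within_open[of g f' x UNIV S f] assms by auto
  then show ?thesis by (simp add: frechet_derivative_def)
qed

lemma differentiable_cong_open:
  assumes "open S" "x \<in> S" "\<And>y. y \<in> S \<Longrightarrow> f y = g y"
  shows "f differentiable (at x) \<longleftrightarrow> g differentiable (at x)"
  using has_derivative_transform_within_open[of f _ x UNIV S g]
      has_derivative_transform_within_open[of g _ x UNIV S f] assms
  by (auto simp: differentiable_def) 

lemma dd_eq: "(f has_derivative f') (at x) \<Longrightarrow> dd f x v = f' v"
  using frechet_derivative_at by metis

lemma has_derivative_dd: "f differentiable (at x) \<Longrightarrow> (f has_derivative dd f x) (at x)"
  by (simp add: frechet_derivative_works)

lemma linear_dd: "f differentiable (at x) \<Longrightarrow> linear (dd f x)"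
  by (simp add: linear_frechet_derivative)

section \<open>Closure properties of the classes C^k\<close>

lemma Ck_on_Suc_imp: "Ck_on (Suc k) S f \<Longrightarrow> Ck_on k S f"
proof (induction k arbitrary: f)
  case 0
  then show ?case
    by (auto intro!: differentiable_imp_continuous_on differentiable_at_imp_differentiable_on)
next
  case (Suc k)
  then show ?case by (metis Ck_on.simps(2))
qed

lemma Ck_on_continuous: "Ck_on k S f \<Longrightarrow> continuous_on S f"
proof (induction k)
  case (Suc k)
  then show ?case using Ck_on_Suc_imp by blast
qed simp

lemma Ck_on_subset: "Ck_on k S f \<Longrightarrow> T \<subseteq> S \<Longrightarrow> Ck_on k T f"
  by (induction k arbitrary: f) (auto intro: continuous_on_subset)

lemma Ck_on_cong:
  assumes "open S" "\<And>y. y \<in> S \<Longrightarrow> f y = g y" "Ck_on k S f"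
  shows "Ck_on k S g"
  using assms(2,3)
proof (induction k arbitrary: f g)
  case 0
  then show ?case using continuous_on_cong[of S S f g] by simp
next
  case (Suc k)
  have "g differentiable (at x)" if "x \<in> S" for x
    using Suc.prems differentiable_cong_open[OF assms(1) that, of f g] that by simp
  moreover have "Ck_on k S (\<lambda>x. dd g x v)" for v
  proof (rule Suc.IH)
    show "dd f x v = dd g x v" if "x \<in> S" for x
      using dd_cong[OF assms(1) that, of f g] Suc.prems(1) by simp
    show "Ck_on k S (\<lambda>x. dd f x v)" using Suc.prems(2) by simp
  qed
  ultimately show ?case by simp
qed

lemma Ck_on_local:
  assumes "\<And>x. x \<in> S \<Longrightarrow> \<exists>T. open T \<and> x \<in> T \<and> Ck_on k T f"
  shows "Ck_on k S f"
  using assms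
proof (induction k arbitrary: f)
  case 0
  have "isCont f x" if "x \<in> S" for x
    using 0[OF that] by (auto simp: continuous_on_eq_continuous_at)
  then show ?case by (simp add: continuous_at_imp_continuous_on)
next
  case (Suc k)
  have "f differentiable (at x)" if "x \<in> S" for x
    using Suc.prems[OF that] by auto
  moreover have "Ck_on k S (\<lambda>x. dd f x v)" for v
    using Suc.prems by (intro Suc.IH) fastforce
  ultimately show ?case by simp
qed

lemma Ck_on_const: "Ck_on k S (\<lambda>x. c)"
  by (induction k arbitrary: c) auto

lemma Ck_on_linear:
  assumes "bounded_linear L"
  shows "Ck_on k S L"
proof (cases k)
  case 0
  then show ?thesis using assms by (simp add: linear_continuous_on)
next
  case (Suc n)
  have "(L has_derivative L) (at x)" for x
    using assms by (simp add: bounded_linear_imp_has_derivative)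
  then have "dd L x v = L v" for x v by (rule dd_eq)
  then show ?thesis using assms Suc
    by (auto simp: Ck_on_const intro: bounded_linear_imp_differentiable)
qed

text \<open>The pattern of all closure lemmas: the derivative is computed at each point, its formula
  is again an instance of the lemma, and openness of \<open>S\<close> allows
  \<open>Ck_on_cong\<close> to replace the derivative by the formula. The induction on
  \<open>k\<close> therefore leaves the functions arbitrary.\<close>

lemma Ck_on_linear_compose:
  assumes "bounded_linear L" "open S" "Ck_on k S f"
  shows "Ck_on k S (\<lambda>x. L (f x))"
  using assms(3)
proof (induction k arbitrary: f)
  case 0
  then show ?case using assms(1) by (simp add: bounded_linear.continuous_on)
next
  case (Suc k)
  have d: "((\<lambda>x. L (f x)) has_derivative (\<lambda>v. L (dd f x v))) (at x)" if "x \<in> S" for x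
    using Suc.prems that
    by (intro bounded_linear.has_derivative[OF assms(1)] has_derivative_dd) auto
  have "Ck_on k S (\<lambda>x. dd (\<lambda>x. L (f x)) x v)" for v
  proof (rule Ck_on_cong[OF assms(2)])
    show "L (dd f x v) = dd (\<lambda>x. L (f x)) x v" if "x \<in> S" for x
      using dd_eq[OF d[OF that]] by simp
    show "Ck_on k S (\<lambda>x. L (dd f x v))" using Suc.prems by (intro Suc.IH) simp
  qed
  then show ?case using d by (auto simp: differentiable_def)
qed

lemma Ck_on_add:
  assumes "open S" "Ck_on k S f" "Ck_on k S g"
  shows "Ck_on k S (\<lambda>x. f x + g x)"
  using assms(2,3)
proof (induction k arbitrary: f g)
  case 0
  then show ?case by (simp add: continuous_on_add)
next
  case (Suc k)
  have d: "((\<lambda>x. f x + g x) has_derivative (\<lambda>v. dd f x v + dd g x v)) (at x)" if "x \<in> S" for x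
    using Suc.prems that by (intro has_derivative_add has_derivative_dd) auto
  have "Ck_on k S (\<lambda>x. dd (\<lambda>x. f x + g x) x v)" for v
  proof (rule Ck_on_cong[OF assms(1)])
    show "dd f x v + dd g x v = dd (\<lambda>x. f x + g x) x v" if "x \<in> S" for x
      using dd_eq[OF d[OF that]] by simp
    show "Ck_on k S (\<lambda>x. dd f x v + dd g x v)" using Suc.prems by (intro Suc.IH) auto
  qed
  then show ?case using d by (auto simp: differentiable_def)
qed

lemma Ck_on_sum:
  assumes "open S" "\<And>i. i \<in> I \<Longrightarrow> Ck_on k S (f i)"
  shows "Ck_on k S (\<lambda>x. \<Sum>i\<in>I. f i x)"
  using assms(2)
  by (induction I rule: infinite_finite_induct)
    (auto simp: Ck_on_const intro: Ck_on_add[OF assms(1)])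

lemma Ck_on_bilinear:
  assumes "bounded_bilinear B" "open S" "Ck_on k S f" "Ck_on k S g"
  shows "Ck_on k S (\<lambda>x. B (f x) (g x))"
  using assms(3,4)
proof (induction k arbitrary: f g)
  case 0
  then show ?case using assms(1) by (simp add: bounded_bilinear.continuous_on)
next
  case (Suc k)
  have d: "((\<lambda>x. B (f x) (g x)) has_derivative (\<lambda>v. B (f x) (dd g x v) + B (dd f x v) (g x))) (at x)"
    if "x \<in> S" for x
    using Suc.prems that by (intro bounded_bilinear.FDERIV[OF assms(1)] has_derivative_dd) auto
  have "Ck_on k S (\<lambda>x. dd (\<lambda>x. B (f x) (g x)) x v)" for v
  proof (rule Ck_on_cong[OF assms(2)])
    show "B (f x) (dd g x v) + B (dd f x v) (g x) = dd (\<lambda>x. B (f x) (g x)) x v" if "x \<in> S" for x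
      using dd_eq[OF d[OF that]] by simp
    show "Ck_on k S (\<lambda>x. B (f x) (dd g x v) + B (dd f x v) (g x))"
      \<comment> \<open>Each product of the Leibniz rule contains one undifferentiated factor, which
        has to be lowered to class C^k.\<close>
      using Suc.prems Ck_on_Suc_imp[OF Suc.prems(1)] Ck_on_Suc_imp[OF Suc.prems(2)]
      by (intro Ck_on_add[OF assms(2)] Suc.IH) simp_all
  qed
  then show ?case using d by (auto simp: differentiable_def)
qed

lemma linear_expand:
  fixes L :: "'e::euclidean_space \<Rightarrow> 'b::real_vector"
  assumes "linear L"
  shows "L v = (\<Sum>b\<in>Basis. (v \<bullet> b) *\<^sub>R L b)"
proof -
  have "L v = L (\<Sum>b\<in>Basis. (v \<bullet> b) *\<^sub>R b)" by (simp add: euclidean_representation)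
  also have "\<dots> = (\<Sum>b\<in>Basis. (v \<bullet> b) *\<^sub>R L b)"
    using assms by (simp add: linear_sum linear_scale)
  finally show ?thesis .
qed

text \<open>Operator-valued maps are avoided: a family of linear maps is controlled by its finitely
  many values on basis vectors, which turns evaluation at a varying vector into a finite sum of
  products.\<close>

lemma Ck_on_linear_family:
  fixes L :: "'e::euclidean_space \<Rightarrow> 'd::euclidean_space \<Rightarrow> 'b::real_normed_vector"
  assumes "open S" "\<And>x. x \<in> S \<Longrightarrow> linear (L x)" "\<And>v. Ck_on k S (\<lambda>x. L x v)" "Ck_on k S w"
  shows "Ck_on k S (\<lambda>x. L x (w x))"
proof (rule Ck_on_cong[OF assms(1)])
  show "(\<Sum>b\<in>Basis. (w x \<bullet> b) *\<^sub>R L x b) = L x (w x)" if "x \<in> S" for x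
    by (rule linear_expand[OF assms(2)[OF that], symmetric])
  show "Ck_on k S (\<lambda>x. \<Sum>b\<in>Basis. (w x \<bullet> b) *\<^sub>R L x b)"
    using assms bounded_bilinear_scaleR bounded_linear_inner_left
    by (intro Ck_on_sum Ck_on_bilinear[of scaleR] Ck_on_linear_compose[of "\<lambda>x. x \<bullet> b" for b]) auto
qed

text \<open>The chain rule writes the derivative as the linear family \<open>dd g (f x)\<close>
  applied to \<open>dd f x v\<close>; the induction hypothesis for the outer map \<open>dd g\<close>
  makes the coefficients C^k.\<close>

lemma Ck_on_compose:
  fixes f :: "'e::euclidean_space \<Rightarrow> 'd::euclidean_space"
  assumes "open S" "open T" "f ` S \<subseteq> T" "Ck_on k S f" "Ck_on k T g"
  shows "Ck_on k S (\<lambda>x. g (f x))"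
  using assms(4,5)
proof (induction k arbitrary: g)
  case 0
  then show ?case using assms(3) by (auto intro: continuous_on_compose2)
next
  case (Suc k)
  have d: "((\<lambda>x. g (f x)) has_derivative (\<lambda>v. dd g (f x) (dd f x v))) (at x)" if "x \<in> S" for x
  proof (rule has_derivative_compose[of f "dd f x" x UNIV g "dd g (f x)"])
    show "(f has_derivative dd f x) (at x)" using Suc.prems that by (simp add: has_derivative_dd)
    have "f x \<in> T" using assms(3) that by blast
    then show "(g has_derivative dd g (f x)) (at (f x))" using Suc.prems by (simp add: has_derivative_dd)
  qed
  have "Ck_on k S (\<lambda>x. dd (\<lambda>x. g (f x)) x v)" for v
  proof (rule Ck_on_cong[OF assms(1)])
    show "dd g (f x) (dd f x v) = dd (\<lambda>x. g (f x)) x v" if "x \<in> S" for x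
      using dd_eq[OF d[OF that]] by simp
    show "Ck_on k S (\<lambda>x. dd g (f x) (dd f x v))"
    proof (rule Ck_on_linear_family[OF assms(1)])
      show "linear (dd g (f x))" if "x \<in> S" for x
        using Suc.prems that assms(3) by (intro linear_dd) auto
      show "Ck_on k S (\<lambda>x. dd g (f x) v)" for v
        using Suc.prems Ck_on_Suc_imp[OF Suc.prems(1)] by (intro Suc.IH) simp_all
      show "Ck_on k S (\<lambda>x. dd f x v)" using Suc.prems by simp
    qed
  qed
  then show ?case using d by (auto simp: differentiable_def)
qed

section \<open>Smooth maps and rules of differentiation\<close>

lemma smooth_on_continuous: "smooth_on S f \<Longrightarrow> continuous_on S f"
  using smooth_on_def Ck_on_continuous by blast

lemma smooth_on_differentiable: "smooth_on S f \<Longrightarrow> x \<in> S \<Longrightarrow> f differentiable (at x)"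
  unfolding smooth_on_def by (metis Ck_on.simps(2))

lemma smooth_on_has_derivative: "smooth_on S f \<Longrightarrow> x \<in> S \<Longrightarrow> (f has_derivative dd f x) (at x)"
  using smooth_on_differentiable has_derivative_dd by blast

lemma smooth_on_linear_dd: "smooth_on S f \<Longrightarrow> x \<in> S \<Longrightarrow> linear (dd f x)"
  using smooth_on_differentiable linear_dd by blast

lemma smooth_on_dd: "smooth_on S f \<Longrightarrow> smooth_on S (\<lambda>x. dd f x v)"
  unfolding smooth_on_def by (metis Ck_on.simps(2))

lemma smooth_on_subset: "smooth_on S f \<Longrightarrow> T \<subseteq> S \<Longrightarrow> smooth_on T f"
  unfolding smooth_on_def using Ck_on_subset by blast

lemma smooth_on_cong:
  "open S \<Longrightarrow> (\<And>y. y \<in> S \<Longrightarrow> f y = g y) \<Longrightarrow> smooth_on S f \<Longrightarrow> smooth_on S g"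
  unfolding smooth_on_def using Ck_on_cong by blast

lemma smooth_on_local:
  "(\<And>x. x \<in> S \<Longrightarrow> \<exists>T. open T \<and> x \<in> T \<and> smooth_on T f) \<Longrightarrow> smooth_on S f"
  unfolding smooth_on_def by (meson Ck_on_local)

lemma smooth_on_const: "smooth_on S (\<lambda>x. c)"
  unfolding smooth_on_def by (simp add: Ck_on_const)

lemma smooth_on_linear: "bounded_linear L \<Longrightarrow> smooth_on S L"
  unfolding smooth_on_def by (simp add: Ck_on_linear)

lemma smooth_on_linear_compose:
  "bounded_linear L \<Longrightarrow> open S \<Longrightarrow> smooth_on S f \<Longrightarrow> smooth_on S (\<lambda>x. L (f x))"
  unfolding smooth_on_def by (simp add: Ck_on_linear_compose)

lemma smooth_on_add:
  "open S \<Longrightarrow> smooth_on S f \<Longrightarrow> smooth_on S g \<Longrightarrow> smooth_on S (\<lambda>x. f x + g x)"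
  unfolding smooth_on_def by (simp add: Ck_on_add)

lemma smooth_on_sum:
  "open S \<Longrightarrow> (\<And>i. i \<in> I \<Longrightarrow> smooth_on S (f i)) \<Longrightarrow> smooth_on S (\<lambda>x. \<Sum>i\<in>I. f i x)"
  unfolding smooth_on_def by (simp add: Ck_on_sum)

lemma smooth_on_bilinear:
  "bounded_bilinear B \<Longrightarrow> open S \<Longrightarrow> smooth_on S f \<Longrightarrow> smooth_on S g
    \<Longrightarrow> smooth_on S (\<lambda>x. B (f x) (g x))"
  unfolding smooth_on_def by (simp add: Ck_on_bilinear)

lemmas smooth_on_inner = smooth_on_bilinear[OF bounded_bilinear_inner]

lemma smooth_on_minus:
  assumes "open S" "smooth_on S f" shows "smooth_on S (\<lambda>x. - f x)"
  using smooth_on_linear_compose[OF bounded_linear_minus[OF bounded_linear_ident] assms] .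

lemma smooth_on_diff:
  assumes "open S" "smooth_on S f" "smooth_on S g" shows "smooth_on S (\<lambda>x. f x - g x)"
  using smooth_on_add[OF assms(1,2) smooth_on_minus[OF assms(1,3)]] by simp

lemma smooth_on_linear_family:
  fixes L :: "'e::euclidean_space \<Rightarrow> 'd::euclidean_space \<Rightarrow> 'b::real_normed_vector"
  shows "open S \<Longrightarrow> (\<And>x. x \<in> S \<Longrightarrow> linear (L x)) \<Longrightarrow> (\<And>v. smooth_on S (\<lambda>x. L x v))
    \<Longrightarrow> smooth_on S w \<Longrightarrow> smooth_on S (\<lambda>x. L x (w x))"
  unfolding smooth_on_def by (simp add: Ck_on_linear_family)

lemma smooth_on_compose:
  fixes f :: "'e::euclidean_space \<Rightarrow> 'd::euclidean_space"
  shows "open S \<Longrightarrow> open T \<Longrightarrow> f ` S \<subseteq> T \<Longrightarrow> smooth_on S f \<Longrightarrow> smooth_on T g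
    \<Longrightarrow> smooth_on S (\<lambda>x. g (f x))"
  unfolding smooth_on_def by (simp add: Ck_on_compose)

lemma smooth_on_dd_family:
  "open S \<Longrightarrow> smooth_on S f \<Longrightarrow> smooth_on S w \<Longrightarrow> smooth_on S (\<lambda>x. dd f x (w x))"
  by (rule smooth_on_linear_family) (auto intro: smooth_on_linear_dd smooth_on_dd)

lemma dd_compose:
  assumes "f differentiable (at x)" "g differentiable (at (f x))"
  shows "dd (\<lambda>y. g (f y)) x v = dd g (f x) (dd f x v)"
  by (rule dd_eq, rule has_derivative_compose[OF has_derivative_dd has_derivative_dd]) (fact assms)+

lemma dd_bilinear:
  assumes "bounded_bilinear B" "f differentiable (at x)" "g differentiable (at x)"
  shows "dd (\<lambda>y. B (f y) (g y)) x v = B (f x) (dd g x v) + B (dd f x v) (g x)"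
  by (rule dd_eq) (intro bounded_bilinear.FDERIV[OF assms(1)] has_derivative_dd assms)

lemma dd_add:
  assumes "f differentiable (at x)" "g differentiable (at x)"
  shows "dd (\<lambda>y. f y + g y) x v = dd f x v + dd g x v"
  by (rule dd_eq) (intro has_derivative_add has_derivative_dd assms)

lemma dd_sum:
  assumes "\<And>i. i \<in> I \<Longrightarrow> f i differentiable (at x)"
  shows "dd (\<lambda>y. \<Sum>i\<in>I. f i y) x v = (\<Sum>i\<in>I. dd (f i) x v)"
  by (rule dd_eq) (intro has_derivative_sum has_derivative_dd assms)

lemma dd_linear:
  assumes "bounded_linear L" "f differentiable (at x)"
  shows "dd (\<lambda>y. L (f y)) x v = L (dd f x v)"
  by (rule dd_eq) (intro bounded_linear.has_derivative[OF assms(1)] has_derivative_dd assms)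

text \<open>The Leibniz rule for evaluation. In the first summand the argument is frozen at
  \<open>w x\<close>, so only the operator is differentiated; in the second only the argument
  is.\<close>

lemma dd_linear_family:
  fixes L :: "'e::euclidean_space \<Rightarrow> 'd::euclidean_space \<Rightarrow> 'b::real_normed_vector"
  assumes "open S" "x \<in> S" "\<And>y. y \<in> S \<Longrightarrow> linear (L y)"
    "\<And>v. (\<lambda>y. L y v) differentiable (at x)" "w differentiable (at x)"
  shows "dd (\<lambda>y. L y (w y)) x v = dd (\<lambda>y. L y (w x)) x v + L x (dd w x v)"
    "(\<lambda>y. L y (w y)) differentiable (at x)"
proof -
  have wb: "((\<lambda>y. w y \<bullet> b) has_derivative (\<lambda>v. dd w x v \<bullet> b)) (at x)" for b
    by (rule bounded_linear.has_derivative[OF bounded_linear_inner_left has_derivative_dd[OF assms(5)]])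
  have d: "((\<lambda>y. \<Sum>b\<in>Basis. (w y \<bullet> b) *\<^sub>R L y b) has_derivative
      (\<lambda>v. \<Sum>b\<in>Basis. (w x \<bullet> b) *\<^sub>R dd (\<lambda>y. L y b) x v + (dd w x v \<bullet> b) *\<^sub>R L x b)) (at x)"
    by (intro has_derivative_sum has_derivative_scaleR wb has_derivative_dd assms)
  then have "((\<lambda>y. L y (w y)) has_derivative
      (\<lambda>v. \<Sum>b\<in>Basis. (w x \<bullet> b) *\<^sub>R dd (\<lambda>y. L y b) x v + (dd w x v \<bullet> b) *\<^sub>R L x b)) (at x)"
    by (rule has_derivative_transform_within_open[OF _ assms(1,2)])
      (simp add: linear_expand[OF assms(3)])
  moreover
  have "((\<lambda>y. \<Sum>b\<in>Basis. (w x \<bullet> b) *\<^sub>R L y b) has_derivative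
      (\<lambda>v. \<Sum>b\<in>Basis. (w x \<bullet> b) *\<^sub>R dd (\<lambda>y. L y b) x v)) (at x)"
    by (intro has_derivative_sum has_derivative_scaleR_right has_derivative_dd assms)
  then have "((\<lambda>y. L y (w x)) has_derivative
      (\<lambda>v. \<Sum>b\<in>Basis. (w x \<bullet> b) *\<^sub>R dd (\<lambda>y. L y b) x v)) (at x)"
    by (rule has_derivative_transform_within_open[OF _ assms(1,2)])
      (simp add: linear_expand[OF assms(3)])
  ultimately show "dd (\<lambda>y. L y (w y)) x v = dd (\<lambda>y. L y (w x)) x v + L x (dd w x v)"
    "(\<lambda>y. L y (w y)) differentiable (at x)"
    by (auto simp: dd_eq sum.distrib linear_expand[OF assms(3)[OF assms(2)], of "dd w x v"]
        differentiable_def)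
qed

section \<open>Symmetry of second derivatives\<close>

lemma second_difference:
  fixes f :: "'e::euclidean_space \<Rightarrow> real"
  assumes "Ck_on 2 (ball x r) f" "0 < h" "h * (norm v + norm w) < r"
  shows "\<exists>\<xi>. norm (\<xi> - x) \<le> h * (norm v + norm w) \<and>
    f (x + h *\<^sub>R v + h *\<^sub>R w) - f (x + h *\<^sub>R v) - (f (x + h *\<^sub>R w) - f x)
      = h * h * dd (\<lambda>y. dd f y v) \<xi> w"
proof -
  have f1: "f differentiable (at y)" "(\<lambda>y. dd f y v) differentiable (at y)" if "y \<in> ball x r" for y
    using assms(1) that by (auto simp: numeral_2_eq_2)
  have inb: "x + s *\<^sub>R v + t *\<^sub>R w \<in> ball x r \<and> norm (x + s *\<^sub>R v + t *\<^sub>R w - x) \<le> h * (norm v + norm w)"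
    if "0 \<le> s" "s \<le> h" "0 \<le> t" "t \<le> h" for s t
  proof -
    have "norm (x + s *\<^sub>R v + t *\<^sub>R w - x) \<le> norm (s *\<^sub>R v) + norm (t *\<^sub>R w)"
      by (metis add.assoc add_diff_cancel_left' norm_triangle_ineq)
    also have "\<dots> = s * norm v + t * norm w" using that by simp
    also have "\<dots> \<le> h * (norm v + norm w)"
      using that by (simp add: distrib_left add_mono mult_right_mono)
    finally have n: "norm (x + s *\<^sub>R v + t *\<^sub>R w - x) \<le> h * (norm v + norm w)" .
    then have "dist (x + s *\<^sub>R v + t *\<^sub>R w) x < r" using assms(3) unfolding dist_norm by linarith
    then show ?thesis using n by (metis dist_commute mem_ball)
  qed
  \<comment> \<open>The vacuous \<open>0 *\<^sub>R w\<close> gives both terms the shape treated by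
    \<open>d1\<close>, with \<open>t = h\<close> and \<open>t = 0\<close>. The mean value theorem is
    applied to \<open>\<phi>\<close> in the direction \<open>v\<close>, and afterwards to its
    derivative in the direction \<open>w\<close>.\<close>
  define \<phi> where "\<phi> s = f (x + s *\<^sub>R v + h *\<^sub>R w) - f (x + s *\<^sub>R v + 0 *\<^sub>R w)" for s
  have d1: "((\<lambda>s. f (x + s *\<^sub>R v + t *\<^sub>R w)) has_real_derivative dd f (x + s *\<^sub>R v + t *\<^sub>R w) v) (at s)"
    if "0 \<le> s" "s \<le> h" "0 \<le> t" "t \<le> h" for s t
  proof -
    have "((\<lambda>s. f (x + s *\<^sub>R v + t *\<^sub>R w)) has_derivative (\<lambda>z. dd f (x + s *\<^sub>R v + t *\<^sub>R w) (z *\<^sub>R v))) (at s)"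
      using inb[OF that] f1(1)
      by (intro has_derivative_compose[OF _ has_derivative_dd]) (auto intro!: derivative_eq_intros)
    then show ?thesis using linear_dd[OF f1(1)] inb[OF that]
      by (simp add: has_field_derivative_def linear_scale mult_commute_abs)
  qed
  obtain s where s: "0 < s" "s < h"
    "\<phi> h - \<phi> 0 = (h - 0) * (dd f (x + s *\<^sub>R v + h *\<^sub>R w) v - dd f (x + s *\<^sub>R v + 0 *\<^sub>R w) v)"
    using MVT2[of 0 h \<phi> "\<lambda>s. dd f (x + s *\<^sub>R v + h *\<^sub>R w) v - dd f (x + s *\<^sub>R v + 0 *\<^sub>R w) v"] assms(2)
    unfolding \<phi>_def by (fastforce intro!: DERIV_diff d1)
  have d2: "((\<lambda>t. dd f (x + s *\<^sub>R v + t *\<^sub>R w) v) has_real_derivative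
      dd (\<lambda>y. dd f y v) (x + s *\<^sub>R v + t *\<^sub>R w) w) (at t)" if "0 \<le> t" "t \<le> h" for t
  proof -
    have "((\<lambda>t. (\<lambda>y. dd f y v) (x + s *\<^sub>R v + t *\<^sub>R w)) has_derivative
        (\<lambda>z. dd (\<lambda>y. dd f y v) (x + s *\<^sub>R v + t *\<^sub>R w) (z *\<^sub>R w))) (at t)"
      using inb[of s t] f1(2) s that
      by (intro has_derivative_compose[OF _ has_derivative_dd]) (auto intro!: derivative_eq_intros)
    then show ?thesis using linear_dd[OF f1(2)] inb[of s t] that s
      by (simp add: has_field_derivative_def linear_scale mult_commute_abs)
  qed
  obtain t where t: "0 < t" "t < h"
    "dd f (x + s *\<^sub>R v + h *\<^sub>R w) v - dd f (x + s *\<^sub>R v + 0 *\<^sub>R w) v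
      = (h - 0) * dd (\<lambda>y. dd f y v) (x + s *\<^sub>R v + t *\<^sub>R w) w"
    using MVT2[of 0 h "\<lambda>t. dd f (x + s *\<^sub>R v + t *\<^sub>R w) v"] assms(2) d2 by fastforce
  show ?thesis
    using inb[of s t] s t
    by (intro exI[of _ "x + s *\<^sub>R v + t *\<^sub>R w"]) (auto simp: \<phi>_def)
qed

text \<open>The second difference is unchanged when \<open>v\<close> and \<open>w\<close> are
  exchanged, so \<open>second_difference\<close> makes the two mixed derivatives agree at two points
  close to \<open>x\<close>. If they differed at \<open>x\<close>, continuity would keep both values
  within half the gap of their values at \<open>x\<close>, and they could not be equal.\<close>

lemma symmetric_second_derivative_real:
  fixes f :: "'e::euclidean_space \<Rightarrow> real"
  assumes "open S" "smooth_on S f" "x \<in> S"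
  shows "dd (\<lambda>y. dd f y v) x w = dd (\<lambda>y. dd f y w) x v"
proof (rule ccontr)
  let ?a = "\<lambda>y. dd (\<lambda>y. dd f y v) y w" and ?b = "\<lambda>y. dd (\<lambda>y. dd f y w) y v"
  assume "?a x \<noteq> ?b x"
  define e where "e = \<bar>?a x - ?b x\<bar> / 2"
  have e: "e > 0" using \<open>?a x \<noteq> ?b x\<close> by (simp add: e_def)
  have "continuous_on S ?a" "continuous_on S ?b"
    using assms by (auto intro!: smooth_on_continuous smooth_on_dd)
  then have "isCont ?a x" "isCont ?b x"
    using assms by (auto simp: continuous_on_eq_continuous_at)
  then obtain d1 d2 where d: "d1 > 0" "d2 > 0"
    "\<And>y. dist y x < d1 \<Longrightarrow> dist (?a y) (?a x) < e" "\<And>y. dist y x < d2 \<Longrightarrow> dist (?b y) (?b x) < e"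
    using e unfolding continuous_at_eps_delta by metis
  obtain r where r: "r > 0" "ball x r \<subseteq> S" using assms openE by blast
  define m where "m = min r (min d1 d2)"
  \<comment> \<open>The summand 1 keeps the denominator positive for \<open>v = w = 0\<close>, and
    the factor 1/2 puts the intermediate points strictly inside the ball of radius
    \<open>m\<close>.\<close>
  define h where "h = m / (norm v + norm w + 1) / 2"
  have m: "m > 0" using d r by (simp add: m_def)
  define q where "q = norm v + norm w + 1"
  have q: "q > 0" "norm v + norm w < q" by (simp_all add: q_def add_nonneg_pos)
  have h: "h > 0" "h = m / q / 2" using m q by (simp_all add: h_def q_def)
  have "h * (norm v + norm w) < h * q" by (rule mult_strict_left_mono[OF q(2) h(1)])
  also have "\<dots> < m" using m q(1) h(2) by simp
  finally have hm: "h * (norm v + norm w) < m" .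
  then have hr: "h * (norm v + norm w) < r" by (simp add: m_def)
  have c: "Ck_on 2 (ball x r) f" using assms r Ck_on_subset unfolding smooth_on_def by blast
  obtain \<xi> where 1: "norm (\<xi> - x) < m" "f (x + h *\<^sub>R v + h *\<^sub>R w) - f (x + h *\<^sub>R v) - (f (x + h *\<^sub>R w) - f x)
      = h * h * ?a \<xi>"
    using second_difference[OF c h(1), of v w] hr hm by (auto intro: le_less_trans)
  obtain \<zeta> where 2: "norm (\<zeta> - x) < m" "f (x + h *\<^sub>R w + h *\<^sub>R v) - f (x + h *\<^sub>R w) - (f (x + h *\<^sub>R v) - f x)
      = h * h * ?b \<zeta>"
    using second_difference[OF c h(1), of w v] hr hm unfolding add.commute[of "norm w"]
    by (auto intro: le_less_trans)
  have "h * h * ?a \<xi> = h * h * ?b \<zeta>" using 1(2) 2(2) by (simp add: algebra_simps)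
  then have "?a \<xi> = ?b \<zeta>" using h(1) by simp
  moreover have "dist (?a \<xi>) (?a x) < e" "dist (?b \<zeta>) (?b x) < e"
    using d 1 2 by (auto simp: m_def dist_norm)
  ultimately show False by (auto simp: e_def dist_real_def abs_if split: if_splits)
qed

lemma symmetric_second_derivative:
  fixes f :: "'e::euclidean_space \<Rightarrow> 'b::euclidean_space"
  assumes "open S" "smooth_on S f" "x \<in> S"
  shows "dd (\<lambda>y. dd f y v) x w = dd (\<lambda>y. dd f y w) x v"
proof (rule euclidean_eqI)
  fix b :: 'b
  have *: "dd (\<lambda>y. dd f y v) x w \<bullet> b = dd (\<lambda>y. dd (\<lambda>z. f z \<bullet> b) y v) x w" for v w
  proof -
    have "dd (\<lambda>z. f z \<bullet> b) y v = dd f y v \<bullet> b" if "y \<in> S" for y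
      using smooth_on_differentiable[OF assms(2) that] by (rule dd_linear[OF bounded_linear_inner_left])
    then have "dd (\<lambda>y. dd (\<lambda>z. f z \<bullet> b) y v) x w = dd (\<lambda>y. dd f y v \<bullet> b) x w"
      using dd_cong[OF assms(1,3), of "\<lambda>y. dd (\<lambda>z. f z \<bullet> b) y v" "\<lambda>y. dd f y v \<bullet> b"] by simp
    also have "\<dots> = dd (\<lambda>y. dd f y v) x w \<bullet> b"
      using smooth_on_differentiable[OF smooth_on_dd[OF assms(2)] assms(3)]
      by (rule dd_linear[OF bounded_linear_inner_left])
    finally show ?thesis by simp
  qed
  show "dd (\<lambda>y. dd f y v) x w \<bullet> b = dd (\<lambda>y. dd f y w) x v \<bullet> b"
    unfolding * using assms
    by (intro symmetric_second_derivative_real[OF assms(1) _ assms(3)])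
      (auto intro: smooth_on_linear_compose[OF bounded_linear_inner_left])
qed

section \<open>Integrable systems of linear partial differential equations\<close>

lemma segment_in_ball:
  fixes x :: "'e::real_normed_vector"
  assumes "x \<in> ball x0 r" "0 \<le> t" "t \<le> 1"
  shows "x0 + t *\<^sub>R (x - x0) \<in> ball x0 r"
proof -
  have "norm (t *\<^sub>R (x - x0)) \<le> norm (x - x0)" using assms by (simp add: mult_left_le_one_le)
  then show ?thesis using assms by (simp add: dist_norm norm_minus_commute)
qed

lemma Ck_on_1:
  "Ck_on 1 S f \<longleftrightarrow> (\<forall>x\<in>S. f differentiable (at x)) \<and> (\<forall>v. continuous_on S (\<lambda>x. dd f x v))"
  by simp

text \<open>\<open>H\<close> is the homotopy operator of the Poincare lemma on a star-shaped domain,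
  and \<open>J x v t\<close> is \<open>t\<close> times the exterior derivative of \<omega> evaluated
  on \<open>v\<close> and \<open>x - x0\<close>. A closed form would make \<open>H\<close> a
  primitive of \<omega>; here the failure of closedness is kept as an explicit error term, because
  the Picard iterates satisfy the equation only approximately.\<close>

lemma poincare_homotopy:
  fixes \<omega> :: "'e::euclidean_space \<Rightarrow> 'e \<Rightarrow> 'y::euclidean_space" and x0 :: 'e and r :: real
  defines "B \<equiv> ball x0 r"
  assumes lin: "\<And>z. z \<in> B \<Longrightarrow> linear (\<omega> z)" and C1: "\<And>v. Ck_on 1 B (\<lambda>z. \<omega> z v)"
  defines "H \<equiv> (\<lambda>x. integral {0..1} (\<lambda>t. \<omega> (x0 + t *\<^sub>R (x - x0)) (x - x0)))"
  defines "J \<equiv> (\<lambda>x v t. t *\<^sub>R (dd (\<lambda>z. \<omega> z (x - x0)) (x0 + t *\<^sub>R (x - x0)) v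
                              - dd (\<lambda>z. \<omega> z v) (x0 + t *\<^sub>R (x - x0)) (x - x0)))"
  shows "x \<in> B \<Longrightarrow> (H has_derivative (\<lambda>v. \<omega> x v + integral {0..1} (J x v))) (at x)"
    and "x \<in> B \<Longrightarrow> continuous_on {0..1} (J x v)"
    and "Ck_on 1 B H"
proof -
  have seg: "x0 + t *\<^sub>R (x - x0) \<in> B" if "x \<in> B" "t \<in> {0..1}" for x t
    using that segment_in_ball[of x x0 r t] by (simp add: B_def)
  have oB: "open B" by (simp add: B_def)
  have diff: "(\<lambda>z. \<omega> z v) differentiable (at z)" if "z \<in> B" for z v
    using C1[of v] that by simp
  have cont: "continuous_on B (\<lambda>z. \<omega> z v)" "continuous_on B (\<lambda>z. dd (\<lambda>z. \<omega> z v) z w)" for v w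
    using C1[of v] Ck_on_continuous[OF C1[of v]] by auto
  have dlin: "dd (\<lambda>z. \<omega> z w) z v = (\<Sum>b\<in>Basis. (w \<bullet> b) *\<^sub>R dd (\<lambda>z. \<omega> z b) z v)" if "z \<in> B" for z v w
  proof -
    have "dd (\<lambda>z. \<omega> z w) z v = dd (\<lambda>z. \<Sum>b\<in>Basis. (w \<bullet> b) *\<^sub>R \<omega> z b) z v"
      by (rule dd_cong[OF oB that, THEN fun_cong]) (rule linear_expand[OF lin])
    also have "\<dots> = (\<Sum>b\<in>Basis. (w \<bullet> b) *\<^sub>R dd (\<lambda>z. \<omega> z b) z v)"
      by (rule dd_eq, intro has_derivative_sum has_derivative_scaleR_right has_derivative_dd diff that)
    finally show ?thesis .
  qed
  define F' where "F' x t v = t *\<^sub>R dd (\<lambda>z. \<omega> z (x - x0)) (x0 + t *\<^sub>R (x - x0)) v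
      + \<omega> (x0 + t *\<^sub>R (x - x0)) v" for x t v
  have contz: "continuous_on (B \<times> {0..1}) (\<lambda>(x, t). x0 + t *\<^sub>R (x - x0))"
    by (auto intro!: continuous_intros simp: case_prod_beta)
  have segim: "(\<lambda>(x, t). x0 + t *\<^sub>R (x - x0)) ` (B \<times> {0..1}) \<subseteq> B" using seg by auto
  have c1: "continuous_on (B \<times> {0..1}) (\<lambda>(x, t). \<omega> (x0 + t *\<^sub>R (x - x0)) v)" for v
    using continuous_on_compose2[OF cont(1) contz segim, of v] by (simp add: case_prod_beta)
  have c2: "continuous_on (B \<times> {0..1}) (\<lambda>(x, t). dd (\<lambda>z. \<omega> z w) (x0 + t *\<^sub>R (x - x0)) v)" for v w
    using continuous_on_compose2[OF cont(2) contz segim, of w v] by (simp add: case_prod_beta)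
  have c3: "continuous_on (B \<times> {0..1})
      (\<lambda>(x, t). dd (\<lambda>z. \<omega> z (x - x0)) (x0 + t *\<^sub>R (x - x0)) v)" for v
  proof -
    have "continuous_on (B \<times> {0..1})
      (\<lambda>p. \<Sum>b\<in>Basis. ((fst p - x0) \<bullet> b) *\<^sub>R dd (\<lambda>z. \<omega> z b) (x0 + snd p *\<^sub>R (fst p - x0)) v)"
      using c2[of _ v] by (intro continuous_intros) (simp add: case_prod_beta)
    then show ?thesis
      by (rule continuous_on_cong[THEN iffD1, OF refl, rotated])
        (use seg dlin in \<open>auto simp: case_prod_beta\<close>)
  qed
  have c4: "continuous_on (B \<times> {0..1}) (\<lambda>(x, t). F' x t v)" for v
    using c1[of v] c3[of v] unfolding F'_def case_prod_beta by (intro continuous_intros)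
  have c5: "continuous_on (B \<times> {0..1}) (\<lambda>(x, t). \<omega> (x0 + t *\<^sub>R (x - x0)) (x - x0))"
  proof -
    have "continuous_on (B \<times> {0..1})
      (\<lambda>p. \<Sum>b\<in>Basis. ((fst p - x0) \<bullet> b) *\<^sub>R \<omega> (x0 + snd p *\<^sub>R (fst p - x0)) b)"
      using c1 by (intro continuous_intros) (simp add: case_prod_beta)
    then show ?thesis
      by (rule continuous_on_cong[THEN iffD1, OF refl, rotated])
        (use seg linear_expand[OF lin] in \<open>auto simp: case_prod_beta\<close>)
  qed
  have slice: "continuous_on {0..1} (\<lambda>t. f x t)" if "continuous_on (B \<times> {0..1}) (\<lambda>(x, t). f x t)" "x \<in> B"
    for f :: "'e \<Rightarrow> real \<Rightarrow> 'y" and x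
  proof -
    have "continuous_on {0..1} (\<lambda>t. (x, t))"
      by (intro continuous_on_Pair continuous_on_const continuous_on_id)
    from continuous_on_compose2[OF that(1) this] that(2) show ?thesis by auto
  qed
  have blin: "bounded_linear (F' x t)" if "x \<in> B" "t \<in> {0..1}" for x t
    unfolding F'_def linear_conv_bounded_linear[symmetric]
    by (intro linear_compose_add linear_compose_scale_right linear_dd diff lin seg that)
  have dF: "((\<lambda>x. \<omega> (x0 + t *\<^sub>R (x - x0)) (x - x0)) has_derivative F' x t) (at x)"
    if "x \<in> B" "t \<in> {0..1}" for x t
  proof -
    let ?L = "\<lambda>y. \<omega> (x0 + t *\<^sub>R (y - x0))" and ?w = "\<lambda>y. y - x0"
    have aff: "((\<lambda>y. x0 + t *\<^sub>R (y - x0)) has_derivative (\<lambda>v. t *\<^sub>R v)) (at x)"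
      by (auto intro!: derivative_eq_intros)
    have dL: "((\<lambda>y. ?L y v) has_derivative (\<lambda>u. dd (\<lambda>z. \<omega> z v) (x0 + t *\<^sub>R (x - x0)) (t *\<^sub>R u))) (at x)" for v
      by (rule has_derivative_compose[OF aff, of "\<lambda>z. \<omega> z v"]) (intro has_derivative_dd diff seg that)
    have dw: "(?w has_derivative (\<lambda>v. v)) (at x)" by (auto intro!: derivative_eq_intros)
    have linL: "linear (?L y)" if "y \<in> B" for y by (rule lin[OF seg[OF that \<open>t \<in> {0..1}\<close>]])
    have diffL: "(\<lambda>y. ?L y v) differentiable (at x)" for v using dL unfolding differentiable_def by blast
    have diffw: "?w differentiable (at x)" using dw unfolding differentiable_def by blast
    note 1 = dd_linear_family(1)[of B x ?L ?w, OF oB that(1) linL diffL diffw]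
      and 2 = dd_linear_family(2)[of B x ?L ?w, OF oB that(1) linL diffL diffw]
    have "dd (\<lambda>y. ?L y (?w y)) x v = F' x t v" for v
      using 1[of v] dd_eq[OF dL, of "x - x0" v] dd_eq[OF dw, of v]
        linear_scale[OF linear_dd[OF diff[OF seg[OF that]]]] by (simp add: F'_def)
    then have "dd (\<lambda>y. ?L y (?w y)) x = F' x t" by (rule ext)
    then show ?thesis using has_derivative_dd[OF 2] by simp
  qed
  have intF: "integral {0..1} (\<lambda>t. F' x t v) = \<omega> x v + integral {0..1} (J x v)"
    and cJ: "continuous_on {0..1} (J x v)" if x: "x \<in> B" for x v
  proof -
    have s1: "continuous_on {0..1} (\<lambda>t. dd (\<lambda>z. \<omega> z v) (x0 + t *\<^sub>R (x - x0)) w)" for v w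
      using slice[OF c2 x] .
    show cJ: "continuous_on {0..1} (J x v)"
      unfolding J_def by (intro continuous_intros s1)
    \<comment> \<open>\<open>F'\<close> is the derivative of the integrand in \<open>x\<close>, and
      it splits as \<open>?g' + J\<close>. The part \<open>?g'\<close> is the derivative in
      \<open>t\<close> of \<open>?g\<close>, which runs from 0 to
      \<open>\<omega> x v\<close>.\<close>
    let ?g = "\<lambda>t. t *\<^sub>R \<omega> (x0 + t *\<^sub>R (x - x0)) v"
    let ?g' = "\<lambda>t. \<omega> (x0 + t *\<^sub>R (x - x0)) v + t *\<^sub>R dd (\<lambda>z. \<omega> z v) (x0 + t *\<^sub>R (x - x0)) (x - x0)"
    have "(?g has_vector_derivative ?g' t) (at t within {0..1})" if "t \<in> {0..1}" for t
    proof -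
      have aff: "((\<lambda>t. x0 + t *\<^sub>R (x - x0)) has_derivative (\<lambda>s. s *\<^sub>R (x - x0))) (at t)"
        by (auto intro!: derivative_eq_intros)
      have "((\<lambda>t. \<omega> (x0 + t *\<^sub>R (x - x0)) v) has_derivative
          (\<lambda>s. dd (\<lambda>z. \<omega> z v) (x0 + t *\<^sub>R (x - x0)) (s *\<^sub>R (x - x0)))) (at t)"
        by (rule has_derivative_compose[OF aff, of "\<lambda>z. \<omega> z v"]) (intro has_derivative_dd diff seg that x)
      then have "((\<lambda>t. \<omega> (x0 + t *\<^sub>R (x - x0)) v) has_vector_derivative
          dd (\<lambda>z. \<omega> z v) (x0 + t *\<^sub>R (x - x0)) (x - x0)) (at t)"
        unfolding has_vector_derivative_def
        using linear_scale[OF linear_dd[OF diff[OF seg[OF x that]]]] by simp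
      from has_vector_derivative_scaleR[OF DERIV_ident this] show ?thesis
        by (simp add: has_vector_derivative_at_within add.commute)
    qed
    then have g: "(?g' has_integral \<omega> x v) {0..1}"
      using fundamental_theorem_of_calculus[of 0 1 ?g ?g'] by simp
    have "((\<lambda>t. ?g' t + J x v t) has_integral \<omega> x v + integral {0..1} (J x v)) {0..1}"
      by (intro has_integral_add g integrable_integral integrable_continuous_real cJ)
    moreover have "?g' t + J x v t = F' x t v" for t
      by (simp add: J_def F'_def algebra_simps)
    ultimately show "integral {0..1} (\<lambda>t. F' x t v) = \<omega> x v + integral {0..1} (J x v)"
      by (simp add: integral_unique)
  qed
  show "continuous_on {0..1} (J x v)" if "x \<in> B" using cJ[OF that] .
  have H: "(H has_derivative (\<lambda>v. integral {0..1} (\<lambda>t. F' x t v))) (at x)" if x: "x \<in> B" for x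
  proof -
    have ba: "blinfun_apply (Blinfun (F' x t)) = F' x t" if "x \<in> B" "t \<in> {0..1}" for x t
      using blin[OF that] by (rule bounded_linear_Blinfun_apply)
    \<comment> \<open>Differentiation under the integral sign requires continuity of the derivative
      as a bounded operator; in finite dimension this may be checked on each fixed vector.\<close>
    have cb: "continuous_on (B \<times> {0..1}) (\<lambda>(x, t). Blinfun (F' x t))"
    proof (rule continuous_on_blinfun_componentwise)
      fix i :: 'e
      show "continuous_on (B \<times> {0..1}) (\<lambda>p. blinfun_apply (case p of (x, t) \<Rightarrow> Blinfun (F' x t)) i)"
        using c4[of i]
        by (rule continuous_on_cong[THEN iffD1, OF refl, rotated]) (auto simp: ba)
    qed
    have "((\<lambda>x. integral (cbox 0 1) (\<lambda>t. \<omega> (x0 + t *\<^sub>R (x - x0)) (x - x0))) has_derivative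
        blinfun_apply (integral (cbox 0 1) (\<lambda>t. Blinfun (F' x t)))) (at x within B)"
    proof (rule leibniz_rule)
      show "((\<lambda>x. \<omega> (x0 + t *\<^sub>R (x - x0)) (x - x0)) has_derivative blinfun_apply (Blinfun (F' x t))) (at x within B)"
        if "x \<in> B" "t \<in> cbox 0 1" for x t
        using dF[of x t] ba[of x t] that by (simp add: has_derivative_at_withinI)
      show "(\<lambda>t. \<omega> (x0 + t *\<^sub>R (x - x0)) (x - x0)) integrable_on cbox 0 1" if "x \<in> B" for x
        using slice[OF c5 that] by (simp add: integrable_continuous_real)
      show "continuous_on (B \<times> cbox 0 1) (\<lambda>(x, t). Blinfun (F' x t))" using cb by simp
    qed (use x in \<open>auto simp: B_def\<close>)
    moreover have "blinfun_apply (integral (cbox 0 1) (\<lambda>t. Blinfun (F' x t))) = (\<lambda>v. integral {0..1} (\<lambda>t. F' x t v))"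
    proof (rule ext)
      fix v
      have "continuous_on {0..1} (\<lambda>t. Blinfun (F' x t))"
      proof -
        have "continuous_on {0..1} (\<lambda>t. (x, t))"
          by (intro continuous_on_Pair continuous_on_const continuous_on_id)
        from continuous_on_compose2[OF cb this] x show ?thesis by auto
      qed
      then have "blinfun_apply (integral (cbox 0 1) (\<lambda>t. Blinfun (F' x t))) v
          = integral (cbox 0 1) (\<lambda>t. blinfun_apply (Blinfun (F' x t)) v)"
        by (intro blinfun_apply_integral integrable_continuous) simp
      also have "\<dots> = integral {0..1} (\<lambda>t. F' x t v)"
        unfolding cbox_interval by (rule integral_cong) (simp add: ba[OF x])
      finally show "blinfun_apply (integral (cbox 0 1) (\<lambda>t. Blinfun (F' x t))) v = integral {0..1} (\<lambda>t. F' x t v)" .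
    qed
    ultimately have "(H has_derivative (\<lambda>v. integral {0..1} (\<lambda>t. F' x t v))) (at x within B)"
      unfolding H_def by simp
    then show ?thesis using at_within_open[OF x oB] by simp
  qed
  show "(H has_derivative (\<lambda>v. \<omega> x v + integral {0..1} (J x v))) (at x)" if "x \<in> B"
    using H[OF that] intF[OF that] by simp
  have "continuous_on B (\<lambda>x. dd H x v)" for v
  proof -
    have "continuous_on B (\<lambda>x. integral (cbox 0 1) (\<lambda>t. F' x t v))"
      using integral_continuous_on_param[of B 0 1 "\<lambda>x t. F' x t v"] c4[of v] by simp
    then show ?thesis
      by (rule continuous_on_cong[THEN iffD1, OF refl, rotated]) (use dd_eq[OF H] in auto)
  qed
  then show "Ck_on 1 B H" unfolding Ck_on_1 using H by (auto simp: differentiable_def)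
qed

text \<open>Finitely many continuous functions \<open>A x b c\<close>, with \<open>b\<close> and
  \<open>c\<close> basis vectors, are bounded on the compact set, and together they control the
  whole family.\<close>

lemma bilinear_family_bound:
  fixes A :: "'e::euclidean_space \<Rightarrow> 'd::euclidean_space \<Rightarrow> 'y::euclidean_space \<Rightarrow> 'z::euclidean_space"
  assumes "compact K" "\<And>v y. continuous_on K (\<lambda>x. A x v y)"
    and "\<And>x y. x \<in> K \<Longrightarrow> linear (\<lambda>v. A x v y)" "\<And>x v. x \<in> K \<Longrightarrow> linear (A x v)"
  obtains a where "a > 0" "\<And>x v y. x \<in> K \<Longrightarrow> norm (A x v y) \<le> a * norm v * norm y"
proof -
  have "\<exists>M>0. \<forall>x\<in>K. norm (A x b c) \<le> M" for b c
    using compact_imp_bounded[OF compact_continuous_image[OF assms(2,1)], of b c]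
    unfolding bounded_pos by auto
  then obtain M where M: "\<And>b c. M b c > (0::real)" "\<And>b c x. x \<in> K \<Longrightarrow> norm (A x b c) \<le> M b c"
    by metis
  define a where "a = (\<Sum>b\<in>Basis. \<Sum>c\<in>Basis. M b c)"
  show ?thesis
  proof
    show "a > 0" unfolding a_def using M by (intro sum_pos) auto
    fix x v y assume x: "x \<in> K"
    have "A x v y = (\<Sum>b\<in>Basis. (v \<bullet> b) *\<^sub>R (\<Sum>c\<in>Basis. (y \<bullet> c) *\<^sub>R A x b c))"
      unfolding linear_expand[OF assms(3)[OF x], of v]
      by (rule sum.cong[OF refl]) (subst linear_expand[OF assms(4)[OF x]], rule refl)
    also have "norm \<dots> \<le> (\<Sum>b\<in>Basis. \<Sum>c\<in>Basis. norm v * norm y * M b c)"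
    proof (rule sum_norm_le)
      fix b :: 'd assume b: "b \<in> Basis"
      have "norm (\<Sum>c\<in>Basis. (y \<bullet> c) *\<^sub>R A x b c) \<le> (\<Sum>c\<in>Basis. norm y * M b c)"
        using M(2)[OF x] Basis_le_norm[of _ y] by (intro sum_norm_le) (auto intro!: mult_mono)
      then have "\<bar>v \<bullet> b\<bar> * norm (\<Sum>c\<in>Basis. (y \<bullet> c) *\<^sub>R A x b c) \<le> norm v * (\<Sum>c\<in>Basis. norm y * M b c)"
        using Basis_le_norm[OF b, of v] by (intro mult_mono) auto
      then show "norm ((v \<bullet> b) *\<^sub>R (\<Sum>c\<in>Basis. (y \<bullet> c) *\<^sub>R A x b c)) \<le> (\<Sum>c\<in>Basis. norm v * norm y * M b c)"
        by (simp add: sum_distrib_left mult.assoc)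
    qed
    also have "\<dots> = a * norm v * norm y"
      by (simp add: a_def sum_distrib_left[symmetric] mult_ac)
    finally show "norm (A x v y) \<le> a * norm v * norm y" .
  qed
qed

text \<open>The solution is the limit of the Picard iterates \<open>Y (Suc n) = y0 + H (A \<cdot> Y n)\<close> along rays.
  By the homotopy formula and integrability, the defect \<open>dY n - A \<cdot> Y n\<close> contracts up to a
  multiple of \<open>Y (Suc n) - Y n\<close>, so that the derivatives converge as well.\<close>

theorem linear_frobenius:
  fixes A :: "'e::euclidean_space \<Rightarrow> 'e \<Rightarrow> 'y::euclidean_space \<Rightarrow> 'y"
  assumes "open S" "x0 \<in> S" and smooth: "\<And>v y. smooth_on S (\<lambda>x. A x v y)"
    and lin1: "\<And>x y. x \<in> S \<Longrightarrow> linear (\<lambda>v. A x v y)" and lin2: "\<And>x v. x \<in> S \<Longrightarrow> linear (A x v)"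
    and integrable: "\<And>x v w y. x \<in> S \<Longrightarrow>
      dd (\<lambda>x. A x v y) x w + A x v (A x w y) = dd (\<lambda>x. A x w y) x v + A x w (A x v y)"
  obtains r where "r > 0" "ball x0 r \<subseteq> S"
    "\<And>y0. \<exists>Y. Y x0 = y0 \<and> (\<forall>x\<in>ball x0 r. (Y has_derivative (\<lambda>v. A x v (Y x))) (at x))"
proof -
  obtain r0 where r0: "r0 > 0" "cball x0 r0 \<subseteq> S" using assms(1,2) open_contains_cball by blast
  obtain a where a: "a > 0" "\<And>x v y. x \<in> cball x0 r0 \<Longrightarrow> norm (A x v y) \<le> a * norm v * norm y"
    using bilinear_family_bound[of "cball x0 r0" A] r0 smooth lin1 lin2
    by (metis compact_cball continuous_on_subset smooth_on_continuous subsetD)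
  \<comment> \<open>With \<open>r \<le> 1 / (4 a)\<close> both estimates below contract by 1/2: the
    Picard step with factor \<open>a r\<close>, the defect with factor \<open>2 a r\<close>. Since
    \<open>a\<close> does not depend on the initial value, one ball serves every
    \<open>y0\<close>.\<close>
  define r where "r = min r0 (1 / (4 * a))"
  define B where "B = ball x0 r"
  have r: "r > 0" "r \<le> r0" "2 * a * r \<le> 1 / 2"
    using r0 a by (auto simp: r_def min_def field_simps)
  have BS: "B \<subseteq> S" "B \<subseteq> cball x0 r0" using r r0 by (auto simp: B_def)
  have oB: "open B" by (simp add: B_def)
  have ab: "norm (A x v y) \<le> a * norm v * norm y" if "x \<in> B" for x v y
    using a(2) BS that by blast
  have seg: "x0 + t *\<^sub>R (x - x0) \<in> B" if "x \<in> B" "t \<in> {0..1}" for x t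
    using that segment_in_ball[of x x0 r t] by (simp add: B_def)
  have rB: "norm (x - x0) \<le> r" if "x \<in> B" for x
    using that by (simp add: B_def dist_norm norm_minus_commute)
  have x0B: "x0 \<in> B" using r by (simp add: B_def)
  have ar: "a * norm (x - x0) * s \<le> 1 / 2 * s" if "x \<in> B" "s \<ge> 0" for x s
  proof -
    have "a * norm (x - x0) \<le> a * r" using rB[OF that(1)] a(1) by (simp add: mult_left_mono)
    also have "\<dots> \<le> 1 / 2" using r a(1) by simp
    finally show ?thesis using that(2) by (rule mult_right_mono)
  qed
  have "\<exists>Y. Y x0 = y0 \<and> (\<forall>x\<in>B. (Y has_derivative (\<lambda>v. A x v (Y x))) (at x))" for y0
  proof -
    define T where "T Y x = y0 + integral {0..1} (\<lambda>t. A (x0 + t *\<^sub>R (x - x0)) (x - x0) (Y (x0 + t *\<^sub>R (x - x0))))"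
      for Y x
    define Yn where "Yn n = (T ^^ n) (\<lambda>_. y0)" for n
    have Y0: "Yn 0 = (\<lambda>_. y0)" and YS: "Yn (Suc n) = T (Yn n)" for n by (simp_all add: Yn_def)
    have cA: "Ck_on 1 B (\<lambda>z. A z v y)" for v y
      using smooth BS(1) Ck_on_subset unfolding smooth_on_def by blast
    have \<omega>: "linear (\<lambda>v. A z v (Y z))" "Ck_on 1 B (\<lambda>z. A z v (Y z))"
      if "Ck_on 1 B Y" "z \<in> B" for Y z v
      proof -
      have l: "linear (\<lambda>v. A z v y)" "linear (A z v)" if "z \<in> B" for z v y
        using lin1 lin2 BS(1) that by blast+
      show "linear (\<lambda>v. A z v (Y z))" using l(1)[OF that(2)] .
      show "Ck_on 1 B (\<lambda>z. A z v (Y z))" by (rule Ck_on_linear_family[OF oB l(2) cA that(1)])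
    qed
    have CkT: "Ck_on 1 B (T Y)" if "Ck_on 1 B Y" for Y
    proof -
      have "Ck_on 1 (ball x0 r) (\<lambda>x. integral {0..1} (\<lambda>t. A (x0 + t *\<^sub>R (x - x0)) (x - x0) (Y (x0 + t *\<^sub>R (x - x0)))))"
        by (rule poincare_homotopy(3)[where \<omega>="\<lambda>z v. A z v (Y z)"])
          (use \<omega>(1)[OF that, unfolded B_def] \<omega>(2)[OF that x0B, unfolded B_def] in \<open>simp_all only:\<close>)
      then show ?thesis unfolding T_def B_def by (intro Ck_on_add open_ball Ck_on_const)
    qed
    have Ck: "Ck_on 1 B (Yn n)" for n
      by (induction n) (simp_all only: Y0 YS CkT Ck_on_const)
    have dY: "Yn n differentiable (at x)" if "x \<in> B" for n x using Ck[of n] that by simp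
    have contint: "continuous_on {0..1} (\<lambda>t. A (x0 + t *\<^sub>R (x - x0)) (x - x0) (Yn n (x0 + t *\<^sub>R (x - x0))))"
      if "x \<in> B" for x n
    proof -
      have "continuous_on B (\<lambda>z. A z (x - x0) (Yn n z))" using Ck_on_continuous[OF \<omega>(2)[OF Ck x0B]] .
      moreover have "continuous_on {0..1} (\<lambda>t. x0 + t *\<^sub>R (x - x0))" by (intro continuous_intros)
      ultimately show ?thesis by (rule continuous_on_compose2) (use seg[OF that] in auto)
    qed
    have diffb: "norm (Yn (Suc n) x - Yn n x) \<le> norm y0 * (1/2)^n" if "x \<in> B" for n x
      using that
    proof (induction n arbitrary: x)
      case 0
      have "norm (integral {0..1} (\<lambda>t. A (x0 + t *\<^sub>R (x - x0)) (x - x0) (Yn 0 (x0 + t *\<^sub>R (x - x0))))) \<le> (norm y0) * (1 - 0)"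
      proof (rule integral_bound[OF _ contint])
        fix t :: real assume t: "t \<in> {0..1}"
        show "norm (A (x0 + t *\<^sub>R (x - x0)) (x - x0) (Yn 0 (x0 + t *\<^sub>R (x - x0)))) \<le> norm y0"
          using ab[OF seg[OF 0 t], of "x - x0" y0] ar[OF 0, of "norm y0"] norm_ge_zero[of y0]
          unfolding Y0 by linarith
      qed (use 0 in auto)
      then show ?case by (simp add: YS T_def Y0)
    next
      case (Suc n)
      let ?z = "\<lambda>t. x0 + t *\<^sub>R (x - x0)"
      have "Yn (Suc (Suc n)) x - Yn (Suc n) x
        = integral {0..1} (\<lambda>t. A (?z t) (x - x0) (Yn (Suc n) (?z t)) - A (?z t) (x - x0) (Yn n (?z t)))"
        unfolding YS[of "Suc n"] YS[of n, THEN fun_cong, of x] T_def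
        by (subst integral_diff) (auto intro!: integrable_continuous_real contint Suc.prems)
      also have "norm \<dots> \<le> (norm y0 * (1/2)^Suc n) * (1 - 0)"
      proof (rule integral_bound)
        fix t :: real assume t: "t \<in> {0..1}"
        have z: "?z t \<in> B" using seg[OF Suc.prems t] .
        have "A (?z t) (x - x0) (Yn (Suc n) (?z t)) - A (?z t) (x - x0) (Yn n (?z t))
          = A (?z t) (x - x0) (Yn (Suc n) (?z t) - Yn n (?z t))"
          using linear_diff[OF lin2] BS z by (metis subsetD)
        also have "norm \<dots> \<le> a * norm (x - x0) * norm (Yn (Suc n) (?z t) - Yn n (?z t))" by (rule ab[OF z])
        also have "\<dots> \<le> 1/2 * norm (Yn (Suc n) (?z t) - Yn n (?z t))" by (rule ar[OF Suc.prems]) simp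
        also have "\<dots> \<le> norm y0 * (1/2)^Suc n" using Suc.IH[OF z] by simp
        finally show "norm (A (?z t) (x - x0) (Yn (Suc n) (?z t)) - A (?z t) (x - x0) (Yn n (?z t)))
          \<le> norm y0 * (1/2)^Suc n" .
      qed (auto intro!: continuous_on_diff contint Suc.prems)
      finally show ?case by simp
    qed
    \<comment> \<open>The solution of the recursion \<open>e (n+1) = e n / 2 + a |y0| / 2^n\<close>
      with \<open>e 0 = a |y0|\<close>, which is what the inductive estimate of the defect
      produces.\<close>
    define e where "e n = a * norm y0 * (1 + 2 * real n) * (1/2)^n" for n
    have defect: "norm (dd (Yn n) x v - A x v (Yn n x)) \<le> e n * norm v" if "x \<in> B" for n x v
      using that
    proof (induction n arbitrary: x v)
      case 0
      have "dd (\<lambda>_. y0) x v = 0" by simp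
      then show ?case using ab[OF 0, of v y0] by (simp add: e_def Y0 mult_ac)
    next
      case (Suc n)
      let ?z = "\<lambda>t. x0 + t *\<^sub>R (x - x0)" and ?\<omega> = "\<lambda>z v. A z v (Yn n z)"
      define J where "J = (\<lambda>t. t *\<^sub>R (dd (\<lambda>z. ?\<omega> z (x - x0)) (?z t) v - dd (\<lambda>z. ?\<omega> z v) (?z t) (x - x0)))"
      have H: "((\<lambda>x. integral {0..1} (\<lambda>t. ?\<omega> (x0 + t *\<^sub>R (x - x0)) (x - x0))) has_derivative
         (\<lambda>v. ?\<omega> x v + integral {0..1} (\<lambda>t. t *\<^sub>R (dd (\<lambda>z. ?\<omega> z (x - x0)) (?z t) v - dd (\<lambda>z. ?\<omega> z v) (?z t) (x - x0))))) (at x)"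
        by (rule poincare_homotopy(1)[where r=r])
          (use \<omega>[OF Ck, unfolded B_def] Suc.prems in \<open>auto simp: B_def\<close>)
      have cJ: "continuous_on {0..1} J"
        unfolding J_def
        by (rule poincare_homotopy(2)[where r=r])
          (use \<omega>[OF Ck, unfolded B_def] Suc.prems in \<open>auto simp: B_def\<close>)
      have dT: "dd (Yn (Suc n)) x v = ?\<omega> x v + integral {0..1} J"
      proof -
        have "(Yn (Suc n) has_derivative (\<lambda>v. 0 + (?\<omega> x v + integral {0..1} (\<lambda>t. t *\<^sub>R (dd (\<lambda>z. ?\<omega> z (x - x0)) (?z t) v - dd (\<lambda>z. ?\<omega> z v) (?z t) (x - x0)))))) (at x)"
          unfolding YS T_def by (intro has_derivative_add has_derivative_const H)
        from dd_eq[OF this] show ?thesis by (simp add: J_def)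
      qed
      have Jb: "norm (J t) \<le> 1/2 * e n * norm v" if t: "t \<in> {0..1}" for t
      proof -
        have z: "?z t \<in> B" "?z t \<in> S" using seg[OF Suc.prems t] BS by auto
        let ?h = "x - x0" and ?y = "Yn n (?z t)"
        have d\<omega>: "dd (\<lambda>z. ?\<omega> z u) (?z t) w = dd (\<lambda>z. A z u ?y) (?z t) w + A (?z t) u (dd (Yn n) (?z t) w)" for u w
          by (rule dd_linear_family(1)[OF oB z(1)])
            (use lin2 BS dY[OF z(1)] smooth_on_differentiable[OF smooth z(2)] in auto)
        have nb: "norm (A (?z t) u w) \<le> a * norm u * c" if "norm w \<le> c" for u w c
          by (rule order_trans[OF ab[OF z(1)] mult_left_mono[OF that]]) (use a(1) in simp)
        let ?\<eta> = "\<lambda>u. dd (Yn n) (?z t) u - A (?z t) u ?y"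
        \<comment> \<open>Integrability cancels every term that contains \<open>?y\<close> and a
          derivative of \<open>A\<close>; what remains is linear in the defect
          \<open>?\<eta>\<close> of the previous iterate.\<close>
        have "dd (\<lambda>z. ?\<omega> z ?h) (?z t) v - dd (\<lambda>z. ?\<omega> z v) (?z t) ?h = A (?z t) ?h (?\<eta> v) - A (?z t) v (?\<eta> ?h)"
          using integrable[OF z(2), of ?h ?y v]
          unfolding d\<omega> linear_diff[OF lin2[OF z(2)]] by (simp add: algebra_simps)
        also have "norm \<dots> \<le> a * norm ?h * (e n * norm v) + a * norm v * (e n * norm ?h)"
          by (rule order_trans[OF norm_triangle_ineq4 add_mono[OF nb[OF Suc.IH[OF z(1)]] nb[OF Suc.IH[OF z(1)]]]])
        also have "\<dots> = (2 * a * norm ?h) * (e n * norm v)" by (simp add: mult_ac)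
        also have "\<dots> \<le> 1/2 * (e n * norm v)"
        proof (rule mult_right_mono)
          have "2 * a * norm ?h \<le> 2 * a * r" using rB[OF Suc.prems] a(1) by simp
          then show "2 * a * norm ?h \<le> 1/2" using r(3) by linarith
          show "0 \<le> e n * norm v" using a(1) by (simp add: e_def)
        qed
        finally have "norm (dd (\<lambda>z. ?\<omega> z ?h) (?z t) v - dd (\<lambda>z. ?\<omega> z v) (?z t) ?h) \<le> 1/2 * (e n * norm v)" .
        moreover have "norm (J t) \<le> norm (dd (\<lambda>z. ?\<omega> z ?h) (?z t) v - dd (\<lambda>z. ?\<omega> z v) (?z t) ?h)"
          using t by (simp add: J_def mult_left_le_one_le)
        ultimately show ?thesis by simp
      qed
      have "dd (Yn (Suc n)) x v - A x v (Yn (Suc n) x) = integral {0..1} J - A x v (Yn (Suc n) x - Yn n x)"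
        unfolding dT linear_diff[OF lin2[OF subsetD[OF BS(1) Suc.prems]]] by simp
      also have "norm \<dots> \<le> 1/2 * e n * norm v * (1 - 0) + a * norm v * (norm y0 * (1/2)^n)"
        by (rule order_trans[OF norm_triangle_ineq4 add_mono[OF integral_bound[OF _ cJ Jb]
              order_trans[OF ab[OF Suc.prems] mult_left_mono[OF diffb[OF Suc.prems]]]]])
          (use a(1) in simp_all)
      also have "\<dots> = e (Suc n) * norm v" by (simp add: e_def field_simps)
      finally show ?case .
    qed
    have *: "uniform_limit B (\<lambda>n x. \<Sum>i<n. Yn (Suc i) x - Yn i x) (\<lambda>x. suminf (\<lambda>i. Yn (Suc i) x - Yn i x)) sequentially"
      by (rule Weierstrass_m_test[where M="\<lambda>n. norm y0 * (1/2)^n"])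
        (auto intro!: summable_mult summable_geometric diffb)
    have "uniform_limit B (\<lambda>n x. Yn n x - y0) (\<lambda>x. suminf (\<lambda>i. Yn (Suc i) x - Yn i x)) sequentially"
    proof -
      have "(\<Sum>i<n. Yn (Suc i) x - Yn i x) = Yn n x - y0" for n x
        using sum_lessThan_telescope[of "\<lambda>n. Yn n x" n] by (simp add: Y0)
      then show ?thesis using * by simp
    qed
    moreover define Y where "Y x = y0 + suminf (\<lambda>i. Yn (Suc i) x - Yn i x)" for x
    ultimately have "\<forall>\<epsilon>>0. \<forall>\<^sub>F n in sequentially. \<forall>x\<in>B. dist (Yn n x - y0) (Y x - y0) < \<epsilon>"
      by (simp add: uniform_limit_iff)
    then have lim: "\<forall>\<^sub>F n in sequentially. \<forall>x\<in>B. norm (Yn n x - Y x) < \<epsilon>" if "\<epsilon> > 0" for \<epsilon>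
      using that by (simp add: dist_norm)
    have pt: "(\<lambda>n. Yn n x) \<longlonglongrightarrow> Y x" if "x \<in> B" for x
      using lim that unfolding tendsto_iff dist_norm by (fastforce elim: eventually_mono)
    have e0: "e \<longlonglongrightarrow> 0"
    proof -
      have "(\<lambda>n. (1 + 2 * real n) * (1/2)^n) \<longlonglongrightarrow> 0"
      proof -
        have "(\<lambda>n. real n * (1/2)^n) \<longlonglongrightarrow> 0" by (rule powser_times_n_limit_0) simp
        moreover have "(\<lambda>n. (1/2::real)^n) \<longlonglongrightarrow> 0" by (rule LIMSEQ_realpow_zero) auto
        ultimately have "(\<lambda>n. (1/2)^n + 2 * (real n * (1/2)^n)) \<longlonglongrightarrow> 0 + 2 * (0::real)"
          by (intro tendsto_add tendsto_mult tendsto_const)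
        then show ?thesis by (simp add: algebra_simps)
      qed
      from tendsto_mult_right_zero[OF this, of "a * norm y0"] show ?thesis by (simp add: e_def[abs_def] mult.assoc)
    qed
    \<comment> \<open>Derivatives converge uniformly: \<open>defect\<close> compares them with
      \<open>A\<close> applied to \<open>Yn n\<close>, and \<open>A\<close> is uniformly bounded.
      The limit derivative is written with \<open>Y\<close>, so the limit function \<open>g\<close>
      produced here is identified with \<open>Y\<close> afterwards.\<close>
    have ex: "\<exists>g. \<forall>x\<in>B. (\<lambda>n. Yn n x) \<longlonglongrightarrow> g x \<and> (g has_derivative (\<lambda>v. A x v (Y x))) (at x within B)"
    proof (rule has_derivative_sequence[where f=Yn and f'="\<lambda>n. dd (Yn n)"])
      show "x0 \<in> B" "(\<lambda>n. Yn n x0) \<longlonglongrightarrow> Y x0" using x0B pt by auto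
      show "convex B" by (simp add: B_def)
      show "(Yn n has_derivative dd (Yn n) x) (at x within B)" if "x \<in> B" for n x
        using dY[OF that] has_derivative_dd has_derivative_at_withinI by blast
      fix \<epsilon> :: real assume \<epsilon>: "\<epsilon> > 0"
      have "\<forall>\<^sub>F n in sequentially. e n < \<epsilon> / 2" by (rule order_tendstoD(2)[OF e0]) (use \<epsilon> in simp)
      moreover have "\<forall>\<^sub>F n in sequentially. \<forall>x\<in>B. norm (Yn n x - Y x) < \<epsilon> / 2 / a"
        by (rule lim) (use \<epsilon> a(1) in simp)
      ultimately show "\<forall>\<^sub>F n in sequentially. \<forall>x\<in>B. \<forall>h. norm (dd (Yn n) x h - A x h (Y x)) \<le> \<epsilon> * norm h"
      proof eventually_elim
        case (elim n)
        show ?case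
        proof (intro ballI allI)
          fix x h assume x: "x \<in> B"
          have "dd (Yn n) x h - A x h (Y x) = (dd (Yn n) x h - A x h (Yn n x)) + A x h (Yn n x - Y x)"
            unfolding linear_diff[OF lin2[OF subsetD[OF BS(1) x]]] by simp
          also have "norm \<dots> \<le> \<epsilon> / 2 * norm h + a * norm h * (\<epsilon> / 2 / a)"
            by (rule order_trans[OF norm_triangle_ineq add_mono[OF order_trans[OF defect[OF x] mult_right_mono]
                  order_trans[OF ab[OF x] mult_left_mono]]])
              (use elim x a(1) in \<open>auto intro: less_imp_le\<close>)
          also have "\<dots> = \<epsilon> * norm h" using a(1) by (simp add: field_simps)
          finally show "norm (dd (Yn n) x h - A x h (Y x)) \<le> \<epsilon> * norm h" .
        qed
      qed
    qed
    then obtain g where g: "\<And>x. x \<in> B \<Longrightarrow> (\<lambda>n. Yn n x) \<longlonglongrightarrow> g x"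
        "\<And>x. x \<in> B \<Longrightarrow> (g has_derivative (\<lambda>v. A x v (Y x))) (at x within B)" by blast
    have gY: "g x = Y x" if "x \<in> B" for x using LIMSEQ_unique g(1) pt that by blast
    have "(g has_derivative (\<lambda>v. A x v (g x))) (at x)" if "x \<in> B" for x
      using g(2)[OF that] gY[OF that] at_within_open[OF that oB] by simp
    moreover have "Yn n x0 = y0" for n
    proof (cases n)
      case (Suc m)
      have "A x0 0 y = 0" for y using linear_0[OF lin1[OF assms(2)]] .
      then show ?thesis by (simp add: Suc YS T_def)
    qed (simp add: Y0)
    then have "g x0 = y0" using g(1)[OF x0B] by (simp add: LIMSEQ_const_iff)
    ultimately show ?thesis by blast
  qed
  then show ?thesis using that[of r] r BS by (simp add: B_def)
qed

text \<open>Bootstrapping: the equation expresses the derivative of \<open>Y\<close> through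
  \<open>Y\<close> itself, so class C^k of \<open>Y\<close> passes to its derivative.\<close>

lemma linear_pde_solution_smooth:
  fixes A :: "'e::euclidean_space \<Rightarrow> 'e \<Rightarrow> 'y::euclidean_space \<Rightarrow> 'y"
  assumes "open S" and smooth: "\<And>v y. smooth_on S (\<lambda>x. A x v y)" and lin: "\<And>x v. x \<in> S \<Longrightarrow> linear (A x v)"
    and Y: "\<And>x. x \<in> S \<Longrightarrow> (Y has_derivative (\<lambda>v. A x v (Y x))) (at x)"
  shows "smooth_on S Y"
proof -
  have "Ck_on k S Y" for k
  proof (induction k)
    case 0
    show ?case using Y has_derivative_continuous by (auto intro!: continuous_at_imp_continuous_on) blast
  next
    case (Suc k)
    have "Ck_on k S (\<lambda>x. dd Y x v)" for v
    proof (rule Ck_on_cong[OF assms(1)])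
      show "A x v (Y x) = dd Y x v" if "x \<in> S" for x using dd_eq[OF Y[OF that]] by simp
      show "Ck_on k S (\<lambda>x. A x v (Y x))"
        by (rule Ck_on_linear_family[OF assms(1)]) (use smooth lin Suc in \<open>simp_all add: smooth_on_def\<close>)
    qed
    then show ?case using Y by (auto simp: differentiable_def)
  qed
  then show ?thesis by (simp add: smooth_on_def)
qed

section \<open>Smooth solutions of linear equations and smooth inverses\<close>

text \<open>The map in question is the inverse of \<open>(x, y) \<mapsto> (x, A x y)\<close>, whose derivative is invertible.\<close>

lemma linear_family_inverse_differentiable:
  fixes A :: "'e::euclidean_space \<Rightarrow> 'd::euclidean_space \<Rightarrow> 'd"
  assumes S: "open S" and lin: "\<And>x. x \<in> S \<Longrightarrow> linear (A x)" and inj: "\<And>x. x \<in> S \<Longrightarrow> inj (A x)"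
    and diff: "\<And>x v. x \<in> S \<Longrightarrow> (\<lambda>x. A x v) differentiable (at x)" and x: "x \<in> S"
  shows "(\<lambda>p. (fst p, inv (A (fst p)) (snd p))) differentiable (at (x, b))"
proof -
  have surj: "surj (A x)" if "x \<in> S" for x using linear_injective_imp_surjective lin inj that by blast
  define y where "y = inv (A x) b"
  have b: "A x y = b" using surj[OF x] by (simp add: y_def surj_f_inv_f)
  define F where "F p = (fst p, A (fst p) (snd p))" for p
  define DA where "DA = dd (\<lambda>z. A z y) x"
  have T: "open (S \<times> (UNIV :: 'd set))" "(z, w) \<in> S \<times> UNIV \<longleftrightarrow> z \<in> S" for z :: 'e and w :: 'd
    using S by (auto intro: open_Times)
  have dA: "((\<lambda>p. A (fst p) v) has_derivative (\<lambda>q. dd (\<lambda>z. A z v) z (fst q))) (at (z, w))" if "z \<in> S" for v z and w :: 'd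
    using has_derivative_compose[OF has_derivative_fst[OF has_derivative_ident], of "\<lambda>z. A z v" "dd (\<lambda>z. A z v) z" "(z, w)"]
      has_derivative_dd[OF diff[OF that]] by simp
  have dsnd: "(snd has_derivative snd) (at p)" for p :: "'e \<times> 'd" by (auto intro!: derivative_eq_intros)
  have linp: "linear (A (fst p))" if "p \<in> S \<times> UNIV" for p :: "'e \<times> 'd" using lin that by auto
  have d1: "(\<lambda>p. A (fst p) v) differentiable (at (z, w))" if "z \<in> S" for v z and w :: 'd
    using dA[OF that] unfolding differentiable_def by blast
  have d2: "snd differentiable (at p)" for p :: "'e \<times> 'd" using dsnd unfolding differentiable_def by blast
  have diffA: "(\<lambda>p. A (fst p) (snd p)) differentiable (at p)" if "p \<in> S \<times> UNIV" for p
    using that by (cases p) (auto intro!: dd_linear_family(2)[OF T(1), of _ "\<lambda>p. A (fst p)" snd] linp d1 d2)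
  have diffF: "F differentiable (at p)" if p: "p \<in> S \<times> UNIV" for p
  proof -
    obtain D where "((\<lambda>p. A (fst p) (snd p)) has_derivative D) (at p)"
      using diffA[OF p] unfolding differentiable_def by blast
    from has_derivative_Pair[OF has_derivative_fst[OF has_derivative_ident] this]
    show ?thesis unfolding F_def differentiable_def by blast
  qed
  have "((\<lambda>p. A (fst p) (snd p)) has_derivative (\<lambda>q. DA (fst q) + A x (snd q))) (at (x, y))"
  proof -
    have "dd (\<lambda>p. A (fst p) (snd p)) (x, y) q = DA (fst q) + A x (snd q)" for q
      using dd_linear_family(1)[OF T(1), of "(x, y)" "\<lambda>p. A (fst p)" snd q] linp d1[OF x] d2 x
        dd_eq[OF dA[OF x, of y y], of q] dd_eq[OF dsnd, of "(x, y)" q] by (simp add: DA_def)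
    then have "dd (\<lambda>p. A (fst p) (snd p)) (x, y) = (\<lambda>q. DA (fst q) + A x (snd q))" by (rule ext)
    then show ?thesis using has_derivative_dd[OF diffA, of "(x, y)"] x by simp
  qed
  then have dF: "(F has_derivative (\<lambda>q. (fst q, DA (fst q) + A x (snd q)))) (at (x, y))"
    unfolding F_def by (intro has_derivative_Pair has_derivative_fst[OF has_derivative_ident])
  \<comment> \<open>The inverse of \<open>F\<close> is known explicitly and only its
    differentiability is in question. The derivative of \<open>F\<close> is triangular, and its
    right inverse is found by solving for the second component.\<close>
  have "((\<lambda>p. (fst p, inv (A (fst p)) (snd p))) has_derivative (\<lambda>q. (fst q, inv (A x) (snd q - DA (fst q))))) (at (F (x, y)))"
  proof (rule has_derivative_inverse_strong[OF T(1), where f=F, OF _ _ _ dF])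
    show "(x, y) \<in> S \<times> UNIV" using x by simp
    show "continuous_on (S \<times> UNIV) F"
      using diffF differentiable_imp_continuous_within by (blast intro!: continuous_at_imp_continuous_on)
    show "(fst (F p), inv (A (fst (F p))) (snd (F p))) = p" if "p \<in> S \<times> UNIV" for p
      using inj that by (auto simp: F_def)
    show "(\<lambda>q. (fst q, DA (fst q) + A x (snd q))) \<circ> (\<lambda>q. (fst q, inv (A x) (snd q - DA (fst q)))) = id"
      by (simp add: fun_eq_iff surj_f_inv_f[OF surj[OF x]])
  qed
  then show ?thesis by (auto simp: F_def b differentiable_def)
qed

text \<open>Near \<open>x\<close>, \<open>w z\<close> is the second component of the differentiable
  map of the preceding lemma at \<open>(z, b z)\<close>, so \<open>w\<close> inherits the regularity
  of \<open>b\<close>.\<close>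

lemma linear_family_solution:
  fixes A :: "'e::euclidean_space \<Rightarrow> 'd::euclidean_space \<Rightarrow> 'd"
  assumes S: "open S" and lin: "\<And>x. x \<in> S \<Longrightarrow> linear (A x)" and inj: "\<And>x. x \<in> S \<Longrightarrow> inj (A x)"
    and diff: "\<And>x v. x \<in> S \<Longrightarrow> (\<lambda>x. A x v) differentiable (at x)" and w: "\<And>x. x \<in> S \<Longrightarrow> A x (w x) = b x"
    and x: "x \<in> S"
  shows "isCont b x \<Longrightarrow> isCont w x"
    and "b differentiable (at x) \<Longrightarrow> w differentiable (at x)"
proof -
  let ?g = "\<lambda>p. (fst p, inv (A (fst p)) (snd p))"
  have g: "?g differentiable (at (x, b x))" by (rule linear_family_inverse_differentiable[OF S lin inj diff x])
  have eq: "snd (?g (z, b z)) = w z" if "z \<in> S" for z using w[OF that] inj[OF that] inv_f_f[of "A z" "w z"] by simp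
  show "isCont w x" if "isCont b x"
  proof -
    have "isCont ?g (x, b x)" using g differentiable_imp_continuous_within by blast
    moreover have "isCont (\<lambda>z. (z, b z)) x" by (intro continuous_Pair continuous_ident that)
    ultimately have "isCont (\<lambda>z. ?g (z, b z)) x" using isCont_o2[where f="\<lambda>z. (z, b z)" and g="?g"] by simp
    then have "isCont (\<lambda>z. snd (?g (z, b z))) x" by (rule isCont_snd)
    then show ?thesis
      using eq S x by (subst isCont_cong[of w "\<lambda>z. snd (?g (z, b z))"]) (auto simp: eventually_nhds)
  qed
  show "w differentiable (at x)" if bd: "b differentiable (at x)"
  proof -
    obtain b' where "(b has_derivative b') (at x)" using bd unfolding differentiable_def by blast
    then have "((\<lambda>z. (z, b z)) has_derivative (\<lambda>v. (v, b' v))) (at x)"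
      by (intro has_derivative_Pair has_derivative_ident)
    moreover obtain g' where "(?g has_derivative g') (at (x, b x))" using g unfolding differentiable_def by blast
    ultimately have "((\<lambda>z. ?g (z, b z)) has_derivative (\<lambda>v. g' (v, b' v))) (at x)"
      by (rule has_derivative_compose)
    then have "((\<lambda>z. snd (?g (z, b z))) has_derivative (\<lambda>v. snd (g' (v, b' v)))) (at x)"
      by (rule has_derivative_snd)
    then have "(w has_derivative (\<lambda>v. snd (g' (v, b' v)))) (at x)"
      by (rule has_derivative_transform_within_open[OF _ S x eq])
    then show ?thesis unfolding differentiable_def by blast
  qed
qed

lemma linear_dd_parameter:
  assumes S: "open S" "x \<in> S" and lin: "\<And>x. x \<in> S \<Longrightarrow> linear (A x)"
    and diff: "\<And>v. (\<lambda>x. A x v) differentiable (at x)"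
  shows "linear (\<lambda>w. dd (\<lambda>x. A x w) x v)"
proof (rule linearI)
  show "dd (\<lambda>x. A x (v1 + v2)) x v = dd (\<lambda>x. A x v1) x v + dd (\<lambda>x. A x v2) x v" for v1 v2
    using dd_cong[OF S, of "\<lambda>x. A x (v1 + v2)" "\<lambda>x. A x v1 + A x v2"] linear_add[OF lin]
      dd_add[OF diff diff] by simp
  show "dd (\<lambda>x. A x (c *\<^sub>R w)) x v = c *\<^sub>R dd (\<lambda>x. A x w) x v" for c w
    using dd_cong[OF S, of "\<lambda>x. A x (c *\<^sub>R w)" "\<lambda>x. c *\<^sub>R A x w"] linear_scale[OF lin]
      dd_linear[OF bounded_linear_scaleR_right diff] by simp
qed

text \<open>Differentiating \<open>A w = b\<close> gives an equation for the derivative of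
  \<open>w\<close> with the same operator \<open>A\<close> and right-hand side
  \<open>db - (dA) w\<close>. The induction thus keeps \<open>A\<close> and varies \<open>b\<close>
  and \<open>w\<close>; the lower regularity of \<open>w\<close> already suffices for the new
  right-hand side.\<close>

lemma Ck_on_solution:
  fixes A :: "'e::euclidean_space \<Rightarrow> 'd::euclidean_space \<Rightarrow> 'd"
  assumes S: "open S" and lin: "\<And>x. x \<in> S \<Longrightarrow> linear (A x)" and inj: "\<And>x. x \<in> S \<Longrightarrow> inj (A x)"
    and diff: "\<And>x v. x \<in> S \<Longrightarrow> (\<lambda>x. A x v) differentiable (at x)"
    and "\<And>v. Ck_on k S (\<lambda>x. A x v)" "Ck_on k S b" and "\<And>x. x \<in> S \<Longrightarrow> A x (w x) = b x"
  shows "Ck_on k S w"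
  using assms(5-7)
proof (induction k arbitrary: b w)
  case 0
  then have "isCont b x" if "x \<in> S" for x using that S by (simp add: continuous_on_eq_continuous_at)
  then have "isCont w x" if "x \<in> S" for x
    using linear_family_solution(1)[OF S lin inj diff 0(3) that] that by blast
  then show ?case by (simp add: continuous_at_imp_continuous_on)
next
  case (Suc k)
  have wk: "Ck_on k S w" by (rule Suc.IH[OF Ck_on_Suc_imp[OF Suc.prems(1)] Ck_on_Suc_imp[OF Suc.prems(2)] Suc.prems(3)])
  have bd: "b differentiable (at x)" if "x \<in> S" for x using Suc.prems(2) that by simp
  have wd: "w differentiable (at x)" if "x \<in> S" for x
    using linear_family_solution(2)[OF S lin inj diff Suc.prems(3) that bd[OF that]] .
  have "Ck_on k S (\<lambda>x. dd w x v)" for v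
  proof (rule Suc.IH)
    show "Ck_on k S (\<lambda>x. A x v)" for v using Ck_on_Suc_imp[OF Suc.prems(1)] .
    show "Ck_on k S (\<lambda>x. dd b x v + (- 1) *\<^sub>R dd (\<lambda>z. A z (w x)) x v)"
    proof (rule Ck_on_add[OF S _ Ck_on_linear_compose[OF bounded_linear_scaleR_right S]])
      show "Ck_on k S (\<lambda>x. dd b x v)" using Suc.prems(2) by simp
      have "Ck_on k S (\<lambda>x. dd (\<lambda>z. A z y) x v)" for y using Suc.prems(1)[of y] by simp
      then show "Ck_on k S (\<lambda>x. dd (\<lambda>z. A z (w x)) x v)"
        by (intro Ck_on_linear_family[OF S _ _ wk, where L="\<lambda>x y. dd (\<lambda>z. A z y) x v"]
            linear_dd_parameter[OF S] lin diff)
    qed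
    show "A x (dd w x v) = dd b x v + (- 1) *\<^sub>R dd (\<lambda>z. A z (w x)) x v" if "x \<in> S" for x
      using dd_cong[OF S that, of "\<lambda>x. A x (w x)" b] Suc.prems(3)
        dd_linear_family(1)[OF S that lin diff[OF that] wd[OF that], of v] by simp
  qed
  then show ?case using wd by simp
qed

lemma smooth_on_solution:
  fixes A :: "'e::euclidean_space \<Rightarrow> 'd::euclidean_space \<Rightarrow> 'd"
  assumes S: "open S" and lin: "\<And>x. x \<in> S \<Longrightarrow> linear (A x)" and inj: "\<And>x. x \<in> S \<Longrightarrow> inj (A x)"
    and A: "\<And>v. smooth_on S (\<lambda>x. A x v)" and b: "smooth_on S b" and w: "\<And>x. x \<in> S \<Longrightarrow> A x (w x) = b x"
  shows "smooth_on S w"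
  unfolding smooth_on_def
  using Ck_on_solution[OF S lin inj _ _ _ w] A b smooth_on_differentiable[OF A]
  by (simp add: smooth_on_def)

text \<open>The C^1 inverse function theorem supplies the inverse \<open>g\<close>. Its derivative
  solves the linear equation \<open>dd u (g y) (dd g y v) = v\<close>, whose coefficients are as
  regular as \<open>g\<close>, so \<open>Ck_on_solution\<close> gains one derivative at each
  step.\<close>

lemma smooth_inverse_function:
  fixes u :: "'e::euclidean_space \<Rightarrow> 'e"
  assumes S: "open S" "x0 \<in> S" and u: "smooth_on S u" and inj: "inj (dd u x0)"
  obtains V W \<phi> where "open V" "x0 \<in> V" "V \<subseteq> S" "open W" "homeomorphism V W u \<phi>"
    "smooth_on W \<phi>" "\<And>x. x \<in> V \<Longrightarrow> bij (dd u x)"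
proof -
  define f' where "f' x = Blinfun (dd u x)" for x
  have bl: "bounded_linear (dd u x)" if "x \<in> S" for x
    using smooth_on_linear_dd[OF u that] linear_conv_bounded_linear by blast
  then have f': "blinfun_apply (f' x) = dd u x" if "x \<in> S" for x
    using that by (simp add: f'_def bounded_linear_Blinfun_apply)
  have cont: "continuous_on S f'"
  proof (rule continuous_on_blinfun_componentwise)
    show "continuous_on S (\<lambda>x. blinfun_apply (f' x) i)" for i
      using smooth_on_continuous[OF smooth_on_dd[OF u, of i]]
      by (rule continuous_on_cong[THEN iffD1, OF refl, rotated]) (simp add: f')
  qed
  obtain k where k: "linear k" "k \<circ> dd u x0 = id"
    using linear_injective_left_inverse[OF smooth_on_linear_dd[OF u S(2)] inj] by blast
  then have bk: "bounded_linear k" using linear_conv_bounded_linear by blast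
  have "Blinfun k o\<^sub>L f' x0 = id_blinfun"
    using k by (intro blinfun_eqI) (simp add: f'[OF S(2)] bounded_linear_Blinfun_apply[OF bk] fun_eq_iff)
  from inverse_function_theorem[OF S(1) _ cont S(2) this, of u] smooth_on_has_derivative[OF u] f'
  obtain V W g g' where V: "open V" "V \<subseteq> S" "x0 \<in> V" "open W" "homeomorphism V W u g"
    and g': "\<And>y. y \<in> W \<Longrightarrow> (g has_derivative g' y) (at y)" "\<And>y. y \<in> W \<Longrightarrow> bij (blinfun_apply (f' (g y)))"
    by metis
  have gV: "g y \<in> V" "u (g y) = y" if "y \<in> W" for y using V(5) that by (auto simp: homeomorphism_def)
  have bij: "bij (dd u x)" if "x \<in> V" for x
  proof -
    have "u x \<in> W" "g (u x) = x" using V(5) that by (auto simp: homeomorphism_def)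
    then show ?thesis using g'(2)[of "u x"] f'[of x] that V(2) by auto
  qed
  have "Ck_on k W g" for k
  proof (induction k)
    case 0
    show ?case using V(5) by (simp add: homeomorphism_def)
  next
    case (Suc k)
    have sm: "Ck_on k W (\<lambda>y. dd u (g y) v)" if "Ck_on k W g" for v k
      by (rule Ck_on_compose[OF V(4,1) _ that])
        (use gV(1) smooth_on_subset[OF smooth_on_dd[OF u] V(2)] in \<open>auto simp: smooth_on_def\<close>)
    have "g differentiable (at y)" if "y \<in> W" for y using g'(1)[OF that] by (auto simp: differentiable_def)
    note gd = this
    \<comment> \<open>\<open>Ck_on_solution\<close> asks for differentiable coefficients even at
      level \<open>k = 0\<close>.\<close>
    have "(\<lambda>y. dd u (g y) v) differentiable (at y)" if "y \<in> W" for y v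
    proof -
      have "(\<lambda>x. dd u x v) differentiable (at (g y))"
        using smooth_on_differentiable[OF smooth_on_dd[OF u]] gV(1)[OF that] V(2) by blast
      then show ?thesis using gd[OF that] differentiable_chain_at[of g y "\<lambda>x. dd u x v"] by (simp add: o_def)
    qed
    note ud = this
    have "Ck_on k W (\<lambda>y. dd g y v)" for v
    proof (rule Ck_on_solution[OF V(4), of "\<lambda>y. dd u (g y)"])
      show "linear (dd u (g y))" "inj (dd u (g y))" if "y \<in> W" for y
        using smooth_on_linear_dd[OF u] bij gV(1)[OF that] V(2) by (auto simp: bij_is_inj)
      show "dd u (g y) (dd g y v) = v" if "y \<in> W" for y
      proof -
        have "dd (\<lambda>y. u (g y)) y v = dd u (g y) (dd g y v)"
          using smooth_on_differentiable[OF u] gV(1)[OF that] V(2) by (intro dd_compose gd that) blast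
        moreover have "dd (\<lambda>y. u (g y)) y v = dd (\<lambda>y. y) y v"
          by (rule dd_cong[OF V(4) that, THEN fun_cong]) (rule gV(2))
        ultimately show ?thesis by simp
      qed
    qed (use ud sm[OF Suc] Ck_on_const in auto)
    then show ?case using gd by simp
  qed
  then have "smooth_on W g" by (simp add: smooth_on_def)
  then show ?thesis using that[OF V(1,3,2,4,5) _ bij] by blast
qed

section \<open>Bump functions\<close>

text \<open>For \<open>k = 0\<close> this is the classical function that is flat at 0. The powers of
  \<open>1 / t\<close> make the family closed under differentiation up to linear combinations, so
  that all orders are treated by one induction.\<close>

definition flat_fun :: "nat \<Rightarrow> real \<Rightarrow> real" where
  "flat_fun k t = (if t > 0 then (1 / t) ^ k * exp (- (1 / t)) else 0)"

text \<open>The quotient is the difference quotient at 0; after the substitution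
  \<open>s = 1 / t\<close> the exponential beats every power.\<close>

lemma flat_fun_tendsto: "((\<lambda>t. flat_fun k t / t) \<longlongrightarrow> 0) (at 0)"
  unfolding filterlim_at_split
proof
  have "((\<lambda>s::real. s ^ Suc k / exp s) \<longlongrightarrow> 0) at_top" by (rule tendsto_power_div_exp_0)
  then have "((\<lambda>t::real. inverse t ^ Suc k / exp (inverse t)) \<longlongrightarrow> 0) (at_right 0)"
    by (rule filterlim_compose[OF _ filterlim_inverse_at_top_right])
  then show "((\<lambda>t. flat_fun k t / t) \<longlongrightarrow> 0) (at_right 0)"
    by (rule Lim_transform_eventually)
      (auto simp: eventually_at_filter flat_fun_def exp_minus field_simps)
  show "((\<lambda>t. flat_fun k t / t) \<longlongrightarrow> 0) (at_left 0)"
    by (rule Lim_transform_eventually[OF tendsto_const]) (auto simp: eventually_at_filter flat_fun_def)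
qed

lemma flat_fun_derivative:
  "(flat_fun k has_real_derivative (flat_fun (k + 2) t - real k * flat_fun (k + 1) t)) (at t)"
proof -
  consider "t > 0" | "t < 0" | "t = 0" by linarith
  then show ?thesis
  proof cases
    case 1
    have "((\<lambda>t. (1 / t) ^ k * exp (- (1 / t))) has_real_derivative
        (flat_fun (k + 2) t - real k * flat_fun (k + 1) t)) (at t)"
      using 1 by (cases k) (auto intro!: derivative_eq_intros simp: flat_fun_def field_simps power2_eq_square,
          metis One_nat_def mult.commute neq0_conv power_minus_mult)
    then show ?thesis
      by (rule has_field_derivative_transform_within_open[where S="{0<..}"]) (use 1 in \<open>auto simp: flat_fun_def\<close>)
  next
    case 2
    have "((\<lambda>t. 0) has_real_derivative (flat_fun (k + 2) t - real k * flat_fun (k + 1) t)) (at t)"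
      using 2 by (simp add: flat_fun_def)
    then show ?thesis
      by (rule has_field_derivative_transform_within_open[where S="{..<0}"]) (use 2 in \<open>auto simp: flat_fun_def\<close>)
  next
    case 3
    then show ?thesis using flat_fun_tendsto[of k] by (simp add: has_field_derivative_iff flat_fun_def[of _ 0])
  qed
qed

lemma flat_fun_smooth: "smooth_on UNIV (flat_fun k)"
proof -
  have d: "(flat_fun k has_derivative (\<lambda>v. v * (flat_fun (k + 2) t - real k * flat_fun (k + 1) t))) (at t)" for k t
    using flat_fun_derivative[of k t] by (simp add: has_field_derivative_def mult_commute_abs)
  have "Ck_on n UNIV (flat_fun k)" for n
  proof (induction n arbitrary: k)
    case 0
    show ?case using d by (auto intro!: continuous_at_imp_continuous_on has_derivative_continuous)
  next
    case (Suc n)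
    have "dd (flat_fun k) t v = v * (flat_fun (k + 2) t + (- real k) * flat_fun (k + 1) t)" for t v
      using dd_eq[OF d, of k t v] by simp
    moreover have "Ck_on n UNIV (\<lambda>t. v * (flat_fun (k + 2) t + (- real k) * flat_fun (k + 1) t))" for v
      by (intro Ck_on_linear_compose[OF bounded_linear_mult_right] Ck_on_add open_UNIV Suc)
    ultimately have "Ck_on n UNIV (\<lambda>t. dd (flat_fun k) t v)" for v by presburger
    then show ?case using d by (auto simp: differentiable_def)
  qed
  then show ?thesis by (simp add: smooth_on_def)
qed

lemma bump_function:
  fixes x0 :: "'e::euclidean_space"
  assumes "\<epsilon> > 0"
  obtains \<rho> :: "'e \<Rightarrow> real" and \<delta> where "smooth_on UNIV \<rho>" "\<delta> > 0" "\<And>x. x \<in> ball x0 \<delta> \<Longrightarrow> \<rho> x = 1"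
    "\<And>x. x \<notin> cball x0 \<epsilon> \<Longrightarrow> \<rho> x = 0"
proof
  define \<delta> where "\<delta> = \<epsilon> / 2"
  define s where "s x = (x - x0) \<bullet> (x - x0) - \<delta>\<^sup>2" for x :: 'e
  define c where "c = flat_fun 0 (\<epsilon>\<^sup>2 - \<delta>\<^sup>2)"
  \<comment> \<open>The inner flat function is 0 up to radius \<delta> and at least \<open>c\<close>
    from radius \<epsilon> on, so the outer argument is 1 inside and nonpositive outside. The
    construction uses only compositions and division by constants.\<close>
  define \<rho> where "\<rho> x = flat_fun 0 (1 - flat_fun 0 (s x) / c) / flat_fun 0 1" for x
  show d: "\<delta> > 0" using assms by (simp add: \<delta>_def)
  have p: "\<epsilon>\<^sup>2 - \<delta>\<^sup>2 > 0" using assms by (simp add: \<delta>_def power2_eq_square field_simps)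
  then have c: "c > 0" by (simp add: c_def flat_fun_def)
  have ns: "s x = (norm (x - x0))\<^sup>2 - \<delta>\<^sup>2" for x by (simp add: s_def power2_norm_eq_inner)
  have sms: "smooth_on UNIV s" unfolding s_def
    by (intro smooth_on_diff smooth_on_inner smooth_on_const open_UNIV smooth_on_linear bounded_linear_ident)
  have 1: "smooth_on UNIV (\<lambda>x. flat_fun 0 (s x))"
    by (rule smooth_on_compose[OF open_UNIV open_UNIV _ sms flat_fun_smooth]) simp
  have 2: "smooth_on UNIV (\<lambda>x. 1 - flat_fun 0 (s x) / c)"
    by (intro smooth_on_diff open_UNIV smooth_on_const smooth_on_linear_compose[OF bounded_linear_divide] 1)
  have 3: "smooth_on UNIV (\<lambda>x. flat_fun 0 (1 - flat_fun 0 (s x) / c))"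
    by (rule smooth_on_compose[OF open_UNIV open_UNIV _ 2 flat_fun_smooth]) simp
  show "smooth_on UNIV \<rho>"
    unfolding \<rho>_def by (intro smooth_on_linear_compose[OF bounded_linear_divide] open_UNIV 3)
  show "\<rho> x = 1" if "x \<in> ball x0 \<delta>" for x
  proof -
    have "(norm (x - x0))\<^sup>2 \<le> \<delta>\<^sup>2" using that by (intro power_mono) (auto simp: dist_norm norm_minus_commute)
    then show ?thesis by (simp add: \<rho>_def ns flat_fun_def)
  qed
  show "\<rho> x = 0" if "x \<notin> cball x0 \<epsilon>" for x
  proof -
    have "\<epsilon>\<^sup>2 \<le> (norm (x - x0))\<^sup>2" using that assms by (intro power_mono) (auto simp: dist_norm norm_minus_commute)
    then have "s x \<ge> \<epsilon>\<^sup>2 - \<delta>\<^sup>2" by (simp add: ns)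
    then have "flat_fun 0 (s x) \<ge> c" using p by (auto simp: c_def flat_fun_def frac_le)
    then have "1 - flat_fun 0 (s x) / c \<le> 0" using c by simp
    then show ?thesis by (simp add: \<rho>_def flat_fun_def)
  qed
qed

section \<open>Positive definite forms\<close>

text \<open>The constant is the minimum on the compact unit sphere, carried to all vectors by
  homogeneity of degree two.\<close>

lemma positive_definite_lower_bound:
  fixes h :: "'e::euclidean_space \<Rightarrow> 'e \<Rightarrow> real"
  assumes "bilinear h" "\<And>v. v \<noteq> 0 \<Longrightarrow> h v v > 0"
  obtains c where "c > 0" "\<And>v. h v v \<ge> c * (norm v)\<^sup>2"
proof -
  have cont: "continuous_on (sphere 0 1) (\<lambda>v. h v v)"
    using assms(1) unfolding bilinear_conv_bounded_bilinear
    by (rule bounded_bilinear.continuous_on) (rule continuous_on_id)+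
  obtain b :: 'e where "b \<in> Basis" using nonempty_Basis by blast
  then have "sphere (0::'e) 1 \<noteq> {}" by (auto intro!: exI[of _ b])
  then obtain v0 where v0: "v0 \<in> sphere 0 1" "\<And>v. v \<in> sphere 0 1 \<Longrightarrow> h v0 v0 \<le> h v v"
    using continuous_attains_inf[OF compact_sphere _ cont] by blast
  have hs: "h (r *\<^sub>R v) (r *\<^sub>R v) = r\<^sup>2 * h v v" for r v
    using assms(1) by (simp add: bilinear_lmul bilinear_rmul power2_eq_square)
  show ?thesis
  proof
    show "h v0 v0 > 0" using v0(1) by (intro assms(2)) auto
    show "h v v \<ge> h v0 v0 * (norm v)\<^sup>2" for v
    proof (cases "v = 0")
      case True
      then show ?thesis using hs[of 0 v] by simp
    next
      case False
      have "h v v = (norm v)\<^sup>2 * h (sgn v) (sgn v)"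
        using hs[of "norm v" "sgn v"] False by (simp add: sgn_div_norm)
      also have "\<dots> \<ge> (norm v)\<^sup>2 * h v0 v0"
        using v0(2)[of "sgn v"] False by (intro mult_left_mono) (auto simp: norm_sgn)
      finally show ?thesis by (simp add: mult.commute)
    qed
  qed
qed

text \<open>One radius works for all \<open>v\<close>, because the change of the quadratic form is
  at most \<open>|v|^2\<close> times the sum \<open>s z\<close> of the changes of the matrix
  entries, while the form at \<open>z0\<close> is at least \<open>c |v|^2\<close>.\<close>

lemma positive_definite_open:
  fixes h :: "'e::euclidean_space \<Rightarrow> 'e \<Rightarrow> 'e \<Rightarrow> real"
  assumes S: "open S" "z0 \<in> S" and bil: "\<And>z. z \<in> S \<Longrightarrow> bilinear (h z)"
    and cont: "\<And>v w. continuous_on S (\<lambda>z. h z v w)" and pos: "\<And>v. v \<noteq> 0 \<Longrightarrow> h z0 v v > 0"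
  obtains r where "r > 0" "ball z0 r \<subseteq> S" "\<And>z v. z \<in> ball z0 r \<Longrightarrow> v \<noteq> 0 \<Longrightarrow> h z v v > 0"
proof -
  obtain c where c: "c > 0" "\<And>v. h z0 v v \<ge> c * (norm v)\<^sup>2"
    using positive_definite_lower_bound[OF bil[OF S(2)] pos] by blast
  define s where "s z = (\<Sum>i\<in>Basis. \<Sum>j\<in>Basis. \<bar>h z i j - h z0 i j\<bar>)" for z
  have "continuous_on S s" unfolding s_def by (intro continuous_intros cont)
  then have "isCont s z0" using S by (simp add: continuous_on_eq_continuous_at)
  then obtain r1 where r1: "r1 > 0" "\<And>z. dist z z0 < r1 \<Longrightarrow> dist (s z) (s z0) < c"
    using c(1) unfolding continuous_at_eps_delta by blast
  obtain r2 where r2: "r2 > 0" "ball z0 r2 \<subseteq> S" using S openE by blast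
  show ?thesis
  proof (rule that[of "min r1 r2"])
    show "min r1 r2 > 0" "ball z0 (min r1 r2) \<subseteq> S" using r1 r2 by auto
    fix z v :: 'e assume z: "z \<in> ball z0 (min r1 r2)" and v: "v \<noteq> 0"
    have zS: "z \<in> S" using z r2 by auto
    have sz: "s z < c" using r1(2)[of z] z by (auto simp: dist_commute s_def dist_real_def)
    have ex: "h z v v = (\<Sum>i\<in>Basis. \<Sum>j\<in>Basis. (v \<bullet> i) * (v \<bullet> j) * h z i j)" if "z \<in> S" for z
      using bilinear_sum[OF bil[OF that], of "\<lambda>i. (v \<bullet> i) *\<^sub>R i" Basis "\<lambda>i. (v \<bullet> i) *\<^sub>R i" Basis]
        bil[OF that]
      by (simp add: euclidean_representation sum.cartesian_product bilinear_lmul bilinear_rmul case_prod_beta mult.assoc)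
    have "\<bar>h z v v - h z0 v v\<bar> \<le> (\<Sum>i\<in>Basis. \<Sum>j\<in>Basis. (norm v)\<^sup>2 * \<bar>h z i j - h z0 i j\<bar>)"
      unfolding ex[OF zS] ex[OF S(2)] sum_subtractf[symmetric]
    proof (intro order_trans[OF sum_abs] sum_mono)
      fix i j :: 'e assume "i \<in> Basis" "j \<in> Basis"
      then have "\<bar>v \<bullet> i\<bar> * \<bar>v \<bullet> j\<bar> \<le> norm v * norm v" by (intro mult_mono Basis_le_norm) auto
      then show "\<bar>(v \<bullet> i) * (v \<bullet> j) * h z i j - (v \<bullet> i) * (v \<bullet> j) * h z0 i j\<bar> \<le> (norm v)\<^sup>2 * \<bar>h z i j - h z0 i j\<bar>"
        unfolding right_diff_distrib[symmetric] abs_mult power2_eq_square by (intro mult_right_mono) auto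
    qed
    also have "\<dots> = (norm v)\<^sup>2 * s z" by (simp add: s_def sum_distrib_left)
    also have "\<dots> < (norm v)\<^sup>2 * c" using sz v by simp
    finally show "h z v v > 0" using c(2)[of v] by (simp add: mult.commute)
  qed
qed

section \<open>Affine coordinates and Hessian potentials\<close>

lemma smooth_on_Pair:
  assumes "open S" "smooth_on S f" "smooth_on S g"
  shows "smooth_on S (\<lambda>x. (f x, g x))"
proof -
  have "bounded_linear (\<lambda>a. (a, 0))" "bounded_linear (\<lambda>b. (0, b))"
    by (auto intro!: bounded_linear_Pair bounded_linear_ident bounded_linear_zero)
  from smooth_on_add[OF assms(1) smooth_on_linear_compose[OF this(1) assms(1,2)]
      smooth_on_linear_compose[OF this(2) assms(1,3)]]
  show ?thesis by simp
qed

text \<open>The vector representing a functional with respect to the Euclidean inner product. Only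
  the values on \<open>Basis\<close> enter, so it also packs a finite family of scalar equations
  into one vector equation.\<close>

definition riesz :: "('e::euclidean_space \<Rightarrow> real) \<Rightarrow> 'e" where
  "riesz f = (\<Sum>b\<in>Basis. f b *\<^sub>R b)"

lemma riesz_inner: "linear f \<Longrightarrow> riesz f \<bullet> w = f w"
  unfolding riesz_def inner_sum_left using linear_expand[of f w] by (simp add: inner_commute mult.commute)

lemma riesz_add: "riesz (\<lambda>b. f b + g b) = riesz f + riesz g"
  by (simp add: riesz_def scaleR_add_left sum.distrib)

lemma riesz_scale: "riesz (\<lambda>b. c * f b) = c *\<^sub>R riesz f"
  by (simp add: riesz_def scaleR_sum_right)

lemma smooth_on_riesz:
  "open S \<Longrightarrow> (\<And>b. smooth_on S (\<lambda>x. f x b)) \<Longrightarrow> smooth_on S (\<lambda>x. riesz (f x))"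
  unfolding riesz_def
  by (intro smooth_on_sum smooth_on_linear_compose[OF bounded_linear_scaleR_left])

lemma has_derivative_riesz:
  assumes "\<And>b. ((\<lambda>x. f x b) has_derivative (\<lambda>v. f' v b)) F"
  shows "((\<lambda>x. riesz (f x)) has_derivative (\<lambda>v. riesz (f' v))) F"
  unfolding riesz_def by (intro has_derivative_sum has_derivative_scaleR_left assms)

text \<open>The equations \<open>D dp = c G\<close>, \<open>dc = 0\<close> written as a first-order system for \<open>(p, \<theta>, c)\<close>, where
  \<open>\<theta>\<close> represents \<open>dp\<close>.  Solutions with \<open>c = 0\<close> are affine functions, those with \<open>c = 1\<close> are
  potentials of \<open>G\<close>.  Integrability amounts to symmetry, flatness and the Codazzi equation.\<close>

definition hessian_system ::
    "('n::euclidean_space \<Rightarrow> 'n \<Rightarrow> 'n \<Rightarrow> 'n) \<Rightarrow> ('n \<Rightarrow> 'n \<Rightarrow> 'n \<Rightarrow> real)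
      \<Rightarrow> 'n \<Rightarrow> 'n \<Rightarrow> real \<times> 'n \<times> real \<Rightarrow> real \<times> 'n \<times> real" where
  "hessian_system \<Gamma> G x v y =
     (fst (snd y) \<bullet> v, riesz (\<lambda>b. fst (snd y) \<bullet> \<Gamma> x v b + snd (snd y) * G x v b), 0)"

text \<open>A flat statistical structure seen in one chart: \<Gamma> are the Christoffel symbols and
  \<open>G\<close> the metric coefficients. \<open>flat\<close> is the vanishing curvature on
  constant fields, and \<open>codazzi\<close> is the symmetry of the derivative of the metric in its
  first two arguments, after cancelling the term that is equal on both sides by the symmetry of
  \<Gamma>.\<close>

locale flat_hessian =
  fixes S :: "'n::euclidean_space set" and \<Gamma> :: "'n \<Rightarrow> 'n \<Rightarrow> 'n \<Rightarrow> 'n" and G :: "'n \<Rightarrow> 'n \<Rightarrow> 'n \<Rightarrow> real"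
  assumes open_S: "open S"
    and smooth_\<Gamma>: "smooth_on S (\<lambda>x. \<Gamma> x v w)" and smooth_G: "smooth_on S (\<lambda>x. G x v w)"
    and bilinear_\<Gamma>: "x \<in> S \<Longrightarrow> bilinear (\<Gamma> x)" and bilinear_G: "x \<in> S \<Longrightarrow> bilinear (G x)"
    and sym_\<Gamma>: "x \<in> S \<Longrightarrow> \<Gamma> x v w = \<Gamma> x w v" and sym_G: "x \<in> S \<Longrightarrow> G x v w = G x w v"
    and flat: "x \<in> S \<Longrightarrow> dd (\<lambda>x. \<Gamma> x w z) x v + \<Gamma> x v (\<Gamma> x w z) = dd (\<lambda>x. \<Gamma> x v z) x w + \<Gamma> x w (\<Gamma> x v z)"
    and codazzi: "x \<in> S \<Longrightarrow> dd (\<lambda>x. G x w z) x v - G x w (\<Gamma> x v z) = dd (\<lambda>x. G x v z) x w - G x v (\<Gamma> x w z)"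
begin

lemma linear_\<Gamma>: "x \<in> S \<Longrightarrow> linear (\<Gamma> x v)" "x \<in> S \<Longrightarrow> linear (\<lambda>v. \<Gamma> x v w)"
  using bilinear_\<Gamma> by (auto simp: bilinear_def)

lemma linear_G: "x \<in> S \<Longrightarrow> linear (G x v)" "x \<in> S \<Longrightarrow> linear (\<lambda>v. G x v w)"
  using bilinear_G by (auto simp: bilinear_def)

lemma linear_coeff: "x \<in> S \<Longrightarrow> linear (\<lambda>b. \<theta> \<bullet> \<Gamma> x v b + c * G x v b)"
  using linear_add[OF linear_\<Gamma>(1)] linear_scale[OF linear_\<Gamma>(1)] linear_add[OF linear_G(1)] linear_scale[OF linear_G(1)]
  by (auto intro!: linearI simp: inner_add_right algebra_simps)

lemma system_inner:
  assumes "x \<in> S"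
  shows "fst (snd (hessian_system \<Gamma> G x v y)) \<bullet> w = fst (snd y) \<bullet> \<Gamma> x v w + snd (snd y) * G x v w"
  using riesz_inner[OF linear_coeff[OF assms]] by (simp add: hessian_system_def)

lemma smooth_system: "smooth_on S (\<lambda>x. hessian_system \<Gamma> G x v y)"
  unfolding hessian_system_def
  by (intro smooth_on_Pair smooth_on_riesz smooth_on_add smooth_on_const open_S smooth_\<Gamma> smooth_G
      smooth_on_linear_compose[OF bounded_linear_inner_right]
      smooth_on_linear_compose[OF bounded_linear_mult_right])

lemma linear_system:
  assumes "x \<in> S"
  shows "linear (\<lambda>v. hessian_system \<Gamma> G x v y)" "linear (hessian_system \<Gamma> G x v)"
  using linear_add[OF linear_\<Gamma>(2)[OF assms]] linear_scale[OF linear_\<Gamma>(2)[OF assms]]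
    linear_add[OF linear_G(2)[OF assms]] linear_scale[OF linear_G(2)[OF assms]]
  by (auto intro!: linearI simp: hessian_system_def inner_add_left inner_add_right algebra_simps
      simp flip: riesz_add riesz_scale)

text \<open>The scalar component needs the symmetry of \<Gamma> and \<open>G\<close>. In the vector
  component flatness matches the coefficients of \<theta>, and the Codazzi equation those of
  \<open>c\<close>.\<close>

lemma system_integrable:
  assumes x: "x \<in> S"
  shows "dd (\<lambda>x. hessian_system \<Gamma> G x v y) x w + hessian_system \<Gamma> G x v (hessian_system \<Gamma> G x w y)
       = dd (\<lambda>x. hessian_system \<Gamma> G x w y) x v + hessian_system \<Gamma> G x w (hessian_system \<Gamma> G x v y)"
proof -
  obtain p \<theta> c where y: "y = (p, \<theta>, c)" by (cases y) auto
  let ?R = "\<lambda>v w b. \<theta> \<bullet> dd (\<lambda>x. \<Gamma> x v b) x w + c * dd (\<lambda>x. G x v b) x w"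
  have d\<Gamma>: "((\<lambda>x. \<Gamma> x v b) has_derivative dd (\<lambda>x. \<Gamma> x v b) x) (at x)"
    and dG: "((\<lambda>x. G x v b) has_derivative dd (\<lambda>x. G x v b) x) (at x)" for v b
    by (rule smooth_on_has_derivative[OF _ x], rule smooth_\<Gamma> smooth_G)+
  have dA: "dd (\<lambda>x. hessian_system \<Gamma> G x v y) x w = (0, riesz (?R v w), 0)" for v w
  proof (rule dd_eq)
    show "((\<lambda>x. hessian_system \<Gamma> G x v y) has_derivative (\<lambda>w. (0, riesz (?R v w), 0))) (at x)"
      unfolding hessian_system_def y fst_conv snd_conv
      by (intro has_derivative_Pair has_derivative_const has_derivative_riesz has_derivative_add
          bounded_linear.has_derivative[OF bounded_linear_inner_right]
          bounded_linear.has_derivative[OF bounded_linear_mult_right] d\<Gamma> dG)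
  qed
  have AA: "hessian_system \<Gamma> G x v (hessian_system \<Gamma> G x w y)
      = (\<theta> \<bullet> \<Gamma> x w v + c * G x w v, riesz (\<lambda>b. \<theta> \<bullet> \<Gamma> x w (\<Gamma> x v b) + c * G x w (\<Gamma> x v b)), 0)" for v w
  proof -
    have "snd (snd (hessian_system \<Gamma> G x w y)) = 0" by (simp add: hessian_system_def)
    then show ?thesis
      unfolding hessian_system_def[of \<Gamma> G x v] system_inner[OF x] by (simp add: y)
  qed
  have "?R v w b + (\<theta> \<bullet> \<Gamma> x w (\<Gamma> x v b) + c * G x w (\<Gamma> x v b))
      = \<theta> \<bullet> (dd (\<lambda>x. \<Gamma> x v b) x w + \<Gamma> x w (\<Gamma> x v b)) + c * (dd (\<lambda>x. G x v b) x w + G x w (\<Gamma> x v b))" for v w b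
    by (simp add: algebra_simps)
  moreover have "dd (\<lambda>x. G x v b) x w + G x w (\<Gamma> x v b) = dd (\<lambda>x. G x w b) x v + G x v (\<Gamma> x w b)" for b
    using codazzi[OF x, of w b v] by simp
  ultimately have "(\<lambda>b. ?R v w b + (\<theta> \<bullet> \<Gamma> x w (\<Gamma> x v b) + c * G x w (\<Gamma> x v b)))
      = (\<lambda>b. ?R w v b + (\<theta> \<bullet> \<Gamma> x v (\<Gamma> x w b) + c * G x v (\<Gamma> x w b)))"
    using flat[OF x, of v _ w] by simp
  then have "riesz (?R v w) + riesz (\<lambda>b. \<theta> \<bullet> \<Gamma> x w (\<Gamma> x v b) + c * G x w (\<Gamma> x v b))
      = riesz (?R w v) + riesz (\<lambda>b. \<theta> \<bullet> \<Gamma> x v (\<Gamma> x w b) + c * G x v (\<Gamma> x w b))"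
    unfolding riesz_add[symmetric] by simp
  then show ?thesis
    unfolding dA AA by (simp add: sym_\<Gamma>[OF x, of w v] sym_G[OF x, of w v])
qed

text \<open>The radius is chosen before the initial covector and \<open>c\<close>, so that all
  coordinate functions and the potential live on a common ball.\<close>

lemma local_solutions:
  assumes "x0 \<in> S"
  obtains r where "r > 0" "ball x0 r \<subseteq> S"
    "\<And>\<theta>0 c. \<exists>p \<theta>. smooth_on (ball x0 r) p \<and> \<theta> x0 = \<theta>0 \<and>
       (\<forall>x\<in>ball x0 r. \<forall>v w. dd p x v = \<theta> x \<bullet> v \<and>
          ((\<lambda>x. \<theta> x \<bullet> w) has_derivative (\<lambda>v. \<theta> x \<bullet> \<Gamma> x v w + c * G x v w)) (at x))"
proof -
  obtain r where r: "r > 0" "ball x0 r \<subseteq> S"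
    and sol: "\<And>y0. \<exists>Y. Y x0 = y0 \<and> (\<forall>x\<in>ball x0 r. (Y has_derivative (\<lambda>v. hessian_system \<Gamma> G x v (Y x))) (at x))"
    using linear_frobenius[OF open_S assms smooth_system linear_system system_integrable] by blast
  have "\<exists>p \<theta>. smooth_on (ball x0 r) p \<and> \<theta> x0 = \<theta>0 \<and>
       (\<forall>x\<in>ball x0 r. \<forall>v w. dd p x v = \<theta> x \<bullet> v \<and>
          ((\<lambda>x. \<theta> x \<bullet> w) has_derivative (\<lambda>v. \<theta> x \<bullet> \<Gamma> x v w + c * G x v w)) (at x))" for \<theta>0 c
  proof -
    obtain Y where Y: "Y x0 = (0, \<theta>0, c)"
      "\<And>x. x \<in> ball x0 r \<Longrightarrow> (Y has_derivative (\<lambda>v. hessian_system \<Gamma> G x v (Y x))) (at x)"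
      using sol by blast
    have smY: "smooth_on (ball x0 r) Y"
      by (rule linear_pde_solution_smooth[OF open_ball smooth_on_subset[OF smooth_system r(2)] _ Y(2)])
        (use r linear_system in blast)
    have d2: "((\<lambda>x. snd (snd (Y x))) has_derivative (\<lambda>v. 0)) (at x within ball x0 r)" if "x \<in> ball x0 r" for x
      using has_derivative_snd[OF has_derivative_snd[OF Y(2)[OF that]]]
      by (simp add: hessian_system_def has_derivative_at_withinI)
    have c: "snd (snd (Y x)) = c" if "x \<in> ball x0 r" for x
      using has_derivative_zero_unique[OF convex_ball d2 that, of x0] Y(1) r(1) by simp
    have "dd (\<lambda>x. fst (Y x)) x v = fst (snd (Y x)) \<bullet> v" if "x \<in> ball x0 r" for x v
      using dd_eq[OF has_derivative_fst[OF Y(2)[OF that]]] by (simp add: hessian_system_def)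
    moreover have "((\<lambda>x. fst (snd (Y x)) \<bullet> w) has_derivative
        (\<lambda>v. fst (snd (Y x)) \<bullet> \<Gamma> x v w + c * G x v w)) (at x)" if "x \<in> ball x0 r" for x w
      using has_derivative_inner_left[OF has_derivative_fst[OF has_derivative_snd[OF Y(2)[OF that]]], of w]
        system_inner[of x _ "Y x" w] r(2) that c[OF that] by (simp add: subset_iff)
    moreover have "smooth_on (ball x0 r) (\<lambda>x. fst (Y x))"
      by (rule smooth_on_linear_compose[OF bounded_linear_fst open_ball smY])
    ultimately show ?thesis using Y(1)
      by (intro exI[of _ "\<lambda>x. fst (Y x)"] exI[of _ "\<lambda>x. fst (snd (Y x))"]) simp
  qed
  then show ?thesis using that r by blast
qed

text \<open>Solutions with \<open>c = 0\<close> whose initial covectors are the basis vectors form a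
  map \<open>u\<close> with identity derivative at \<open>x0\<close>, hence a local coordinate
  system. The solution with \<open>c = 1\<close>, expressed in these coordinates, is the potential
  of the metric.\<close>

theorem affine_coordinates:
  assumes "x0 \<in> S"
  obtains V W u \<phi> \<Psi> where "open V" "x0 \<in> V" "V \<subseteq> S" "open W" "homeomorphism V W u \<phi>"
    "smooth_on V u" "smooth_on W \<phi>" "\<And>x. x \<in> V \<Longrightarrow> bij (dd u x)" "smooth_on W (\<Psi> :: 'n \<Rightarrow> real)"
    "\<And>x v w. x \<in> V \<Longrightarrow> dd (\<lambda>x. dd u x w) x v = dd u x (\<Gamma> x v w)"
    "\<And>x v w. x \<in> V \<Longrightarrow> G x v w = dd (\<lambda>y. dd \<Psi> y (dd u x w)) (u x) (dd u x v)"
proof -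
  obtain r where r: "r > 0" "ball x0 r \<subseteq> S"
    and sol: "\<And>\<theta>0 c. \<exists>p \<theta>. smooth_on (ball x0 r) p \<and> \<theta> x0 = \<theta>0 \<and>
       (\<forall>x\<in>ball x0 r. \<forall>v w. dd p x v = \<theta> x \<bullet> v \<and>
          ((\<lambda>x. \<theta> x \<bullet> w) has_derivative (\<lambda>v. \<theta> x \<bullet> \<Gamma> x v w + c * G x v w)) (at x))"
    using local_solutions[OF assms] by blast
  let ?B = "ball x0 r"
  have "\<forall>b. \<exists>p \<theta>. smooth_on ?B p \<and> \<theta> x0 = b \<and> (\<forall>x\<in>?B. \<forall>v w. dd p x v = \<theta> x \<bullet> v \<and>
          ((\<lambda>x. \<theta> x \<bullet> w) has_derivative (\<lambda>v. \<theta> x \<bullet> \<Gamma> x v w)) (at x))"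
    using sol[of _ 0] by simp
  from choice[OF this] obtain p where "\<forall>b. \<exists>\<theta>. smooth_on ?B (p b) \<and> \<theta> x0 = b \<and> (\<forall>x\<in>?B. \<forall>v w.
      dd (p b) x v = \<theta> x \<bullet> v \<and> ((\<lambda>x. \<theta> x \<bullet> w) has_derivative (\<lambda>v. \<theta> x \<bullet> \<Gamma> x v w)) (at x))" ..
  from choice[OF this] obtain \<theta> where p: "\<And>b. smooth_on ?B (p b)" "\<And>b. \<theta> b x0 = (b :: 'n)"
    "\<And>b x v. x \<in> ?B \<Longrightarrow> dd (p b) x v = \<theta> b x \<bullet> v"
    "\<And>b x w. x \<in> ?B \<Longrightarrow> ((\<lambda>x. \<theta> b x \<bullet> w) has_derivative (\<lambda>v. \<theta> b x \<bullet> \<Gamma> x v w)) (at x)"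
    by blast
  obtain q \<tau> where q: "smooth_on ?B q" "\<And>x v. x \<in> ?B \<Longrightarrow> dd q x v = \<tau> x \<bullet> v"
    "\<And>x w. x \<in> ?B \<Longrightarrow> ((\<lambda>x. \<tau> x \<bullet> w) has_derivative (\<lambda>v. \<tau> x \<bullet> \<Gamma> x v w + G x v w)) (at x)"
    \<comment> \<open>The initial covector 0 is a normalization: two solutions with
      \<open>c = 1\<close> differ by one with \<open>c = 0\<close>, that is, by an affine
      function.\<close>
    using sol[of 0 1] by auto
  define u where "u x = riesz (\<lambda>b. p b x)" for x
  have smu: "smooth_on ?B u" unfolding u_def by (intro smooth_on_riesz open_ball p(1))
  have du: "dd u x v = riesz (\<lambda>b. \<theta> b x \<bullet> v)" if "x \<in> ?B" for x v
  proof -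
    have "dd (p b) x = (\<lambda>v. \<theta> b x \<bullet> v)" for b using p(3)[OF that] by (simp add: fun_eq_iff)
    then have "(p b has_derivative (\<lambda>v. \<theta> b x \<bullet> v)) (at x)" for b
      using smooth_on_has_derivative[OF p(1) that, of b] by simp
    then show ?thesis unfolding u_def by (intro dd_eq has_derivative_riesz)
  qed
  have ddu: "dd (\<lambda>x. dd u x w) x v = dd u x (\<Gamma> x v w)" if "x \<in> ?B" for x v w
  proof -
    have "dd (\<lambda>x. dd u x w) x v = dd (\<lambda>x. riesz (\<lambda>b. \<theta> b x \<bullet> w)) x v"
      by (rule dd_cong[OF open_ball that, THEN fun_cong]) (rule du)
    also have "\<dots> = riesz (\<lambda>b. \<theta> b x \<bullet> \<Gamma> x v w)" by (rule dd_eq, rule has_derivative_riesz, rule p(4)[OF that])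
    finally show ?thesis by (simp add: du[OF that])
  qed
  have x0B: "x0 \<in> ?B" using r by simp
  have "dd u x0 v = v" for v
    unfolding du[OF x0B] p(2) riesz_def inner_commute[of _ v] by (rule euclidean_representation)
  then have "inj (dd u x0)" by (simp add: inj_def)
  from smooth_inverse_function[OF open_ball x0B smu this] obtain V W \<phi> where
    V: "open V" "x0 \<in> V" "V \<subseteq> ?B" "open W" "homeomorphism V W u \<phi>" "smooth_on W \<phi>" "\<And>x. x \<in> V \<Longrightarrow> bij (dd u x)"
    by blast
  have smuV: "smooth_on V u" using smooth_on_subset[OF smu V(3)] .
  define \<Psi> where "\<Psi> y = q (\<phi> y)" for y
  have \<phi>: "\<phi> ` W \<subseteq> V" "u ` V \<subseteq> W" "\<And>x. x \<in> V \<Longrightarrow> \<phi> (u x) = x" using V(5) by (auto simp: homeomorphism_def)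
  have sm\<Psi>: "smooth_on W \<Psi>"
    unfolding \<Psi>_def by (rule smooth_on_compose[OF V(4,1) \<phi>(1) V(6) smooth_on_subset[OF q(1) V(3)]])
  have q1: "dd q x w = dd \<Psi> (u x) (dd u x w)" if x: "x \<in> V" for x w
  proof -
    have "dd q x w = dd (\<lambda>x. \<Psi> (u x)) x w"
      by (rule dd_cong[OF V(1) x, THEN fun_cong]) (simp add: \<Psi>_def \<phi>)
    also have "\<dots> = dd \<Psi> (u x) (dd u x w)"
      using x \<phi>(2) by (intro dd_compose smooth_on_differentiable[OF smuV] smooth_on_differentiable[OF sm\<Psi>]) auto
    finally show ?thesis .
  qed
  have "G x v w = dd (\<lambda>y. dd \<Psi> y (dd u x w)) (u x) (dd u x v)" if x: "x \<in> V" for x v w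
  proof -
    have xB: "x \<in> ?B" using x V(3) by blast
    have ux: "u x \<in> W" using x \<phi>(2) by blast
    \<comment> \<open>The second derivative of \<open>q\<close> is computed twice, from the system
      and by the chain rule through \<Psi>. Both results contain the differential of
      \<open>q\<close> at \<open>\<Gamma> x v w\<close>, the second because \<open>u\<close> is
      affine; cancelling it leaves the claim.\<close>
    have "dd (\<lambda>x. dd q x w) x v = dd (\<lambda>x. \<tau> x \<bullet> w) x v"
      by (rule dd_cong[OF open_ball xB, THEN fun_cong]) (rule q(2))
    then have 1: "dd (\<lambda>x. dd q x w) x v = \<tau> x \<bullet> \<Gamma> x v w + G x v w" using dd_eq[OF q(3)[OF xB]] by simp
    have "dd (\<lambda>x. dd q x w) x v = dd (\<lambda>x. dd \<Psi> (u x) (dd u x w)) x v"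
      by (rule dd_cong[OF V(1) x, THEN fun_cong]) (rule q1)
    also have "\<dots> = dd (\<lambda>z. dd \<Psi> (u z) (dd u x w)) x v + dd \<Psi> (u x) (dd (\<lambda>x. dd u x w) x v)"
    proof (rule dd_linear_family(1)[OF V(1) x, of "\<lambda>x. dd \<Psi> (u x)"])
      show "linear (dd \<Psi> (u z))" if "z \<in> V" for z using that \<phi>(2) by (intro smooth_on_linear_dd[OF sm\<Psi>]) auto
      show "(\<lambda>z. dd \<Psi> (u z) a) differentiable (at x)" for a
        using smooth_on_differentiable[OF smooth_on_dd[OF sm\<Psi>] ux, of a] smooth_on_differentiable[OF smuV x]
          differentiable_chain_at[of u x "\<lambda>y. dd \<Psi> y a"] by (simp add: o_def)
      show "(\<lambda>x. dd u x w) differentiable (at x)" using smooth_on_differentiable[OF smooth_on_dd[OF smuV] x] .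
    qed
    also have "dd (\<lambda>z. dd \<Psi> (u z) (dd u x w)) x v = dd (\<lambda>y. dd \<Psi> y (dd u x w)) (u x) (dd u x v)"
      by (rule dd_compose[OF smooth_on_differentiable[OF smuV x] smooth_on_differentiable[OF smooth_on_dd[OF sm\<Psi>] ux]])
    also have "dd \<Psi> (u x) (dd (\<lambda>x. dd u x w) x v) = \<tau> x \<bullet> \<Gamma> x v w"
      unfolding ddu[OF xB] q1[OF x, symmetric] q(2)[OF xB] by simp
    finally show ?thesis using 1 by simp
  qed
  then show ?thesis using that[OF V(1,2) _ V(4,5) smuV V(6,7) sm\<Psi>] ddu V(3) r(2) by blast
qed

end

text \<open>\<eta> is the dual coordinate system of Hessian geometry. The symmetry of its derivative
  is what later allows a derivative of \<eta> to be moved from one argument of the metric to the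
  other.\<close>

lemma gradient_potential:
  assumes "smooth_on W (\<Psi> :: 'n::euclidean_space \<Rightarrow> real)" "open W"
  defines "\<eta> \<equiv> (\<lambda>y. riesz (dd \<Psi> y))"
  shows "smooth_on W \<eta>"
    and "y \<in> W \<Longrightarrow> dd \<Psi> y a = \<eta> y \<bullet> a"
    and "y \<in> W \<Longrightarrow> dd (\<lambda>y. dd \<Psi> y a) y b = dd \<eta> y b \<bullet> a"
    and "y \<in> W \<Longrightarrow> dd \<eta> y b \<bullet> a = dd \<eta> y a \<bullet> b"
proof -
  show sm: "smooth_on W \<eta>" unfolding \<eta>_def using assms by (intro smooth_on_riesz smooth_on_dd)
  show 1: "dd \<Psi> y a = \<eta> y \<bullet> a" if "y \<in> W" for y a
    unfolding \<eta>_def by (simp add: riesz_inner[OF smooth_on_linear_dd[OF assms(1) that]])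
  show 2: "dd (\<lambda>y. dd \<Psi> y a) y b = dd \<eta> y b \<bullet> a" if "y \<in> W" for y a b
  proof -
    have "dd (\<lambda>y. dd \<Psi> y a) y b = dd (\<lambda>y. \<eta> y \<bullet> a) y b"
      by (rule dd_cong[OF assms(2) that, THEN fun_cong]) (rule 1)
    also have "\<dots> = dd \<eta> y b \<bullet> a"
      by (rule dd_linear[OF bounded_linear_inner_left smooth_on_differentiable[OF sm that]])
    finally show ?thesis .
  qed
  show "dd \<eta> y b \<bullet> a = dd \<eta> y a \<bullet> b" if "y \<in> W"
    using symmetric_second_derivative[OF assms(2,1) that] 2[OF that] by metis
qed

text \<open>The \<open>K\<close>-term of the potential vanishes to second order on the graph of \<open>\<eta>\<close> and makes the Hessian
  positive definite there.\<close>

theorem doubled_potential: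
  fixes \<Psi> :: "'n::euclidean_space \<Rightarrow> real" and P1 P2 :: "'k::euclidean_space \<Rightarrow> 'n" and \<beta> :: real
  assumes W: "open W" and \<Psi>: "smooth_on W \<Psi>"
    and P: "linear P1" "linear P2" and P_inj: "\<And>z. P1 z = 0 \<Longrightarrow> P2 z = 0 \<Longrightarrow> z = 0"
  defines "\<eta> \<equiv> (\<lambda>y. riesz (dd \<Psi> y))"
  assumes z0: "P1 z0 \<in> W" "P2 z0 = \<eta> (P1 z0)"
    and pos: "\<And>a. a \<noteq> 0 \<Longrightarrow> dd \<eta> (P1 z0) a \<bullet> a > 0"
  obtains O' \<Phi> K where "open O'" "z0 \<in> O'" "P1 ` O' \<subseteq> W" "smooth_on O' \<Phi>"
    "\<And>z v. z \<in> O' \<Longrightarrow> v \<noteq> 0 \<Longrightarrow> dd (\<lambda>z. dd \<Phi> z v) z v > 0"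
    "\<And>z v w. z \<in> O' \<Longrightarrow> P2 z = \<eta> (P1 z) \<Longrightarrow> dd (\<lambda>z. dd \<Phi> z w) z v =
       (1 - 2 * \<beta>) * (dd \<eta> (P1 z) (P1 v) \<bullet> P1 w) + \<beta> * (P1 v \<bullet> P2 w + P1 w \<bullet> P2 v)
       + K * ((P2 v - dd \<eta> (P1 z) (P1 v)) \<bullet> (P2 w - dd \<eta> (P1 z) (P1 w)))"
proof -
  note \<eta> = gradient_potential[OF \<Psi> W, folded \<eta>_def]
  have bP: "bounded_linear P1" "bounded_linear P2" using P linear_conv_bounded_linear by auto
  define O1 where "O1 = P1 -` W"
  have O1: "open O1" "z0 \<in> O1" "\<And>z. z \<in> O1 \<Longrightarrow> P1 z \<in> W"
    using z0 W linear_continuous_on[OF bP(1), of UNIV] by (auto simp: O1_def continuous_on_open_vimage[OF open_UNIV])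
  have smP: "smooth_on O1 P1" "smooth_on O1 P2" using bP by (auto intro: smooth_on_linear)
  have dP: "(P1 has_derivative P1) (at z)" "(P2 has_derivative P2) (at z)" for z
    using bP by (auto intro: bounded_linear_imp_has_derivative)
  have O1W: "P1 ` O1 \<subseteq> W" using O1 by auto
  define E where "E z = P2 z - \<eta> (P1 z)" for z
  have smE: "smooth_on O1 E"
    unfolding E_def by (intro smooth_on_diff smooth_on_compose[OF O1(1) W O1W smP(1) \<eta>(1)] O1 smP)
  have d\<eta>: "((\<lambda>z. \<eta> (P1 z)) has_derivative (\<lambda>v. dd \<eta> (P1 z) (P1 v))) (at z)" if "z \<in> O1" for z
    by (rule has_derivative_compose[OF dP(1) smooth_on_has_derivative[OF \<eta>(1) O1(3)[OF that]]])
  have dE: "dd E z v = P2 v - dd \<eta> (P1 z) (P1 v)" if "z \<in> O1" for z v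
    unfolding E_def by (rule dd_eq) (intro has_derivative_diff dP d\<eta> that)
  obtain c where c: "c > 0" "\<And>a. dd \<eta> (P1 z0) a \<bullet> a \<ge> c * (norm a)\<^sup>2"
  proof -
    have "bilinear (\<lambda>a b. dd \<eta> (P1 z0) a \<bullet> b)"
      using smooth_on_linear_dd[OF \<eta>(1) z0(1)]
      by (auto simp: bilinear_def linear_iff inner_add_left inner_add_right)
    from positive_definite_lower_bound[OF this pos] show ?thesis using that by blast
  qed
  \<comment> \<open>Chosen so that, after multiplication by \<open>c\<close>, the square can be
    completed: the form is then at least \<open>(c |a| - |\<beta>| |e|)^2 + c |e|^2\<close>.\<close>
  define K where "K = \<beta>\<^sup>2 / c + 1"
  define \<Phi> where "\<Phi> z = (1 - 2 * \<beta>) * \<Psi> (P1 z) + \<beta> * (P1 z \<bullet> P2 z) + K / 2 * (E z \<bullet> E z)" for z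
  have sm\<Phi>: "smooth_on O1 \<Phi>"
    unfolding \<Phi>_def
    by (intro smooth_on_add smooth_on_linear_compose[OF bounded_linear_mult_right] O1 smooth_on_inner smE smP
        smooth_on_compose[OF O1(1) W O1W smP(1) \<Psi>])
  have d1: "dd \<Phi> z w = (1 - 2 * \<beta>) * (\<eta> (P1 z) \<bullet> P1 w) + \<beta> * (P1 z \<bullet> P2 w + P1 w \<bullet> P2 z) + K * (E z \<bullet> dd E z w)"
    if z: "z \<in> O1" for z w
  proof -
    have "((\<lambda>z. \<Psi> (P1 z)) has_derivative (\<lambda>w. \<eta> (P1 z) \<bullet> P1 w)) (at z)"
      using has_derivative_compose[OF dP(1) smooth_on_has_derivative[OF \<Psi> O1(3)[OF z]]] \<eta>(2)[OF O1(3)[OF z]]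
      by (simp add: \<eta>_def)
    then have "(\<Phi> has_derivative (\<lambda>w. (1 - 2 * \<beta>) * (\<eta> (P1 z) \<bullet> P1 w) + \<beta> * (P1 z \<bullet> P2 w + P1 w \<bullet> P2 z)
        + K / 2 * (E z \<bullet> dd E z w + dd E z w \<bullet> E z))) (at z)"
      unfolding \<Phi>_def
      by (intro has_derivative_add has_derivative_mult_right has_derivative_inner dP smooth_on_has_derivative[OF smE z])
    from dd_eq[OF this] show ?thesis by (simp add: inner_commute)
  qed
  \<comment> \<open>On the graph \<open>E z = 0\<close>, so the second derivative of
    \<open>E\<close> drops out and only the product of first derivatives survives.\<close>
  have d2: "dd (\<lambda>z. dd \<Phi> z w) z v = (1 - 2 * \<beta>) * (dd \<eta> (P1 z) (P1 v) \<bullet> P1 w) + \<beta> * (P1 v \<bullet> P2 w + P1 w \<bullet> P2 v)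
       + K * ((P2 v - dd \<eta> (P1 z) (P1 v)) \<bullet> (P2 w - dd \<eta> (P1 z) (P1 w)))"
    if z: "z \<in> O1" and E0: "P2 z = \<eta> (P1 z)" for z v w
  proof -
    have "dd (\<lambda>z. dd \<Phi> z w) z v = dd (\<lambda>z. (1 - 2 * \<beta>) * (\<eta> (P1 z) \<bullet> P1 w)
        + \<beta> * (P1 z \<bullet> P2 w + P1 w \<bullet> P2 z) + K * (E z \<bullet> dd E z w)) z v"
      by (rule dd_cong[OF O1(1) z, THEN fun_cong]) (rule d1)
    also have "\<dots> = (1 - 2 * \<beta>) * (dd \<eta> (P1 z) (P1 v) \<bullet> P1 w) + \<beta> * (P1 v \<bullet> P2 w + P1 w \<bullet> P2 v)
        + K * (E z \<bullet> dd (\<lambda>z. dd E z w) z v + dd E z v \<bullet> dd E z w)"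
      by (rule dd_eq) (intro has_derivative_add has_derivative_mult_right has_derivative_inner has_derivative_inner_left
          has_derivative_inner_right d\<eta>[OF z] dP
          smooth_on_has_derivative[OF smE z] smooth_on_has_derivative[OF smooth_on_dd[OF smE] z])
    finally show ?thesis using E0 by (simp add: dE[OF z] E_def[of z])
  qed
  have bil: "bilinear (\<lambda>v w. dd (\<lambda>z. dd \<Phi> z w) z v)" if z: "z \<in> O1" for z
    unfolding bilinear_def
    using smooth_on_linear_dd[OF smooth_on_dd[OF sm\<Phi>] z]
      linear_dd_parameter[OF O1(1) z smooth_on_linear_dd[OF sm\<Phi>] smooth_on_differentiable[OF smooth_on_dd[OF sm\<Phi>] z]]
    by auto
  have pos0: "dd (\<lambda>z. dd \<Phi> z w) z0 w > 0" if "w \<noteq> 0" for w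
  proof -
    define a where "a = P1 w"
    \<comment> \<open>The deviation of \<open>w\<close> from the tangent vector of the graph over
      \<open>a\<close>. Substituting \<open>P2 w = dd \<eta> (P1 z0) a + e\<close> collects the
      weight \<open>(1 - 2\<beta>) + 2\<beta> = 1\<close> in front of the metric of
      \<open>a\<close>.\<close>
    define e where "e = P2 w - dd \<eta> (P1 z0) a"
    have s: "dd (\<lambda>z. dd \<Phi> z w) z0 w = dd \<eta> (P1 z0) a \<bullet> a + 2 * \<beta> * (a \<bullet> e) + K * (norm e)\<^sup>2"
      unfolding d2[OF O1(2) z0(2)] a_def[symmetric] e_def[symmetric]
      by (simp add: e_def power2_norm_eq_inner algebra_simps inner_commute)
    have "c * (2 * \<beta> * (a \<bullet> e)) \<ge> c * (- (2 * \<bar>\<beta>\<bar> * (norm a * norm e)))"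
    proof (intro mult_left_mono)
      have "\<bar>\<beta> * (a \<bullet> e)\<bar> \<le> \<bar>\<beta>\<bar> * (norm a * norm e)"
        unfolding abs_mult by (intro mult_left_mono Cauchy_Schwarz_ineq2) simp
      then show "2 * \<beta> * (a \<bullet> e) \<ge> - (2 * \<bar>\<beta>\<bar> * (norm a * norm e))" by linarith
    qed (use c(1) in simp)
    moreover have "c * (dd \<eta> (P1 z0) a \<bullet> a) \<ge> c * (c * (norm a)\<^sup>2)" using c by simp
    moreover have "c * (K * (norm e)\<^sup>2) = \<beta>\<^sup>2 * (norm e)\<^sup>2 + c * (norm e)\<^sup>2"
      using c(1) by (simp add: K_def field_simps)
    ultimately have "c * dd (\<lambda>z. dd \<Phi> z w) z0 w \<ge> (c * norm a - \<bar>\<beta>\<bar> * norm e)\<^sup>2 + c * (norm e)\<^sup>2"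
      unfolding s by (simp add: power2_eq_square algebra_simps)
    moreover have "(c * norm a - \<bar>\<beta>\<bar> * norm e)\<^sup>2 + c * (norm e)\<^sup>2 > 0"
    proof (cases "e = 0")
      case True
      then have "a \<noteq> 0" using P_inj[of w] that linear_0[OF smooth_on_linear_dd[OF \<eta>(1) z0(1)]]
        by (auto simp: a_def e_def)
      then show ?thesis using True c(1) by simp
    next
      case False
      then show ?thesis using c(1) by (intro add_nonneg_pos) auto
    qed
    ultimately have "c * dd (\<lambda>z. dd \<Phi> z w) z0 w > 0" by linarith
    then show ?thesis using c(1) by (simp add: zero_less_mult_iff)
  qed
  obtain r where r: "r > 0" "ball z0 r \<subseteq> O1" "\<And>z v. z \<in> ball z0 r \<Longrightarrow> v \<noteq> 0 \<Longrightarrow> dd (\<lambda>z. dd \<Phi> z v) z v > 0"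
    using positive_definite_open[OF O1(1,2) bil smooth_on_continuous[OF smooth_on_dd[OF smooth_on_dd[OF sm\<Phi>]]] pos0]
    by blast
  show ?thesis
  proof (rule that[of "ball z0 r" \<Phi> K])
    show "smooth_on (ball z0 r) \<Phi>" by (rule smooth_on_subset[OF sm\<Phi> r(2)])
    show "P1 ` ball z0 r \<subseteq> W" using r(2) O1W by blast
  qed (use r d2 in auto)
qed

section \<open>Local calculus on manifolds\<close>

locale mfd =
  fixes M :: "('a, 'e::euclidean_space) manifold"
  assumes smooth_manifold: "smooth_manifold M"
begin

section \<open>Charts and their topology\<close>

lemma chart_openin: "c \<in> atlas M \<Longrightarrow> openin (mtop M) (fst c)"
  and chart_image_open: "c \<in> atlas M \<Longrightarrow> open (snd c ` fst c)"
  and chart_homeo: "c \<in> atlas M \<Longrightarrow>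
    homeomorphic_map (subtopology (mtop M) (fst c)) (top_of_set (snd c ` fst c)) (snd c)"
  and chart_transition: "c \<in> atlas M \<Longrightarrow> d \<in> atlas M \<Longrightarrow>
    smooth_on (snd c ` (fst c \<inter> fst d)) (snd d \<circ> chart_inv c)"
  and hausdorff: "Hausdorff_space (mtop M)"
  and chart_cover: "(\<Union>c\<in>atlas M. fst c) = topspace (mtop M)"
  using smooth_manifold unfolding smooth_manifold_def by blast+

lemma topspace_chart: "c \<in> atlas M \<Longrightarrow> topspace (subtopology (mtop M) (fst c)) = fst c"
  using openin_subset[OF chart_openin] by (simp add: Int_absorb1)

lemma chart_inj: "c \<in> atlas M \<Longrightarrow> inj_on (snd c) (fst c)"
  using homeomorphic_imp_injective_map[OF chart_homeo] topspace_chart by metis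

lemma chart_inv_chart [simp]: "c \<in> atlas M \<Longrightarrow> p \<in> fst c \<Longrightarrow> chart_inv c (snd c p) = p"
  by (simp add: chart_inv_def chart_inj inv_into_f_f)

lemma chart_inv_in: "x \<in> snd c ` U \<Longrightarrow> U \<subseteq> fst c \<Longrightarrow> c \<in> atlas M \<Longrightarrow> chart_inv c x \<in> U"
  by auto

lemma chart_open_image:
  assumes "c \<in> atlas M" "openin (mtop M) U"
  shows "open (snd c ` (U \<inter> fst c))"
proof -
  have "openin (subtopology (mtop M) (fst c)) (U \<inter> fst c)"
    using assms(2) by (simp add: openin_subtopology_Int)
  then have "openin (top_of_set (snd c ` fst c)) (snd c ` (U \<inter> fst c))"
    using homeomorphic_imp_open_map[OF chart_homeo[OF assms(1)]] by (simp add: open_map_def)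
  then show ?thesis using chart_image_open[OF assms(1)] by (simp add: openin_open_eq)
qed

lemma chart_open_preimage:
  assumes "c \<in> atlas M" "open V"
  shows "openin (mtop M) {p \<in> fst c. snd c p \<in> V}"
proof -
  have "openin (top_of_set (snd c ` fst c)) (snd c ` fst c \<inter> V)"
    using assms(2) by (auto simp: openin_open)
  from openin_continuous_map_preimage[OF homeomorphic_imp_continuous_map[OF chart_homeo[OF assms(1)]] this]
  have "openin (subtopology (mtop M) (fst c)) {p \<in> fst c. snd c p \<in> V}"
    by (rule back_subst[where P="openin _"]) (use topspace_chart[OF assms(1)] in \<open>auto simp del: topspace_subtopology\<close>)
  then show ?thesis using openin_trans_full chart_openin[OF assms(1)] by blast
qed

lemma chart_at_atlas: "p \<in> topspace (mtop M) \<Longrightarrow> chart_at M p \<in> atlas M"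
  and chart_at_mem: "p \<in> topspace (mtop M) \<Longrightarrow> p \<in> fst (chart_at M p)"
proof -
  assume "p \<in> topspace (mtop M)"
  then have "\<exists>c. c \<in> atlas M \<and> p \<in> fst c" using chart_cover by blast
  then have "chart_at M p \<in> atlas M \<and> p \<in> fst (chart_at M p)" unfolding chart_at_def by (rule someI_ex)
  then show "chart_at M p \<in> atlas M" "p \<in> fst (chart_at M p)" by auto
qed

lemma chart_topspace: "c \<in> atlas M \<Longrightarrow> p \<in> fst c \<Longrightarrow> p \<in> topspace (mtop M)"
  using chart_cover by blast

section \<open>Smooth functions on open subsets\<close>

lemma smooth_fun_subset: "smooth_fun M U h \<Longrightarrow> V \<subseteq> U \<Longrightarrow> smooth_fun M V h"
  unfolding smooth_fun_def by (meson Int_mono image_mono order_refl smooth_on_subset)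

lemma smooth_fun_cong:
  assumes "openin (mtop M) U" "\<And>p. p \<in> U \<Longrightarrow> h p = k p" "smooth_fun M U h"
  shows "smooth_fun M U k"
  unfolding smooth_fun_def
proof
  fix c assume c: "c \<in> atlas M"
  show "smooth_on (snd c ` (U \<inter> fst c)) (k \<circ> chart_inv c)"
    by (rule smooth_on_cong[OF chart_open_image[OF c assms(1)], of "h \<circ> chart_inv c"])
      (use assms c in \<open>auto simp: smooth_fun_def\<close>)
qed

lemma smooth_fun_local:
  assumes "\<And>p. p \<in> U \<Longrightarrow> \<exists>V. openin (mtop M) V \<and> p \<in> V \<and> smooth_fun M V h"
  shows "smooth_fun M U h"
  unfolding smooth_fun_def
proof
  fix c assume c: "c \<in> atlas M"
  show "smooth_on (snd c ` (U \<inter> fst c)) (h \<circ> chart_inv c)"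
  proof (rule smooth_on_local)
    fix x assume "x \<in> snd c ` (U \<inter> fst c)"
    then obtain p where p: "p \<in> U" "p \<in> fst c" "x = snd c p" by blast
    then obtain V where V: "openin (mtop M) V" "p \<in> V" "smooth_fun M V h" using assms by blast
    then show "\<exists>T. open T \<and> x \<in> T \<and> smooth_on T (h \<circ> chart_inv c)"
      using chart_open_image[OF c V(1)] p c by (intro exI[of _ "snd c ` (V \<inter> fst c)"]) (auto simp: smooth_fun_def)
  qed
qed

lemma smooth_funD:
  "smooth_fun M U h \<Longrightarrow> c \<in> atlas M \<Longrightarrow> smooth_on (snd c ` (U \<inter> fst c)) (h \<circ> chart_inv c)"
  by (simp add: smooth_fun_def)

text \<open>In any other chart the function is its expression in \<open>c\<close> after a smooth
  transition map, so one chart containing \<open>U\<close> is enough.\<close>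

lemma smooth_fun_chartI:
  assumes c: "c \<in> atlas M" and U: "U \<subseteq> fst c" "openin (mtop M) U"
    and h: "smooth_on (snd c ` U) (h \<circ> chart_inv c)"
  shows "smooth_fun M U h"
  unfolding smooth_fun_def
proof
  fix d assume d: "d \<in> atlas M"
  have U': "U \<inter> fst c = U" using U(1) by blast
  have oU: "open (snd c ` U)" using chart_open_image[OF c U(2)] U' by simp
  have o: "open (snd d ` (U \<inter> fst d))" by (rule chart_open_image[OF d U(2)])
  have "smooth_on (snd d ` (U \<inter> fst d)) (snd c \<circ> chart_inv d)"
    by (rule smooth_on_subset[OF chart_transition[OF d c]]) (use U(1) in auto)
  moreover have "(snd c \<circ> chart_inv d) ` (snd d ` (U \<inter> fst d)) \<subseteq> snd c ` U" using d by auto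
  ultimately have "smooth_on (snd d ` (U \<inter> fst d)) (\<lambda>x. (h \<circ> chart_inv c) ((snd c \<circ> chart_inv d) x))"
    using smooth_on_compose[OF o oU _ _ h] by blast
  then show "smooth_on (snd d ` (U \<inter> fst d)) (h \<circ> chart_inv d)"
    by (rule smooth_on_cong[OF o, rotated]) (use U(1) c d in auto)
qed

lemma smooth_fun_chart: "c \<in> atlas M \<Longrightarrow> smooth_fun M (fst c) (snd c)"
  by (rule smooth_fun_chartI[OF _ order_refl chart_openin])
    (auto intro: smooth_on_cong[OF chart_image_open _ smooth_on_linear[OF bounded_linear_ident]])

lemma smooth_fun_compose:
  fixes h :: "'a \<Rightarrow> 'd::euclidean_space"
  assumes "openin (mtop M) U" "smooth_fun M U h" "open T" "h ` U \<subseteq> T" "smooth_on T k"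
  shows "smooth_fun M U (\<lambda>p. k (h p))"
  unfolding smooth_fun_def
proof
  fix c assume c: "c \<in> atlas M"
  have "smooth_on (snd c ` (U \<inter> fst c)) (\<lambda>x. k ((h \<circ> chart_inv c) x))"
    by (rule smooth_on_compose[OF chart_open_image[OF c assms(1)] assms(3) _ smooth_funD[OF assms(2) c] assms(5)])
      (use assms(4) c in auto)
  then show "smooth_on (snd c ` (U \<inter> fst c)) ((\<lambda>p. k (h p)) \<circ> chart_inv c)" by (simp add: o_def)
qed

lemma smooth_fun_const: "smooth_fun M U (\<lambda>p. k)"
  by (simp add: smooth_fun_def o_def smooth_on_const)

lemma smooth_fun_linear:
  "openin (mtop M) U \<Longrightarrow> bounded_linear L \<Longrightarrow> smooth_fun M U h \<Longrightarrow> smooth_fun M U (\<lambda>p. L (h p))"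
  unfolding smooth_fun_def o_def using chart_open_image smooth_on_linear_compose by blast

lemma smooth_fun_bilinear:
  "openin (mtop M) U \<Longrightarrow> bounded_bilinear B \<Longrightarrow> smooth_fun M U h \<Longrightarrow> smooth_fun M U k
    \<Longrightarrow> smooth_fun M U (\<lambda>p. B (h p) (k p))"
  unfolding smooth_fun_def o_def using chart_open_image smooth_on_bilinear by blast

lemma smooth_fun_add:
  "openin (mtop M) U \<Longrightarrow> smooth_fun M U h \<Longrightarrow> smooth_fun M U k \<Longrightarrow> smooth_fun M U (\<lambda>p. h p + k p)"
  unfolding smooth_fun_def o_def using chart_open_image smooth_on_add by blast

lemma smooth_fun_diff:
  "openin (mtop M) U \<Longrightarrow> smooth_fun M U h \<Longrightarrow> smooth_fun M U k \<Longrightarrow> smooth_fun M U (\<lambda>p. h p - k p)"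
  unfolding smooth_fun_def o_def using chart_open_image smooth_on_diff by blast

lemma smooth_fun_sum:
  "openin (mtop M) U \<Longrightarrow> (\<And>i. i \<in> I \<Longrightarrow> smooth_fun M U (h i)) \<Longrightarrow> smooth_fun M U (\<lambda>p. \<Sum>i\<in>I. h i p)"
  by (induction I rule: infinite_finite_induct) (auto simp: smooth_fun_const smooth_fun_add)

lemma smooth_fun_linear_family:
  fixes L :: "'a \<Rightarrow> 'd::euclidean_space \<Rightarrow> 'b::real_normed_vector"
  assumes "openin (mtop M) U" "\<And>p. p \<in> U \<Longrightarrow> linear (L p)" "\<And>v. smooth_fun M U (\<lambda>p. L p v)" "smooth_fun M U w"
  shows "smooth_fun M U (\<lambda>p. L p (w p))"
proof (rule smooth_fun_cong[OF assms(1)])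
  show "(\<Sum>b\<in>Basis. (w p \<bullet> b) *\<^sub>R L p b) = L p (w p)" if "p \<in> U" for p
    by (rule linear_expand[OF assms(2)[OF that], symmetric])
  show "smooth_fun M U (\<lambda>p. \<Sum>b\<in>Basis. (w p \<bullet> b) *\<^sub>R L p b)"
    by (intro smooth_fun_sum smooth_fun_bilinear[OF _ bounded_bilinear_scaleR] assms
        smooth_fun_linear[OF _ bounded_linear_inner_left])
qed

section \<open>Coordinate changes and components of tangent vectors\<close>

lemma transition_differentiable:
  assumes "c \<in> atlas M" "d \<in> atlas M" "p \<in> fst c" "p \<in> fst d"
  shows "(snd d \<circ> chart_inv c) differentiable (at (snd c p))"
  using smooth_on_differentiable[OF chart_transition[OF assms(1,2)]] assms by blast

lemma linear_coord_change:
  "c \<in> atlas M \<Longrightarrow> d \<in> atlas M \<Longrightarrow> p \<in> fst c \<Longrightarrow> p \<in> fst d \<Longrightarrow> linear (coord_change c d p)"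
  using linear_dd[OF transition_differentiable] unfolding coord_change_def by (simp add: fun_eq_iff[symmetric])

text \<open>The chain rule behind the whole tangent calculus: the cocycle rule for
  \<open>coord_change\<close> is the case where \<open>h\<close> is a chart map, and the chart
  independence of \<open>dir_deriv\<close> is another instance.\<close>

lemma dd_chart_change:
  assumes c: "c \<in> atlas M" "p \<in> fst c" and d: "d \<in> atlas M" "p \<in> fst d"
    and h: "(h \<circ> chart_inv d) differentiable (at (snd d p))"
  shows "dd (h \<circ> chart_inv c) (snd c p) v = dd (h \<circ> chart_inv d) (snd d p) (coord_change c d p v)"
proof -
  have o: "open (snd c ` (fst d \<inter> fst c))" by (rule chart_open_image[OF c(1) chart_openin[OF d(1)]])
  have "dd (h \<circ> chart_inv c) (snd c p) v = dd (\<lambda>x. (h \<circ> chart_inv d) ((snd d \<circ> chart_inv c) x)) (snd c p) v"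
    by (rule dd_cong[OF o, THEN fun_cong]) (use c d in auto)
  also have "\<dots> = dd (h \<circ> chart_inv d) ((snd d \<circ> chart_inv c) (snd c p)) (dd (snd d \<circ> chart_inv c) (snd c p) v)"
  proof (rule dd_compose[OF transition_differentiable[OF c(1) d(1) c(2) d(2)]])
    show "(h \<circ> chart_inv d) differentiable (at ((snd d \<circ> chart_inv c) (snd c p)))" using c h by simp
  qed
  finally show ?thesis using c by (simp add: coord_change_def)
qed

lemma coord_change_comp:
  assumes "c \<in> atlas M" "d \<in> atlas M" "e \<in> atlas M" "p \<in> fst c" "p \<in> fst d" "p \<in> fst e"
  shows "coord_change d e p (coord_change c d p v) = coord_change c e p v"
  using dd_chart_change[OF assms(1,4,2,5) transition_differentiable[OF assms(2,3,5,6)]]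
  by (simp add: coord_change_def)

lemma coord_change_id:
  assumes "c \<in> atlas M" "p \<in> fst c"
  shows "coord_change c c p v = v"
proof -
  have "dd (snd c \<circ> chart_inv c) (snd c p) v = dd (\<lambda>x. x) (snd c p) v"
    by (rule dd_cong[OF chart_image_open[OF assms(1)], THEN fun_cong]) (use assms in auto)
  then show ?thesis by (simp add: coord_change_def)
qed

lemma comps_coord_field:
  assumes "c \<in> atlas M" "d \<in> atlas M" "p \<in> fst c" "p \<in> fst d"
  shows "comps M d p (coord_field M c v p) = coord_change c d p v"
  using assms coord_change_comp chart_at_atlas chart_at_mem chart_topspace
  by (simp add: comps_def coord_field_def)

lemma comps_coord_field_same [simp]:
  "c \<in> atlas M \<Longrightarrow> p \<in> fst c \<Longrightarrow> comps M c p (coord_field M c v p) = v"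
  by (simp add: comps_coord_field coord_change_id)

lemma coord_field_comps:
  assumes "c \<in> atlas M" "p \<in> fst c"
  shows "coord_field M c (comps M c p v) p = v"
proof -
  have e: "chart_at M p \<in> atlas M" "p \<in> fst (chart_at M p)"
    using chart_at_atlas chart_at_mem chart_topspace[OF assms] by auto
  show ?thesis
    using coord_change_comp[OF e(1) assms(1) e(1) e(2) assms(2) e(2)] coord_change_id[OF e]
    by (simp add: comps_def coord_field_def)
qed

lemma comps_chart_at:
  "p \<in> topspace (mtop M) \<Longrightarrow> comps M (chart_at M p) p v = v"
  "p \<in> topspace (mtop M) \<Longrightarrow> coord_field M (chart_at M p) v p = v"
  by (simp_all add: comps_def coord_field_def coord_change_id chart_at_atlas chart_at_mem)

lemma linear_comps: "c \<in> atlas M \<Longrightarrow> p \<in> fst c \<Longrightarrow> linear (comps M c p)"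
  using linear_coord_change[of "chart_at M p" c p] chart_at_atlas chart_at_mem chart_topspace
  unfolding comps_def by (simp add: fun_eq_iff[symmetric])

lemma linear_coord_field: "c \<in> atlas M \<Longrightarrow> p \<in> fst c \<Longrightarrow> linear (\<lambda>v. coord_field M c v p)"
  using linear_coord_change[of c "chart_at M p" p] chart_at_atlas chart_at_mem chart_topspace
  unfolding coord_field_def by (simp add: fun_eq_iff[symmetric])

lemma coord_field_expand:
  assumes "c \<in> atlas M" "p \<in> fst c"
  shows "v = (\<Sum>b\<in>Basis. (comps M c p v \<bullet> b) *\<^sub>R coord_field M c b p)"
  using linear_expand[OF linear_coord_field[OF assms], of "comps M c p v"] coord_field_comps[OF assms] by simp

section \<open>Smooth vector fields\<close>

lemma smooth_vfD:
  assumes "smooth_vf M U X" "c \<in> atlas M" "openin (mtop M) U"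
  shows "smooth_fun M (U \<inter> fst c) (\<lambda>p. comps M c p (X p))"
  by (rule smooth_fun_chartI[OF assms(2)])
    (use assms in \<open>auto simp: smooth_vf_def intro: openin_Int chart_openin\<close>)

lemma smooth_vf_local:
  assumes "\<And>p. p \<in> U \<Longrightarrow> \<exists>V. openin (mtop M) V \<and> p \<in> V \<and> smooth_vf M V X"
  shows "smooth_vf M U X"
  unfolding smooth_vf_def
proof
  fix c assume c: "c \<in> atlas M"
  show "smooth_on (snd c ` (U \<inter> fst c)) ((\<lambda>p. comps M c p (X p)) \<circ> chart_inv c)"
  proof (rule smooth_on_local)
    fix x assume "x \<in> snd c ` (U \<inter> fst c)"
    then obtain p where p: "p \<in> U" "p \<in> fst c" "x = snd c p" by blast
    then obtain V where V: "openin (mtop M) V" "p \<in> V" "smooth_vf M V X" using assms by blast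
    then show "\<exists>T. open T \<and> x \<in> T \<and> smooth_on T ((\<lambda>p. comps M c p (X p)) \<circ> chart_inv c)"
      using chart_open_image[OF c V(1)] p c by (intro exI[of _ "snd c ` (V \<inter> fst c)"]) (auto simp: smooth_vf_def)
  qed
qed

lemma smooth_vf_subset: "smooth_vf M U X \<Longrightarrow> V \<subseteq> U \<Longrightarrow> smooth_vf M V X"
  unfolding smooth_vf_def by (meson Int_mono image_mono order_refl smooth_on_subset)

lemma smooth_vfI:
  assumes "openin (mtop M) U" "\<And>c. c \<in> atlas M \<Longrightarrow> smooth_fun M (U \<inter> fst c) (\<lambda>p. comps M c p (X p))"
  shows "smooth_vf M U X"
  unfolding smooth_vf_def
proof
  fix c assume c: "c \<in> atlas M"
  show "smooth_on (snd c ` (U \<inter> fst c)) ((\<lambda>p. comps M c p (X p)) \<circ> chart_inv c)"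
    using smooth_funD[OF assms(2)[OF c] c] by (simp add: Int_assoc)
qed

lemma smooth_vf_cong:
  assumes "openin (mtop M) U" "\<And>p. p \<in> U \<Longrightarrow> X p = Y p" "smooth_vf M U X"
  shows "smooth_vf M U Y"
proof (rule smooth_vfI[OF assms(1)])
  fix c assume c: "c \<in> atlas M"
  show "smooth_fun M (U \<inter> fst c) (\<lambda>p. comps M c p (Y p))"
    by (rule smooth_fun_cong[OF _ _ smooth_vfD[OF assms(3) c assms(1)]])
      (use assms c in \<open>auto intro: openin_Int chart_openin\<close>)
qed

lemma smooth_fun_coord_change:
  assumes c: "c \<in> atlas M" and d: "d \<in> atlas M"
  shows "smooth_fun M (fst c \<inter> fst d) (\<lambda>p. coord_change c d p v)"
proof (rule smooth_fun_chartI[OF c])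
  have o: "open (snd c ` (fst c \<inter> fst d))"
    using chart_open_image[OF c chart_openin[OF d]] by (simp add: Int_commute)
  show "smooth_on (snd c ` (fst c \<inter> fst d)) ((\<lambda>p. coord_change c d p v) \<circ> chart_inv c)"
    by (rule smooth_on_cong[OF o _ smooth_on_dd[OF chart_transition[OF c d]]])
      (use c in \<open>auto simp: coord_change_def\<close>)
qed (use c d in \<open>auto intro: openin_Int chart_openin\<close>)

lemma smooth_vf_coord_field: "c \<in> atlas M \<Longrightarrow> smooth_vf M (fst c) (coord_field M c v)"
  by (rule smooth_vfI[OF chart_openin])
    (auto intro: smooth_fun_cong[OF openin_Int[OF chart_openin chart_openin] _ smooth_fun_coord_change]
      simp: comps_coord_field)

lemma smooth_vf_scale:
  assumes U: "openin (mtop M) U" and h: "smooth_fun M U h" and X: "smooth_vf M U X"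
  shows "smooth_vf M U (\<lambda>p. h p *\<^sub>R X p)"
proof (rule smooth_vfI[OF U])
  fix c assume c: "c \<in> atlas M"
  have o: "openin (mtop M) (U \<inter> fst c)" using U c by (intro openin_Int chart_openin)
  have "smooth_fun M (U \<inter> fst c) (\<lambda>p. h p *\<^sub>R comps M c p (X p))"
    by (intro smooth_fun_bilinear[OF o bounded_bilinear_scaleR] smooth_vfD[OF X c U] smooth_fun_subset[OF h]) auto
  then show "smooth_fun M (U \<inter> fst c) (\<lambda>p. comps M c p (h p *\<^sub>R X p))"
    by (rule smooth_fun_cong[OF o, rotated]) (use linear_scale[OF linear_comps[OF c]] in auto)
qed

lemma smooth_vf_add:
  assumes U: "openin (mtop M) U" and X: "smooth_vf M U X" and Y: "smooth_vf M U Y"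
  shows "smooth_vf M U (\<lambda>p. X p + Y p)"
proof (rule smooth_vfI[OF U])
  fix c assume c: "c \<in> atlas M"
  have o: "openin (mtop M) (U \<inter> fst c)" using U c by (intro openin_Int chart_openin)
  have "smooth_fun M (U \<inter> fst c) (\<lambda>p. comps M c p (X p) + comps M c p (Y p))"
    by (intro smooth_fun_add[OF o] smooth_vfD[OF X c U] smooth_vfD[OF Y c U])
  then show "smooth_fun M (U \<inter> fst c) (\<lambda>p. comps M c p (X p + Y p))"
    by (rule smooth_fun_cong[OF o, rotated]) (use linear_add[OF linear_comps[OF c]] in auto)
qed

lemma smooth_vf_zero: "openin (mtop M) U \<Longrightarrow> smooth_vf M U (\<lambda>p. 0)"
  by (rule smooth_vfI)
    (auto intro!: smooth_fun_cong[OF openin_Int[OF _ chart_openin] _ smooth_fun_const[of _ 0]]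
      simp: linear_0[OF linear_comps])

lemma smooth_vf_sum:
  "openin (mtop M) U \<Longrightarrow> (\<And>i. i \<in> I \<Longrightarrow> smooth_vf M U (X i)) \<Longrightarrow> smooth_vf M U (\<lambda>p. \<Sum>i\<in>I. X i p)"
  by (induction I rule: infinite_finite_induct) (auto simp: smooth_vf_zero smooth_vf_add)

section \<open>Derivatives along tangent vectors\<close>

lemma smooth_fun_differentiable:
  assumes "openin (mtop M) U" "smooth_fun M U h" "p \<in> U" "c \<in> atlas M" "p \<in> fst c"
  shows "(h \<circ> chart_inv c) differentiable (at (snd c p))"
  using smooth_on_differentiable[OF smooth_funD[OF assms(2,4)]] assms by blast

lemma dir_deriv_chart:
  assumes "openin (mtop M) U" "smooth_fun M U h" "p \<in> U" "c \<in> atlas M" "p \<in> fst c"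
  shows "dir_deriv M h p v = dd (h \<circ> chart_inv c) (snd c p) (comps M c p v)"
proof -
  have "p \<in> topspace (mtop M)" using assms(1,3) openin_subset by blast
  from dd_chart_change[OF chart_at_atlas[OF this] chart_at_mem[OF this] assms(4,5) smooth_fun_differentiable[OF assms]]
  show ?thesis by (simp add: dir_deriv_def comps_def)
qed

lemma dir_deriv_coord_field:
  assumes "openin (mtop M) U" "smooth_fun M U h" "p \<in> U" "c \<in> atlas M" "p \<in> fst c"
  shows "dir_deriv M h p (coord_field M c v p) = dd (h \<circ> chart_inv c) (snd c p) v"
  using dir_deriv_chart[OF assms] assms by simp

lemma dir_deriv_cong:
  assumes "openin (mtop M) U" "p \<in> U" "\<And>q. q \<in> U \<Longrightarrow> h q = k q"
  shows "dir_deriv M h p v = dir_deriv M k p v"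
proof -
  have p: "p \<in> topspace (mtop M)" using assms(1,2) openin_subset by blast
  show ?thesis unfolding dir_deriv_def
    by (rule dd_cong[OF chart_open_image[OF chart_at_atlas[OF p] assms(1)], THEN fun_cong])
      (use assms p chart_at_mem chart_at_atlas in auto)
qed

context
  fixes U p
  assumes U: "openin (mtop M) U" and p: "p \<in> U"
begin

lemma p_topspace: "p \<in> topspace (mtop M)"
  using U p openin_subset by blast

lemma linear_dir_deriv:
  assumes "smooth_fun M U h"
  shows "linear (dir_deriv M h p)"
  using linear_dd[OF smooth_fun_differentiable[OF U assms p chart_at_atlas[OF p_topspace] chart_at_mem[OF p_topspace]]]
  unfolding dir_deriv_def[abs_def] .

lemma dir_deriv_add:
  "smooth_fun M U h \<Longrightarrow> smooth_fun M U k \<Longrightarrow> dir_deriv M (\<lambda>q. h q + k q) p v = dir_deriv M h p v + dir_deriv M k p v"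
  using dd_add[OF smooth_fun_differentiable[OF U _ p chart_at_atlas[OF p_topspace] chart_at_mem[OF p_topspace]] smooth_fun_differentiable[OF U _ p chart_at_atlas[OF p_topspace] chart_at_mem[OF p_topspace]]]
  by (simp add: dir_deriv_def o_def)

lemma dir_deriv_linear:
  "bounded_linear L \<Longrightarrow> smooth_fun M U h \<Longrightarrow> dir_deriv M (\<lambda>q. L (h q)) p v = L (dir_deriv M h p v)"
  using dd_linear[OF _ smooth_fun_differentiable[OF U _ p chart_at_atlas[OF p_topspace] chart_at_mem[OF p_topspace]]]
  by (simp add: dir_deriv_def o_def)

lemma dir_deriv_bilinear:
  assumes "bounded_bilinear B" "smooth_fun M U h" "smooth_fun M U k"
  shows "dir_deriv M (\<lambda>q. B (h q) (k q)) p v = B (h p) (dir_deriv M k p v) + B (dir_deriv M h p v) (k p)"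
proof -
  have pt: "p \<in> topspace (mtop M)" using U p openin_subset by blast
  note c = chart_at_atlas[OF pt] chart_at_mem[OF pt]
  show ?thesis
    using dd_bilinear[OF assms(1) smooth_fun_differentiable[OF U assms(2) p c] smooth_fun_differentiable[OF U assms(3) p c]] c
    by (simp add: dir_deriv_def o_def)
qed

lemma dir_deriv_sum:
  assumes "\<And>i. i \<in> I \<Longrightarrow> smooth_fun M U (h i)"
  shows "dir_deriv M (\<lambda>q. \<Sum>i\<in>I. h i q) p v = (\<Sum>i\<in>I. dir_deriv M (h i) p v)"
proof -
  have pt: "p \<in> topspace (mtop M)" using U p openin_subset by blast
  show ?thesis
    using dd_sum[of I "\<lambda>i. h i \<circ> chart_inv (chart_at M p)", OF smooth_fun_differentiable[OF U assms p chart_at_atlas[OF pt] chart_at_mem[OF pt]]]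
    by (simp add: dir_deriv_def o_def)
qed

lemma dir_deriv_const: "dir_deriv M (\<lambda>q. k) p v = 0"
  by (simp add: dir_deriv_def o_def)

lemma dir_deriv_compose:
  fixes h :: "'a \<Rightarrow> 'd::euclidean_space"
  assumes "smooth_fun M U h" "k differentiable (at (h p))"
  shows "dir_deriv M (\<lambda>q. k (h q)) p v = dd k (h p) (dir_deriv M h p v)"
proof -
  have pt: "p \<in> topspace (mtop M)" using U p openin_subset by blast
  note c = chart_at_atlas[OF pt] chart_at_mem[OF pt]
  show ?thesis
    using dd_compose[OF smooth_fun_differentiable[OF U assms(1) p c], of k] assms(2) c
    by (simp add: dir_deriv_def o_def)
qed

text \<open>The second-order chain rule. With chart components of a field \<open>Y\<close> for
  \<open>w\<close> and a chart map for \<open>h\<close>, it computes iterated derivatives along two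
  fields: one term from the moving base point, one from the moving vector.\<close>

lemma dir_deriv_dd:
  fixes h :: "'a \<Rightarrow> 'd::euclidean_space"
  assumes h: "smooth_fun M U h" "open T" "h ` U \<subseteq> T" and u: "smooth_on T u" and w: "smooth_fun M U w"
  shows "dir_deriv M (\<lambda>q. dd u (h q) (w q)) p v
       = dd (\<lambda>x. dd u x (w p)) (h p) (dir_deriv M h p v) + dd u (h p) (dir_deriv M w p v)"
proof -
  have hT: "h q \<in> T" if "q \<in> U" for q using h(3) that by blast
  have ud: "(\<lambda>x. dd u x a) differentiable (at (h p))" for a
    using smooth_on_differentiable[OF smooth_on_dd[OF u] hT[OF p]] .
  have su: "smooth_fun M U (\<lambda>q. dd u (h q) a)" for a
    by (rule smooth_fun_compose[OF U h smooth_on_dd[OF u]])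
  have wb: "smooth_fun M U (\<lambda>q. w q \<bullet> b)" for b by (rule smooth_fun_linear[OF U bounded_linear_inner_left w])
  have "dir_deriv M (\<lambda>q. dd u (h q) (w q)) p v
      = dir_deriv M (\<lambda>q. \<Sum>b\<in>Basis. (w q \<bullet> b) *\<^sub>R dd u (h q) b) p v"
    by (rule dir_deriv_cong[OF U p]) (rule linear_expand[OF smooth_on_linear_dd[OF u hT]])
  also have "\<dots> = (\<Sum>b\<in>Basis. dir_deriv M (\<lambda>q. (w q \<bullet> b) *\<^sub>R dd u (h q) b) p v)"
    by (rule dir_deriv_sum) (intro smooth_fun_bilinear[OF U bounded_bilinear_scaleR] su wb)
  also have "\<dots> = (\<Sum>b\<in>Basis. (w p \<bullet> b) *\<^sub>R dd (\<lambda>x. dd u x b) (h p) (dir_deriv M h p v)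
      + (dir_deriv M w p v \<bullet> b) *\<^sub>R dd u (h p) b)"
    by (simp add: dir_deriv_bilinear[OF bounded_bilinear_scaleR wb su] dir_deriv_compose[OF h(1) ud]
        dir_deriv_linear[OF bounded_linear_inner_left w])
  also have "\<dots> = dd (\<lambda>x. dd u x (w p)) (h p) (dir_deriv M h p v) + dd u (h p) (dir_deriv M w p v)"
    using linear_expand[OF linear_dd_parameter[OF h(2) hT[OF p] smooth_on_linear_dd[OF u] ud], of "w p" "dir_deriv M h p v"]
      linear_expand[OF smooth_on_linear_dd[OF u hT[OF p]], of "dir_deriv M w p v"]
    by (simp add: sum.distrib)
  finally show ?thesis .
qed

end

lemma smooth_fun_dir_deriv:
  assumes U: "openin (mtop M) U" and h: "smooth_fun M U h" and X: "smooth_vf M U X"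
  shows "smooth_fun M U (\<lambda>p. dir_deriv M h p (X p))"
proof (rule smooth_fun_local)
  fix p assume p: "p \<in> U"
  then have pt: "p \<in> topspace (mtop M)" using U openin_subset by blast
  define c where "c = chart_at M p"
  have c: "c \<in> atlas M" "p \<in> fst c" using chart_at_atlas[OF pt] chart_at_mem[OF pt] by (auto simp: c_def)
  let ?V = "U \<inter> fst c"
  have V: "openin (mtop M) ?V" using U c by (intro openin_Int chart_openin)
  have oV: "open (snd c ` ?V)" by (rule chart_open_image[OF c(1) U])
  have "smooth_fun M ?V (\<lambda>q. dd (h \<circ> chart_inv c) (snd c q) (comps M c q (X q)))"
  proof (rule smooth_fun_linear_family[OF V _ _ smooth_vfD[OF X c(1) U]])
    show "linear (dd (h \<circ> chart_inv c) (snd c q))" if "q \<in> ?V" for q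
      using smooth_on_linear_dd[OF smooth_funD[OF h c(1)]] that by blast
    show "smooth_fun M ?V (\<lambda>q. dd (h \<circ> chart_inv c) (snd c q) v)" for v
      by (rule smooth_fun_compose[OF V smooth_fun_subset[OF smooth_fun_chart[OF c(1)]] oV _
            smooth_on_dd[OF smooth_funD[OF h c(1)]]]) auto
  qed
  then have "smooth_fun M ?V (\<lambda>p. dir_deriv M h p (X p))"
    by (rule smooth_fun_cong[OF V, rotated]) (use dir_deriv_chart[OF U h _ c(1)] in auto)
  then show "\<exists>V. openin (mtop M) V \<and> p \<in> V \<and> smooth_fun M V (\<lambda>p. dir_deriv M h p (X p))"
    using V p c by blast
qed

lemma dir_deriv_chart_map: "c \<in> atlas M \<Longrightarrow> p \<in> fst c \<Longrightarrow> dir_deriv M (snd c) p v = comps M c p v"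
  by (simp add: dir_deriv_def comps_def coord_change_def)

text \<open>\<open>lie_bracket\<close> is computed in the distinguished chart, not in
  \<open>c\<close>. There the components of a coordinate field of \<open>c\<close> are first
  derivatives of the transition map, so the bracket is a difference of mixed second
  derivatives.\<close>

lemma lie_bracket_coord_field:
  assumes c: "c \<in> atlas M" "p \<in> fst c"
  shows "lie_bracket M (coord_field M c v) (coord_field M c w) p = 0"
proof -
  have pt: "p \<in> topspace (mtop M)" using chart_topspace[OF c] .
  define e where "e = chart_at M p"
  have e: "e \<in> atlas M" "p \<in> fst e" using chart_at_atlas[OF pt] chart_at_mem[OF pt] by (auto simp: e_def)
  let ?V = "fst c \<inter> fst e" and ?t = "snd e \<circ> chart_inv c"
  have V: "openin (mtop M) ?V" using c e by (intro openin_Int chart_openin)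
  have oV: "open (snd c ` ?V)" using chart_open_image[OF c(1) chart_openin[OF e(1)]] by (simp add: Int_commute)
  have x: "snd c p \<in> snd c ` ?V" using c e by blast
  have "dir_deriv M (\<lambda>q. comps M e q (coord_field M c w q)) p (coord_field M c v p) = dd (\<lambda>x. dd ?t x w) (snd c p) v" for v w
  proof -
    have "dir_deriv M (\<lambda>q. comps M e q (coord_field M c w q)) p (coord_field M c v p)
        = dir_deriv M (\<lambda>q. coord_change c e q w) p (coord_field M c v p)"
      by (rule dir_deriv_cong[OF V]) (use c e comps_coord_field in auto)
    also have "\<dots> = dd ((\<lambda>q. coord_change c e q w) \<circ> chart_inv c) (snd c p) v"
      by (rule dir_deriv_coord_field[OF V smooth_fun_coord_change]) (use c e in auto)
    also have "\<dots> = dd (\<lambda>x. dd ?t x w) (snd c p) v"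
      by (rule dd_cong[OF oV x, THEN fun_cong]) (use c in \<open>auto simp: coord_change_def\<close>)
    finally show ?thesis .
  qed
  then show ?thesis
    unfolding lie_bracket_def e_def[symmetric]
    using symmetric_second_derivative[OF oV chart_transition[OF c(1) e(1)] x, of w v] by simp
qed

end

section \<open>Affine connections and metrics\<close>

locale conn = mfd M for M :: "('a, 'e::euclidean_space) manifold" +
  fixes D :: "('a, 'e) connection"
  assumes affine_connection: "affine_connection M D"
begin

lemmas conn_axiom = affine_connection[unfolded affine_connection_def, THEN spec, THEN mp]

lemma conn_smooth: "openin (mtop M) U \<Longrightarrow> smooth_vf M U X \<Longrightarrow> smooth_vf M U Y \<Longrightarrow> smooth_vf M U (D X Y)"
  using conn_axiom[THEN conjunct1] by simp

lemma conn_cong: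
  "openin (mtop M) U \<Longrightarrow> smooth_vf M U X \<Longrightarrow> smooth_vf M U Y \<Longrightarrow> (\<And>q. q \<in> U \<Longrightarrow> X q = X' q)
    \<Longrightarrow> (\<And>q. q \<in> U \<Longrightarrow> Y q = Y' q) \<Longrightarrow> p \<in> U \<Longrightarrow> D X Y p = D X' Y' p"
  using conn_axiom[THEN conjunct2, THEN conjunct1] by simp

lemma conn_add1:
  "openin (mtop M) U \<Longrightarrow> smooth_vf M U X \<Longrightarrow> smooth_vf M U X' \<Longrightarrow> smooth_vf M U Y \<Longrightarrow> p \<in> U
    \<Longrightarrow> D (\<lambda>q. X q + X' q) Y p = D X Y p + D X' Y p"
  using conn_axiom[THEN conjunct2, THEN conjunct2, THEN conjunct1] by simp

lemma conn_add2:
  "openin (mtop M) U \<Longrightarrow> smooth_vf M U X \<Longrightarrow> smooth_vf M U Y \<Longrightarrow> smooth_vf M U Y' \<Longrightarrow> p \<in> U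
    \<Longrightarrow> D X (\<lambda>q. Y q + Y' q) p = D X Y p + D X Y' p"
  using conn_axiom[THEN conjunct2, THEN conjunct2, THEN conjunct2, THEN conjunct1] by simp

lemma conn_scale1:
  "openin (mtop M) U \<Longrightarrow> smooth_fun M U h \<Longrightarrow> smooth_vf M U X \<Longrightarrow> smooth_vf M U Y \<Longrightarrow> p \<in> U
    \<Longrightarrow> D (\<lambda>q. h q *\<^sub>R X q) Y p = h p *\<^sub>R D X Y p"
  using conn_axiom[THEN conjunct2, THEN conjunct2, THEN conjunct2, THEN conjunct2, THEN conjunct1] by simp

lemma conn_leibniz:
  "openin (mtop M) U \<Longrightarrow> smooth_fun M U h \<Longrightarrow> smooth_vf M U X \<Longrightarrow> smooth_vf M U Y \<Longrightarrow> p \<in> U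
    \<Longrightarrow> D X (\<lambda>q. h q *\<^sub>R Y q) p = dir_deriv M h p (X p) *\<^sub>R Y p + h p *\<^sub>R D X Y p"
  using conn_axiom[THEN conjunct2, THEN conjunct2, THEN conjunct2, THEN conjunct2, THEN conjunct2] by simp

lemma conn_zero1: "openin (mtop M) U \<Longrightarrow> smooth_vf M U Y \<Longrightarrow> p \<in> U \<Longrightarrow> D (\<lambda>q. 0) Y p = 0"
  using conn_scale1[OF _ smooth_fun_const[of U 0] smooth_vf_zero] by simp

lemma conn_zero2: "openin (mtop M) U \<Longrightarrow> smooth_vf M U X \<Longrightarrow> p \<in> U \<Longrightarrow> D X (\<lambda>q. 0) p = 0"
  using conn_leibniz[OF _ smooth_fun_const[of U 0] _ smooth_vf_zero] by (simp add: dir_deriv_const)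

lemma conn_expand1:
  assumes U: "openin (mtop M) U" and p: "p \<in> U" and Y: "smooth_vf M U Y"
    and "\<And>i. i \<in> I \<Longrightarrow> smooth_fun M U (h i)" "\<And>i. i \<in> I \<Longrightarrow> smooth_vf M U (X i)"
  shows "D (\<lambda>q. \<Sum>i\<in>I. h i q *\<^sub>R X i q) Y p = (\<Sum>i\<in>I. h i p *\<^sub>R D (X i) Y p)"
  using assms(4,5)
proof (induction I rule: infinite_finite_induct)
  case (insert i I)
  have "D (\<lambda>q. h i q *\<^sub>R X i q + (\<Sum>i\<in>I. h i q *\<^sub>R X i q)) Y p
      = D (\<lambda>q. h i q *\<^sub>R X i q) Y p + D (\<lambda>q. \<Sum>i\<in>I. h i q *\<^sub>R X i q) Y p"
    by (intro conn_add1[OF U] smooth_vf_scale[OF U] smooth_vf_sum[OF U] Y p insert.prems) auto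
  then show ?case using insert conn_scale1[OF U insert.prems(1) insert.prems(2) Y p, of i] by simp
qed (simp_all add: conn_zero1[OF U Y p])

lemma conn_expand2:
  assumes U: "openin (mtop M) U" and p: "p \<in> U" and X: "smooth_vf M U X"
    and "\<And>i. i \<in> I \<Longrightarrow> smooth_fun M U (h i)" "\<And>i. i \<in> I \<Longrightarrow> smooth_vf M U (Y i)"
  shows "D X (\<lambda>q. \<Sum>i\<in>I. h i q *\<^sub>R Y i q) p
       = (\<Sum>i\<in>I. dir_deriv M (h i) p (X p) *\<^sub>R Y i p + h i p *\<^sub>R D X (Y i) p)"
  using assms(4,5)
proof (induction I rule: infinite_finite_induct)
  case (insert i I)
  have "D X (\<lambda>q. h i q *\<^sub>R Y i q + (\<Sum>i\<in>I. h i q *\<^sub>R Y i q)) p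
      = D X (\<lambda>q. h i q *\<^sub>R Y i q) p + D X (\<lambda>q. \<Sum>i\<in>I. h i q *\<^sub>R Y i q) p"
    by (intro conn_add2[OF U] smooth_vf_scale[OF U] smooth_vf_sum[OF U] X p insert.prems) auto
  then show ?case using insert conn_leibniz[OF U insert.prems(1) X insert.prems(2) p, of i] by simp
qed (simp_all add: conn_zero2[OF U X p])

section \<open>Christoffel symbols\<close>

definition christoffel :: "('a, 'e) chart \<Rightarrow> 'e \<Rightarrow> 'e \<Rightarrow> 'e \<Rightarrow> 'e" where
  "christoffel c x v w =
     comps M c (chart_inv c x) (D (coord_field M c v) (coord_field M c w) (chart_inv c x))"

context
  fixes c
  assumes c: "c \<in> atlas M"
begin

lemma smooth_christoffel: "smooth_on (snd c ` fst c) (\<lambda>x. christoffel c x v w)"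
proof -
  have "smooth_vf M (fst c) (D (coord_field M c v) (coord_field M c w))"
    by (intro conn_smooth chart_openin[OF c] smooth_vf_coord_field[OF c])
  then show ?thesis using c unfolding smooth_vf_def christoffel_def o_def by force
qed

lemma bilinear_christoffel:
  assumes "x \<in> snd c ` fst c"
  shows "bilinear (christoffel c x)"
proof -
  obtain p where p: "p \<in> fst c" "x = snd c p" using assms by blast
  note o = chart_openin[OF c] and s = smooth_vf_coord_field[OF c]
  note l = linear_add[OF linear_comps[OF c p(1)]] linear_scale[OF linear_comps[OF c p(1)]]
  have add: "coord_field M c (v + v') q = coord_field M c v q + coord_field M c v' q"
    and sc: "coord_field M c (r *\<^sub>R v) q = r *\<^sub>R coord_field M c v q" if "q \<in> fst c" for v v' r q
    using linear_add[OF linear_coord_field[OF c that]] linear_scale[OF linear_coord_field[OF c that]] by auto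
  have "D (coord_field M c (v + v')) (coord_field M c w) p
      = D (coord_field M c v) (coord_field M c w) p + D (coord_field M c v') (coord_field M c w) p"
    and "D (coord_field M c w) (coord_field M c (v + v')) p
      = D (coord_field M c w) (coord_field M c v) p + D (coord_field M c w) (coord_field M c v') p" for v v' w
  proof -
    have "D (coord_field M c (v + v')) (coord_field M c w) p = D (\<lambda>q. coord_field M c v q + coord_field M c v' q) (coord_field M c w) p"
      by (rule conn_cong[OF o s s add refl p(1)])
    then show "D (coord_field M c (v + v')) (coord_field M c w) p
      = D (coord_field M c v) (coord_field M c w) p + D (coord_field M c v') (coord_field M c w) p"
      using conn_add1[OF o s s s p(1)] by simp
    have "D (coord_field M c w) (coord_field M c (v + v')) p = D (coord_field M c w) (\<lambda>q. coord_field M c v q + coord_field M c v' q) p"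
      by (rule conn_cong[OF o s s refl add p(1)])
    then show "D (coord_field M c w) (coord_field M c (v + v')) p
      = D (coord_field M c w) (coord_field M c v) p + D (coord_field M c w) (coord_field M c v') p"
      using conn_add2[OF o s s s p(1)] by simp
  qed
  moreover have "D (coord_field M c (r *\<^sub>R v)) (coord_field M c w) p = r *\<^sub>R D (coord_field M c v) (coord_field M c w) p"
    and "D (coord_field M c w) (coord_field M c (r *\<^sub>R v)) p = r *\<^sub>R D (coord_field M c w) (coord_field M c v) p" for r v w
  proof -
    have "D (coord_field M c (r *\<^sub>R v)) (coord_field M c w) p = D (\<lambda>q. r *\<^sub>R coord_field M c v q) (coord_field M c w) p"
      by (rule conn_cong[OF o s s sc refl p(1)])
    then show "D (coord_field M c (r *\<^sub>R v)) (coord_field M c w) p = r *\<^sub>R D (coord_field M c v) (coord_field M c w) p"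
      using conn_scale1[OF o smooth_fun_const s s p(1)] by simp
    have "D (coord_field M c w) (coord_field M c (r *\<^sub>R v)) p = D (coord_field M c w) (\<lambda>q. r *\<^sub>R coord_field M c v q) p"
      by (rule conn_cong[OF o s s refl sc p(1)])
    then show "D (coord_field M c w) (coord_field M c (r *\<^sub>R v)) p = r *\<^sub>R D (coord_field M c w) (coord_field M c v) p"
      using conn_leibniz[OF o smooth_fun_const s s p(1)] by (simp add: dir_deriv_const[OF o p(1)])
  qed
  ultimately show ?thesis
    using c p by (auto simp: bilinear_def christoffel_def l intro!: linearI)
qed

text \<open>Near \<open>p\<close> both fields are expanded in the coordinate frame of
  \<open>c\<close>; locality of the connection permits the replacement, function-linearity treats
  \<open>X\<close>, and the Leibniz rule treats \<open>Y\<close>.\<close>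

lemma conn_local_formula:
  assumes U: "openin (mtop M) U" and X: "smooth_vf M U X" and Y: "smooth_vf M U Y" and p: "p \<in> U" "p \<in> fst c"
  shows "comps M c p (D X Y p) = dir_deriv M (\<lambda>q. comps M c q (Y q)) p (X p)
       + christoffel c (snd c p) (comps M c p (X p)) (comps M c p (Y p))"
proof -
  let ?V = "U \<inter> fst c"
  let ?x = "\<lambda>b q. comps M c q (X q) \<bullet> b" and ?y = "\<lambda>b q. comps M c q (Y q) \<bullet> b" and ?F = "coord_field M c"
  have V: "openin (mtop M) ?V" "p \<in> ?V" using U c p by (auto intro: openin_Int chart_openin)
  have XV: "smooth_vf M ?V X" and YV: "smooth_vf M ?V Y" and F: "smooth_vf M ?V (?F b)" for b
    using smooth_vf_subset X Y smooth_vf_coord_field[OF c] by blast+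
  have Yc: "smooth_fun M ?V (\<lambda>q. comps M c q (Y q))" by (rule smooth_vfD[OF Y c U])
  have x: "smooth_fun M ?V (?x b)" and y: "smooth_fun M ?V (?y b)" for b
    by (rule smooth_fun_linear[OF V(1) bounded_linear_inner_left], rule smooth_vfD[OF X c U] Yc)+
  have Xe: "X q = (\<Sum>b\<in>Basis. ?x b q *\<^sub>R ?F b q)" and Ye: "Y q = (\<Sum>b\<in>Basis. ?y b q *\<^sub>R ?F b q)" if "q \<in> ?V" for q
    using coord_field_expand[OF c] that by blast+
  have DF: "D X (?F b) p = (\<Sum>a\<in>Basis. ?x a p *\<^sub>R D (?F a) (?F b) p)" for b
    using conn_cong[OF V(1) XV F Xe refl V(2)] conn_expand1[OF V F x F] by simp
  have DXY: "D X Y p = (\<Sum>b\<in>Basis. dir_deriv M (?y b) p (X p) *\<^sub>R ?F b p + ?y b p *\<^sub>R D X (?F b) p)"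
    using conn_cong[OF V(1) XV YV refl Ye V(2)] conn_expand2[OF V XV y F] by simp
  have "comps M c p (D X Y p) = (\<Sum>b\<in>Basis. (dir_deriv M (\<lambda>q. comps M c q (Y q)) p (X p) \<bullet> b) *\<^sub>R b
      + ?y b p *\<^sub>R (\<Sum>a\<in>Basis. ?x a p *\<^sub>R christoffel c (snd c p) a b))"
    unfolding DXY DF christoffel_def chart_inv_chart[OF c p(2)]
    by (simp add: linear_add[OF linear_comps[OF c p(2)]] linear_scale[OF linear_comps[OF c p(2)]]
        linear_sum[OF linear_comps[OF c p(2)]] dir_deriv_linear[OF V bounded_linear_inner_left Yc] c p)
  also have "\<dots> = dir_deriv M (\<lambda>q. comps M c q (Y q)) p (X p)
      + (\<Sum>b\<in>Basis. ?y b p *\<^sub>R christoffel c (snd c p) (comps M c p (X p)) b)"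
  proof -
    have "linear (\<lambda>v. christoffel c (snd c p) v b)" for b
      using bilinear_christoffel p by (auto simp: bilinear_def)
    from linear_expand[OF this, where v="comps M c p (X p)"] show ?thesis
      by (simp only: sum.distrib euclidean_representation)
  qed
  also have "(\<Sum>b\<in>Basis. ?y b p *\<^sub>R christoffel c (snd c p) (comps M c p (X p)) b)
      = christoffel c (snd c p) (comps M c p (X p)) (comps M c p (Y p))"
    using linear_expand[of "christoffel c (snd c p) (comps M c p (X p))" "comps M c p (Y p)"]
      bilinear_christoffel[of "snd c p"] p by (simp add: bilinear_def)
  finally show ?thesis .
qed

end

end

section \<open>Riemannian metrics and the raising of indices\<close>

locale riem = mfd M for M :: "('a, 'e::euclidean_space) manifold" +
  fixes g :: "('a, 'e) metric"
  assumes riemannian_metric: "riemannian_metric M g"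
begin

lemma metric_bilinear: "p \<in> topspace (mtop M) \<Longrightarrow> bilinear (g p)"
  and metric_sym: "p \<in> topspace (mtop M) \<Longrightarrow> g p v w = g p w v"
  and metric_pos: "p \<in> topspace (mtop M) \<Longrightarrow> v \<noteq> 0 \<Longrightarrow> 0 < g p v v"
  and metric_smooth: "openin (mtop M) U \<Longrightarrow> smooth_vf M U X \<Longrightarrow> smooth_vf M U Y
    \<Longrightarrow> smooth_fun M U (\<lambda>p. g p (X p) (Y p))"
  using riemannian_metric unfolding riemannian_metric_def by blast+

lemma metric_bilinear_on: "openin (mtop M) U \<Longrightarrow> p \<in> U \<Longrightarrow> bilinear (g p)"
  using metric_bilinear openin_subset by blast

lemma metric_nondegenerate:
  assumes "p \<in> topspace (mtop M)" "\<And>v. g p v w = g p v w'"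
  shows "w = w'"
proof (rule ccontr)
  assume "w \<noteq> w'"
  then have "0 < g p (w - w') (w - w')" using metric_pos[OF assms(1)] by simp
  also have "\<dots> = g p (w - w') w - g p (w - w') w'" by (rule bilinear_rsub[OF metric_bilinear[OF assms(1)]])
  finally show False using assms(2)[of "w - w'"] by simp
qed

text \<open>Turns identities that are known only for fields, such as duality, into equations between
  vectors. Test fields on small open sets suffice, since coordinate fields take every value at
  \<open>p\<close>.\<close>

lemma metric_eqI:
  assumes "openin (mtop M) U" "p \<in> U"
    and "\<And>V Y. openin (mtop M) V \<Longrightarrow> V \<subseteq> U \<Longrightarrow> p \<in> V \<Longrightarrow> smooth_vf M V Y \<Longrightarrow> g p (Y p) w = g p (Y p) w'"
  shows "w = w'"
proof (rule metric_nondegenerate)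
  show p: "p \<in> topspace (mtop M)" using assms(1,2) openin_subset by blast
  fix v
  let ?c = "chart_at M p"
  note c = chart_at_atlas[OF p] chart_at_mem[OF p]
  have "g p (coord_field M ?c v p) w = g p (coord_field M ?c v p) w'"
    by (rule assms(3)[of "U \<inter> fst ?c"])
      (use assms(1,2) c in \<open>auto intro: openin_Int chart_openin smooth_vf_subset[OF smooth_vf_coord_field]\<close>)
  then show "g p v w = g p v w'" by (simp add: comps_chart_at(2)[OF p])
qed

definition metric_coeff :: "('a, 'e) chart \<Rightarrow> 'e \<Rightarrow> 'e \<Rightarrow> 'e \<Rightarrow> real" where
  "metric_coeff c x v w = g (chart_inv c x) (coord_field M c v (chart_inv c x)) (coord_field M c w (chart_inv c x))"

lemma metric_coeff_comps:
  "c \<in> atlas M \<Longrightarrow> p \<in> fst c \<Longrightarrow> metric_coeff c (snd c p) (comps M c p v) (comps M c p w) = g p v w"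
  by (simp add: metric_coeff_def coord_field_comps)

lemma smooth_metric_coeff:
  assumes "c \<in> atlas M"
  shows "smooth_on (snd c ` fst c) (\<lambda>x. metric_coeff c x v w)"
  using smooth_funD[OF metric_smooth[OF chart_openin smooth_vf_coord_field smooth_vf_coord_field] assms, of c v w] assms
  by (simp add: metric_coeff_def o_def)

lemma bilinear_metric_coeff:
  assumes "c \<in> atlas M" "x \<in> snd c ` fst c"
  shows "bilinear (metric_coeff c x)"
proof -
  obtain p where p: "p \<in> fst c" "x = snd c p" using assms by blast
  have "metric_coeff c x = (\<lambda>v w. g p (coord_field M c v p) (coord_field M c w p))"
    using p assms(1) by (simp add: metric_coeff_def fun_eq_iff)
  moreover have "linear (\<lambda>w. g p u (coord_field M c w p))" "linear (\<lambda>v. g p (coord_field M c v p) u)" for u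
    using metric_bilinear[OF chart_topspace[OF assms(1) p(1)]] linear_coord_field[OF assms(1) p(1)]
    by (auto simp: bilinear_def intro: linear_compose[unfolded o_def])
  ultimately show ?thesis by (simp add: bilinear_def)
qed

text \<open>The musical isomorphism at \<open>p\<close>, applied to a functional given by its values
  on \<open>Basis\<close>. Existence is proved below from the injectivity of lowering an
  index.\<close>

definition metric_sharp :: "'a \<Rightarrow> ('e \<Rightarrow> real) \<Rightarrow> 'e" where
  "metric_sharp p f = (SOME w. \<forall>b\<in>Basis. g p b w = f b)"

lemma linear_lower: "p \<in> topspace (mtop M) \<Longrightarrow> linear (\<lambda>w. riesz (\<lambda>b. g p (T b) w))"
  using metric_bilinear
  by (auto intro!: linearI simp: bilinear_radd bilinear_rmul simp flip: riesz_add riesz_scale)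

lemma riesz_Basis: "b \<in> Basis \<Longrightarrow> riesz f \<bullet> b = f b"
  by (simp add: riesz_def inner_sum_left inner_Basis if_distrib cong: if_cong)

text \<open>A vector orthogonal to a spanning family is orthogonal to itself. \<open>T\<close> is
  left general because it is used both with the standard basis and with the coordinate frame of a
  chart.\<close>

lemma inj_lower:
  assumes p: "p \<in> topspace (mtop M)" and T: "\<And>v. \<exists>a. v = (\<Sum>b\<in>Basis. a b *\<^sub>R T b)"
  shows "inj (\<lambda>w. riesz (\<lambda>b. g p (T b) w))"
  unfolding linear_injective_0[OF linear_lower[OF p]]
proof (intro allI impI)
  fix w assume 0: "riesz (\<lambda>b. g p (T b) w) = 0"
  have Tb: "g p (T b) w = 0" if "b \<in> Basis" for b using riesz_Basis[OF that, of "\<lambda>b. g p (T b) w"] 0 by simp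
  obtain a where "w = (\<Sum>b\<in>Basis. a b *\<^sub>R T b)" using T by blast
  then have "g p w w = g p (\<Sum>b\<in>Basis. a b *\<^sub>R T b) w" by simp
  also have "\<dots> = (\<Sum>b\<in>Basis. a b * g p (T b) w)"
  proof -
    have l: "linear (\<lambda>v. g p v w)" using metric_bilinear[OF p] by (simp add: bilinear_def)
    show ?thesis by (simp add: linear_sum[OF l] linear_scale[OF l])
  qed
  finally have "g p w w = 0" using Tb by simp
  then show "w = 0" using metric_pos[OF p, of w] by (metis less_irrefl)
qed

lemma metric_sharp:
  assumes p: "p \<in> topspace (mtop M)" and b: "b \<in> Basis"
  shows "g p b (metric_sharp p f) = f b"
proof -
  have "v = (\<Sum>b\<in>Basis. (v \<bullet> b) *\<^sub>R b)" for v :: 'e by (simp add: euclidean_representation)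
  then have "inj (\<lambda>w. riesz (\<lambda>b. g p b w))" by (intro inj_lower[OF p]) blast
  then have "surj (\<lambda>w. riesz (\<lambda>b. g p b w))"
    using linear_injective_imp_surjective[OF linear_lower[OF p, of "\<lambda>b. b"]] by blast
  then obtain w where w: "riesz f = riesz (\<lambda>b. g p b w)" by (metis surjD)
  have "\<forall>b\<in>Basis. g p b w = f b" using riesz_Basis w by metis
  then have "\<forall>b\<in>Basis. g p b (metric_sharp p f) = f b" unfolding metric_sharp_def by (rule someI)
  then show ?thesis using b by blast
qed

end

section \<open>Existence of the dual connection\<close>

locale riem_conn = riem M g + conn M D
  for M :: "('a, 'e::euclidean_space) manifold" and g D
begin

text \<open>The duality equation solved for its unknown term, tested only on the coordinate fields
  of the chart at \<open>p\<close>, whose values at \<open>p\<close> are the basis vectors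
  themselves.\<close>

definition dual_conn :: "('a, 'e) connection" where
  "dual_conn X Z p = metric_sharp p (\<lambda>b.
     dir_deriv M (\<lambda>q. g q (coord_field M (chart_at M p) b q) (Z q)) p (X p)
     - g p (D X (coord_field M (chart_at M p) b) p) (Z p))"

text \<open>The right-hand side is linear over functions in \<open>Y\<close>: both terms produce the
  same derivatives of the components of \<open>Y\<close>, and these cancel. Hence the identity
  extends from coordinate fields, where it holds by construction, to all fields.\<close>

lemma dual_conn:
  assumes U: "openin (mtop M) U" and X: "smooth_vf M U X" and Y: "smooth_vf M U Y" and Z: "smooth_vf M U Z"
    and p: "p \<in> U"
  shows "g p (Y p) (dual_conn X Z p) = dir_deriv M (\<lambda>q. g q (Y q) (Z q)) p (X p) - g p (D X Y p) (Z p)"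
proof -
  have pt: "p \<in> topspace (mtop M)" using U p openin_subset by blast
  define c where "c = chart_at M p"
  have c: "c \<in> atlas M" "p \<in> fst c" using chart_at_atlas[OF pt] chart_at_mem[OF pt] by (auto simp: c_def)
  let ?V = "U \<inter> fst c" and ?y = "\<lambda>b q. comps M c q (Y q) \<bullet> b" and ?F = "coord_field M c"
  have V: "openin (mtop M) ?V" "p \<in> ?V" using U c p by (auto intro: openin_Int chart_openin)
  have XV: "smooth_vf M ?V X" and YV: "smooth_vf M ?V Y" and ZV: "smooth_vf M ?V Z" and F: "smooth_vf M ?V (?F b)" for b
    using smooth_vf_subset X Y Z smooth_vf_coord_field[OF c(1)] by blast+
  have y: "smooth_fun M ?V (?y b)" for b
    by (rule smooth_fun_linear[OF V(1) bounded_linear_inner_left], rule smooth_vfD[OF Y c(1) U])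
  have Ye: "Y q = (\<Sum>b\<in>Basis. ?y b q *\<^sub>R ?F b q)" if "q \<in> ?V" for q
    using coord_field_expand[OF c(1)] that by blast
  have gY: "g q (Y q) u = (\<Sum>b\<in>Basis. ?y b q * g q (?F b q) u)" if "q \<in> ?V" for q u
  proof -
    have "q \<in> topspace (mtop M)" using that U openin_subset by blast
    then have "linear (\<lambda>v. g q v u)" using metric_bilinear by (simp add: bilinear_def)
    from linear_sum[OF this, of "\<lambda>b. ?y b q *\<^sub>R ?F b q" Basis] show ?thesis
      using Ye[OF that] linear_scale[OF \<open>linear (\<lambda>v. g q v u)\<close>] by simp
  qed
  note gF = metric_smooth[OF V(1) F ZV]
  have bil: "bilinear (g p)" by (rule metric_bilinear[OF pt])
  have "dir_deriv M (\<lambda>q. g q (Y q) (Z q)) p (X p)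
      = dir_deriv M (\<lambda>q. \<Sum>b\<in>Basis. ?y b q * g q (?F b q) (Z q)) p (X p)"
    by (rule dir_deriv_cong[OF V]) (rule gY)
  also have "\<dots> = (\<Sum>b\<in>Basis. ?y b p * dir_deriv M (\<lambda>q. g q (?F b q) (Z q)) p (X p)
      + dir_deriv M (?y b) p (X p) * g p (?F b p) (Z p))"
    by (subst dir_deriv_sum[OF V])
      (simp_all add: smooth_fun_bilinear[OF V(1) bounded_bilinear_mult y gF] dir_deriv_bilinear[OF V bounded_bilinear_mult y gF])
  finally have 1: "dir_deriv M (\<lambda>q. g q (Y q) (Z q)) p (X p) = \<dots>" .
  have "D X Y p = (\<Sum>b\<in>Basis. dir_deriv M (?y b) p (X p) *\<^sub>R ?F b p + ?y b p *\<^sub>R D X (?F b) p)"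
    using conn_cong[OF V(1) XV YV refl Ye V(2)] conn_expand2[OF V XV y F] by simp
  then have 2: "g p (D X Y p) (Z p) = (\<Sum>b\<in>Basis. dir_deriv M (?y b) p (X p) * g p (?F b p) (Z p)
      + ?y b p * g p (D X (?F b) p) (Z p))"
  proof -
    have l: "linear (\<lambda>v. g p v (Z p))" using bil by (simp add: bilinear_def)
    show ?thesis if "D X Y p = (\<Sum>b\<in>Basis. dir_deriv M (?y b) p (X p) *\<^sub>R ?F b p + ?y b p *\<^sub>R D X (?F b) p)"
      unfolding that by (simp add: linear_sum[OF l] linear_add[OF l] linear_scale[OF l])
  qed
  have Fp: "?F b p = b" for b using comps_chart_at(2)[OF pt] by (simp add: c_def)
  have "g p (Y p) (dual_conn X Z p) = (\<Sum>b\<in>Basis. ?y b p * g p b (dual_conn X Z p))"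
    using gY[OF V(2)] by (simp add: Fp)
  also have "\<dots> = (\<Sum>b\<in>Basis. ?y b p * (dir_deriv M (\<lambda>q. g q (?F b q) (Z q)) p (X p) - g p (D X (?F b) p) (Z p)))"
    by (rule sum.cong[OF refl]) (simp add: dual_conn_def metric_sharp[OF pt] c_def)
  also have "\<dots> = dir_deriv M (\<lambda>q. g q (Y q) (Z q)) p (X p) - g p (D X Y p) (Z p)"
    unfolding 1 2 sum_subtractf[symmetric] by (rule sum.cong[OF refl]) (simp add: algebra_simps)
  finally show ?thesis .
qed

text \<open>The definition involves a choice and a chart that varies with the point. In a fixed
  chart, however, the components solve a linear system whose operator is the Gram matrix of the
  coordinate fields and whose right-hand side is smooth, so \<open>smooth_on_solution\<close>
  applies.\<close>

lemma smooth_dual_conn: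
  assumes U: "openin (mtop M) U" and X: "smooth_vf M U X" and Z: "smooth_vf M U Z"
  shows "smooth_vf M U (dual_conn X Z)"
proof (rule smooth_vfI[OF U])
  fix c assume c: "c \<in> atlas M"
  let ?V = "U \<inter> fst c" and ?F = "coord_field M c"
  have V: "openin (mtop M) ?V" using U c by (auto intro: openin_Int chart_openin)
  have oV: "open (snd c ` ?V)" by (rule chart_open_image[OF c U])
  have XV: "smooth_vf M ?V X" and ZV: "smooth_vf M ?V Z" and F: "smooth_vf M ?V (?F b)" for b
    using smooth_vf_subset X Z smooth_vf_coord_field[OF c] by blast+
  have in_V: "q \<in> fst c" "q \<in> topspace (mtop M)" if "q \<in> ?V" for q using that U openin_subset by blast+
  show "smooth_fun M ?V (\<lambda>q. comps M c q (dual_conn X Z q))"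
  proof (rule smooth_fun_chartI[OF c _ V])
    show "smooth_on (snd c ` ?V) ((\<lambda>q. comps M c q (dual_conn X Z q)) \<circ> chart_inv c)"
    proof (rule smooth_on_solution[OF oV, where A="\<lambda>x w. riesz (\<lambda>b. metric_coeff c x b w)"
          and b="\<lambda>x. riesz (\<lambda>b. (dir_deriv M (\<lambda>q. g q (?F b q) (Z q)) (chart_inv c x) (X (chart_inv c x))
              - g (chart_inv c x) (D X (?F b) (chart_inv c x)) (Z (chart_inv c x))))"])
      fix x assume "x \<in> snd c ` ?V"
      then obtain q where q: "q \<in> ?V" "x = snd c q" by blast
      have A: "riesz (\<lambda>b. metric_coeff c x b w) = riesz (\<lambda>b. g q (?F b q) (?F w q))" for w
        using q c by (simp add: metric_coeff_def)
      have lF: "linear (\<lambda>w. ?F w q)" by (rule linear_coord_field[OF c in_V(1)[OF q(1)]])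
      show "linear (\<lambda>w. riesz (\<lambda>b. metric_coeff c x b w))"
        unfolding A using linear_compose[OF lF linear_lower[OF in_V(2)[OF q(1)]]] by (simp add: o_def)
      have "inj (\<lambda>w. ?F w q)"
        by (rule inj_on_inverseI[where g="comps M c q"]) (use c in_V[OF q(1)] in simp)
      moreover have "inj (\<lambda>w. riesz (\<lambda>b. g q (?F b q) w))"
        by (rule inj_lower[OF in_V(2)[OF q(1)]]) (use coord_field_expand[OF c in_V(1)[OF q(1)]] in blast)
      ultimately show "inj (\<lambda>w. riesz (\<lambda>b. metric_coeff c x b w))"
        unfolding A using inj_compose[of "\<lambda>w. riesz (\<lambda>b. g q (?F b q) w)" "\<lambda>w. ?F w q"] by (simp add: o_def)
      show "riesz (\<lambda>b. metric_coeff c x b (((\<lambda>q. comps M c q (dual_conn X Z q)) \<circ> chart_inv c) x))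
        = riesz (\<lambda>b. (dir_deriv M (\<lambda>q. g q (?F b q) (Z q)) (chart_inv c x) (X (chart_inv c x))
              - g (chart_inv c x) (D X (?F b) (chart_inv c x)) (Z (chart_inv c x))))"
        unfolding A using q c in_V[OF q(1)] dual_conn[OF V XV F ZV q(1)] by (simp add: coord_field_comps)
    next
      show "smooth_on (snd c ` ?V) (\<lambda>x. riesz (\<lambda>b. metric_coeff c x b w))" for w
        by (intro smooth_on_riesz oV smooth_on_subset[OF smooth_metric_coeff[OF c]]) auto
      have "smooth_fun M ?V (\<lambda>q. dir_deriv M (\<lambda>q. g q (?F b q) (Z q)) q (X q) - g q (D X (?F b) q) (Z q))" for b
        by (intro smooth_fun_diff[OF V] smooth_fun_dir_deriv[OF V _ XV] metric_smooth[OF V] conn_smooth[OF V] XV F ZV)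
      from smooth_funD[OF this c]
      show "smooth_on (snd c ` ?V) (\<lambda>x. riesz (\<lambda>b. (dir_deriv M (\<lambda>q. g q (?F b q) (Z q)) (chart_inv c x) (X (chart_inv c x))
              - g (chart_inv c x) (D X (?F b) (chart_inv c x)) (Z (chart_inv c x)))))"
        by (intro smooth_on_riesz oV) (simp add: o_def Int_assoc)
    qed
  qed auto
qed

text \<open>Pairing with a test field reduces each axiom of an affine connection for
  \<open>dual_conn\<close> to an identity between real numbers.\<close>

lemma dual_conn_eqI:
  assumes U: "openin (mtop M) U" and X: "smooth_vf M U X" and Z: "smooth_vf M U Z" and p: "p \<in> U"
    and eq: "\<And>V Y. openin (mtop M) V \<Longrightarrow> V \<subseteq> U \<Longrightarrow> p \<in> V \<Longrightarrow> smooth_vf M V X \<Longrightarrow> smooth_vf M V Y \<Longrightarrow> smooth_vf M V Z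
      \<Longrightarrow> dir_deriv M (\<lambda>q. g q (Y q) (Z q)) p (X p) - g p (D X Y p) (Z p) = g p (Y p) w"
  shows "dual_conn X Z p = w"
proof (rule metric_eqI[OF U p])
  fix V Y assume V: "openin (mtop M) V" "V \<subseteq> U" "p \<in> V" and Y: "smooth_vf M V Y"
  have XV: "smooth_vf M V X" and ZV: "smooth_vf M V Z" using smooth_vf_subset X Z V(2) by blast+
  show "g p (Y p) (dual_conn X Z p) = g p (Y p) w"
    using eq[OF V XV Y ZV] dual_conn[OF V(1) XV Y ZV V(3)] by simp
qed

lemma affine_dual_conn: "affine_connection M dual_conn"
  unfolding affine_connection_def
proof (intro allI impI conjI ballI; (elim conjE)?)
  fix U X Y assume U: "openin (mtop M) U" and "smooth_vf M U X" "smooth_vf M U Y"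
  then show "smooth_vf M U (dual_conn X Y)" by (rule smooth_dual_conn)
next
  fix U X X' Y Y' p
  assume U: "openin (mtop M) U" and XY: "smooth_vf M U X" "smooth_vf M U Y" and eq: "\<forall>p\<in>U. X p = X' p" "\<forall>p\<in>U. Y p = Y' p" and p: "p \<in> U"
  have XY': "smooth_vf M U X'" "smooth_vf M U Y'" using smooth_vf_cong[OF U] XY eq by blast+
  show "dual_conn X Y p = dual_conn X' Y' p"
  proof (rule dual_conn_eqI[OF U XY p])
    fix V Z assume V: "openin (mtop M) V" "V \<subseteq> U" "p \<in> V" and s: "smooth_vf M V X" "smooth_vf M V Z" "smooth_vf M V Y"
    have eqV: "X q = X' q" "Y q = Y' q" if "q \<in> V" for q using eq V(2) that by auto
    have "D X Z p = D X' Z p" by (rule conn_cong[OF V(1) s(1,2) eqV(1) refl V(3)])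
    moreover have "dir_deriv M (\<lambda>q. g q (Z q) (Y q)) p (X p) = dir_deriv M (\<lambda>q. g q (Z q) (Y' q)) p (X p)"
      by (rule dir_deriv_cong[OF V(1,3)]) (simp add: eqV)
    ultimately show "dir_deriv M (\<lambda>q. g q (Z q) (Y q)) p (X p) - g p (D X Z p) (Y p) = g p (Z p) (dual_conn X' Y' p)"
      using dual_conn[OF V(1) smooth_vf_subset[OF XY'(1) V(2)] s(2) smooth_vf_subset[OF XY'(2) V(2)] V(3)] eqV[OF V(3)] by simp
  qed
next
  fix U X X' Y p
  assume U: "openin (mtop M) U" and X: "smooth_vf M U X" and X': "smooth_vf M U X'" and Y: "smooth_vf M U Y" and p: "p \<in> U"
  show "dual_conn (\<lambda>q. X q + X' q) Y p = dual_conn X Y p + dual_conn X' Y p"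
  proof (rule dual_conn_eqI[OF U smooth_vf_add[OF U X X'] Y p])
    fix V Z assume V: "openin (mtop M) V" "V \<subseteq> U" "p \<in> V" and Z: "smooth_vf M V Z"
    note s = smooth_vf_subset[OF X V(2)] smooth_vf_subset[OF X' V(2)] smooth_vf_subset[OF Y V(2)]
    show "dir_deriv M (\<lambda>q. g q (Z q) (Y q)) p (X p + X' p) - g p (D (\<lambda>q. X q + X' q) Z p) (Y p)
        = g p (Z p) (dual_conn X Y p + dual_conn X' Y p)"
      using conn_add1[OF V(1) s(1,2) Z V(3)] linear_add[OF linear_dir_deriv[OF V(1,3) metric_smooth[OF V(1) Z s(3)]]]
        dual_conn[OF V(1) s(1) Z s(3) V(3)] dual_conn[OF V(1) s(2) Z s(3) V(3)]
      by (simp add: bilinear_ladd[OF metric_bilinear_on[OF U p]] bilinear_radd[OF metric_bilinear_on[OF U p]])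
  qed
next
  fix U X Y Y' p
  assume U: "openin (mtop M) U" and X: "smooth_vf M U X" and Y: "smooth_vf M U Y" and Y': "smooth_vf M U Y'" and p: "p \<in> U"
  show "dual_conn X (\<lambda>q. Y q + Y' q) p = dual_conn X Y p + dual_conn X Y' p"
  proof (rule dual_conn_eqI[OF U X smooth_vf_add[OF U Y Y'] p])
    fix V Z assume V: "openin (mtop M) V" "V \<subseteq> U" "p \<in> V" and Z: "smooth_vf M V Z"
    note s = smooth_vf_subset[OF X V(2)] smooth_vf_subset[OF Y V(2)] smooth_vf_subset[OF Y' V(2)]
    have "dir_deriv M (\<lambda>q. g q (Z q) (Y q + Y' q)) p (X p) = dir_deriv M (\<lambda>q. g q (Z q) (Y q) + g q (Z q) (Y' q)) p (X p)"
      by (rule dir_deriv_cong[OF V(1,3)]) (use metric_bilinear_on[OF V(1)] bilinear_radd in blast)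
    then show "dir_deriv M (\<lambda>q. g q (Z q) (Y q + Y' q)) p (X p) - g p (D X Z p) (Y p + Y' p)
        = g p (Z p) (dual_conn X Y p + dual_conn X Y' p)"
      using dir_deriv_add[OF V(1,3) metric_smooth[OF V(1) Z s(2)] metric_smooth[OF V(1) Z s(3)]]
        dual_conn[OF V(1) s(1) Z s(2) V(3)] dual_conn[OF V(1) s(1) Z s(3) V(3)]
      by (simp add: bilinear_radd[OF metric_bilinear_on[OF U p]])
  qed
next
  fix U and h :: "'a \<Rightarrow> real" and X Y p
  assume U: "openin (mtop M) U" and h: "smooth_fun M U h" and X: "smooth_vf M U X" and Y: "smooth_vf M U Y" and p: "p \<in> U"
  show "dual_conn (\<lambda>q. h q *\<^sub>R X q) Y p = h p *\<^sub>R dual_conn X Y p"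
  proof (rule dual_conn_eqI[OF U smooth_vf_scale[OF U h X] Y p])
    fix V Z assume V: "openin (mtop M) V" "V \<subseteq> U" "p \<in> V" and Z: "smooth_vf M V Z"
    note s = smooth_vf_subset[OF X V(2)] smooth_vf_subset[OF Y V(2)] smooth_fun_subset[OF h V(2)]
    show "dir_deriv M (\<lambda>q. g q (Z q) (Y q)) p (h p *\<^sub>R X p) - g p (D (\<lambda>q. h q *\<^sub>R X q) Z p) (Y p)
        = g p (Z p) (h p *\<^sub>R dual_conn X Y p)"
      using conn_scale1[OF V(1) s(3,1) Z V(3)] linear_scale[OF linear_dir_deriv[OF V(1,3) metric_smooth[OF V(1) Z s(2)]]]
        dual_conn[OF V(1) s(1) Z s(2) V(3)]
      by (simp add: bilinear_lmul[OF metric_bilinear_on[OF U p]] bilinear_rmul[OF metric_bilinear_on[OF U p]] right_diff_distrib)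
  qed
next
  fix U and h :: "'a \<Rightarrow> real" and X Y p
  assume U: "openin (mtop M) U" and h: "smooth_fun M U h" and X: "smooth_vf M U X" and Y: "smooth_vf M U Y" and p: "p \<in> U"
  show "dual_conn X (\<lambda>q. h q *\<^sub>R Y q) p = dir_deriv M h p (X p) *\<^sub>R Y p + h p *\<^sub>R dual_conn X Y p"
  proof (rule dual_conn_eqI[OF U X smooth_vf_scale[OF U h Y] p])
    fix V Z assume V: "openin (mtop M) V" "V \<subseteq> U" "p \<in> V" and Z: "smooth_vf M V Z"
    note s = smooth_vf_subset[OF X V(2)] smooth_vf_subset[OF Y V(2)] smooth_fun_subset[OF h V(2)]
    have "dir_deriv M (\<lambda>q. g q (Z q) (h q *\<^sub>R Y q)) p (X p) = dir_deriv M (\<lambda>q. h q * g q (Z q) (Y q)) p (X p)"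
      by (rule dir_deriv_cong[OF V(1,3)]) (use bilinear_rmul[OF metric_bilinear_on[OF V(1)]] in simp)
    then show "dir_deriv M (\<lambda>q. g q (Z q) (h q *\<^sub>R Y q)) p (X p) - g p (D X Z p) (h p *\<^sub>R Y p)
        = g p (Z p) (dir_deriv M h p (X p) *\<^sub>R Y p + h p *\<^sub>R dual_conn X Y p)"
      using dir_deriv_bilinear[OF V(1,3) bounded_bilinear_mult s(3) metric_smooth[OF V(1) Z s(2)]]
        dual_conn[OF V(1) s(1) Z s(2) V(3)]
      by (simp add: bilinear_radd[OF metric_bilinear_on[OF U p]] bilinear_rmul[OF metric_bilinear_on[OF U p]] right_diff_distrib)
  qed
qed

text \<open>\<open>dual_conn\<close> serves as the witness that makes the choice in
  \<open>dual_connection\<close> meaningful; afterwards only the duality equation and the connection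
  axioms of the chosen operator are used.\<close>

lemma is_dual_connection: "is_dual_connection M g D (dual_connection M g D)"
proof -
  have "is_dual_connection M g D dual_conn"
    unfolding is_dual_connection_def using affine_dual_conn dual_conn by auto
  then show ?thesis unfolding dual_connection_def by (rule someI[of "is_dual_connection M g D"])
qed

end

section \<open>Statistical manifolds\<close>

text \<open>The condition \<open>a + b = 1\<close> enters in the Leibniz rule, where the derivative
  of the factor has to occur with total weight one.\<close>

lemma (in mfd) affine_connection_combination:
  assumes D1: "affine_connection M D1" and D2: "affine_connection M D2" and ab: "a + b = (1::real)"
  shows "affine_connection M (\<lambda>X Y p. a *\<^sub>R D1 X Y p + b *\<^sub>R D2 X Y p)"
proof -
  interpret c1: conn M D1 by unfold_locales (rule D1)
  interpret c2: conn M D2 by unfold_locales (rule D2)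
  have ab': "a *\<^sub>R v + b *\<^sub>R v = v" for v :: 'e using ab by (simp flip: scaleR_left_distrib)
  show ?thesis
    unfolding affine_connection_def
  proof (intro allI impI conjI ballI; (elim conjE)?)
    fix U X Y assume U: "openin (mtop M) U" and "smooth_vf M U X" "smooth_vf M U Y"
    then show "smooth_vf M U (\<lambda>p. a *\<^sub>R D1 X Y p + b *\<^sub>R D2 X Y p)"
      by (intro smooth_vf_add smooth_vf_scale smooth_fun_const c1.conn_smooth c2.conn_smooth)
  next
    fix U X X' Y Y' p
    assume "openin (mtop M) U" "smooth_vf M U X" "smooth_vf M U Y" "\<forall>p\<in>U. X p = X' p" "\<forall>p\<in>U. Y p = Y' p" "p \<in> U"
    then show "a *\<^sub>R D1 X Y p + b *\<^sub>R D2 X Y p = a *\<^sub>R D1 X' Y' p + b *\<^sub>R D2 X' Y' p"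
      using c1.conn_cong[of U X Y X' Y' p] c2.conn_cong[of U X Y X' Y' p] by simp
  next
    fix U X X' Y p
    assume "openin (mtop M) U" "smooth_vf M U X" "smooth_vf M U X'" "smooth_vf M U Y" "p \<in> U"
    then show "a *\<^sub>R D1 (\<lambda>q. X q + X' q) Y p + b *\<^sub>R D2 (\<lambda>q. X q + X' q) Y p
        = (a *\<^sub>R D1 X Y p + b *\<^sub>R D2 X Y p) + (a *\<^sub>R D1 X' Y p + b *\<^sub>R D2 X' Y p)"
      by (simp add: c1.conn_add1 c2.conn_add1 scaleR_add_right)
  next
    fix U X Y Y' p
    assume "openin (mtop M) U" "smooth_vf M U X" "smooth_vf M U Y" "smooth_vf M U Y'" "p \<in> U"
    then show "a *\<^sub>R D1 X (\<lambda>q. Y q + Y' q) p + b *\<^sub>R D2 X (\<lambda>q. Y q + Y' q) p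
        = (a *\<^sub>R D1 X Y p + b *\<^sub>R D2 X Y p) + (a *\<^sub>R D1 X Y' p + b *\<^sub>R D2 X Y' p)"
      by (simp add: c1.conn_add2 c2.conn_add2 scaleR_add_right)
  next
    fix U and h :: "'a \<Rightarrow> real" and X Y p
    assume "openin (mtop M) U" "smooth_fun M U h" "smooth_vf M U X" "smooth_vf M U Y" "p \<in> U"
    then show "a *\<^sub>R D1 (\<lambda>q. h q *\<^sub>R X q) Y p + b *\<^sub>R D2 (\<lambda>q. h q *\<^sub>R X q) Y p
        = h p *\<^sub>R (a *\<^sub>R D1 X Y p + b *\<^sub>R D2 X Y p)"
      by (simp add: c1.conn_scale1 c2.conn_scale1 scaleR_add_right mult.commute)
  next
    fix U and h :: "'a \<Rightarrow> real" and X Y p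
    assume "openin (mtop M) U" "smooth_fun M U h" "smooth_vf M U X" "smooth_vf M U Y" "p \<in> U"
    then show "a *\<^sub>R D1 X (\<lambda>q. h q *\<^sub>R Y q) p + b *\<^sub>R D2 X (\<lambda>q. h q *\<^sub>R Y q) p
        = dir_deriv M h p (X p) *\<^sub>R Y p + h p *\<^sub>R (a *\<^sub>R D1 X Y p + b *\<^sub>R D2 X Y p)"
      using ab'[of "dir_deriv M h p (X p) *\<^sub>R Y p"]
      by (simp add: c1.conn_leibniz c2.conn_leibniz scaleR_add_right mult.commute)
  qed
qed

locale stat =
  fixes M :: "('a, 'e::euclidean_space) manifold" and g :: "('a, 'e) metric" and D :: "('a, 'e) connection"
  assumes statistical: "statistical_manifold M g D"

sublocale stat \<subseteq> riem_conn M g D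
  using statistical by unfold_locales (simp_all add: statistical_manifold_def)

context stat
begin

lemma torsion:
  "openin (mtop M) U \<Longrightarrow> smooth_vf M U X \<Longrightarrow> smooth_vf M U Y \<Longrightarrow> p \<in> U
    \<Longrightarrow> D X Y p - D Y X p = lie_bracket M X Y p"
  using statistical by (simp add: statistical_manifold_def torsion_free_def)

lemma cov_deriv_sym:
  assumes "openin (mtop M) U" "smooth_vf M U X" "smooth_vf M U Y" "smooth_vf M U Z" "p \<in> U"
  shows "cov_deriv_metric M g D X Y Z p = cov_deriv_metric M g D Y X Z p"
    and "cov_deriv_metric M g D X Y Z p = cov_deriv_metric M g D X Z Y p"
  using statistical assms unfolding statistical_manifold_def by blast+

lemma affine_dual: "affine_connection M (dual_connection M g D)"
  using is_dual_connection by (simp add: is_dual_connection_def)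

lemma duality:
  assumes "openin (mtop M) U" "smooth_vf M U X" "smooth_vf M U Y" "smooth_vf M U Z" "p \<in> U"
  shows "dir_deriv M (\<lambda>q. g q (Y q) (Z q)) p (X p) = g p (D X Y p) (Z p) + g p (Y p) (dual_connection M g D X Z p)"
  using is_dual_connection assms unfolding is_dual_connection_def by blast

text \<open>By duality the derivative of the metric on \<open>X\<close>, \<open>Y\<close>,
  \<open>Z\<close> is \<open>Y\<close> paired with the dual minus the original derivative of
  \<open>Z\<close> along \<open>X\<close>. Its symmetry in \<open>X\<close> and \<open>Z\<close>
  therefore says that both connections have the same torsion.\<close>

lemma torsion_dual:
  assumes U: "openin (mtop M) U" and X: "smooth_vf M U X" and Z: "smooth_vf M U Z" and p: "p \<in> U"
  shows "dual_connection M g D X Z p - dual_connection M g D Z X p = lie_bracket M X Z p"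
proof (rule metric_eqI[OF U p])
  fix V Y assume V: "openin (mtop M) V" "V \<subseteq> U" "p \<in> V" and Y: "smooth_vf M V Y"
  have XV: "smooth_vf M V X" and ZV: "smooth_vf M V Z" using smooth_vf_subset X Z V(2) by blast+
  have "cov_deriv_metric M g D X Y Z p = cov_deriv_metric M g D Z Y X p"
    using cov_deriv_sym(1)[OF V(1) XV Y ZV V(3)] cov_deriv_sym(2)[OF V(1) Y XV ZV V(3)]
      cov_deriv_sym(1)[OF V(1) Y ZV XV V(3)] by simp
  then have "g p (Y p) (dual_connection M g D X Z p) - g p (Y p) (dual_connection M g D Z X p)
      = g p (Y p) (D X Z p) - g p (Y p) (D Z X p)"
    using duality[OF V(1) XV Y ZV V(3)] duality[OF V(1) ZV Y XV V(3)] by (simp add: cov_deriv_metric_def)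
  then show "g p (Y p) (dual_connection M g D X Z p - dual_connection M g D Z X p) = g p (Y p) (lie_bracket M X Z p)"
    unfolding torsion[OF V(1) XV ZV V(3), symmetric] by (simp add: bilinear_rsub[OF metric_bilinear_on[OF V(1,3)]])
qed

lemma statistical_alpha: "statistical_manifold M g (alpha_connection \<alpha> M g D)"
proof -
  let ?a = "(1 + \<alpha>) / 2" and ?b = "(1 - \<alpha>) / 2" and ?D' = "dual_connection M g D" and ?A = "alpha_connection \<alpha> M g D"
  have ab: "?a + ?b = 1" by (simp add: field_simps)
  have A: "?A = (\<lambda>X Y p. ?a *\<^sub>R D X Y p + ?b *\<^sub>R ?D' X Y p)" by (simp add: alpha_connection_def fun_eq_iff)
  have aff: "affine_connection M ?A"
    unfolding A by (rule affine_connection_combination[OF affine_connection affine_dual ab])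
  have tor: "torsion_free M ?A"
    unfolding torsion_free_def
  proof (intro allI impI ballI, elim conjE)
    fix U X Y p assume U: "openin (mtop M) U" "smooth_vf M U X" "smooth_vf M U Y" "p \<in> U"
    have "?A X Y p - ?A Y X p = ?a *\<^sub>R (D X Y p - D Y X p) + ?b *\<^sub>R (?D' X Y p - ?D' Y X p)"
      by (simp add: A scaleR_diff_right)
    also have "\<dots> = (?a + ?b) *\<^sub>R lie_bracket M X Y p"
      by (simp only: torsion[OF U] torsion_dual[OF U] scaleR_left_distrib)
    finally show "?A X Y p - ?A Y X p = lie_bracket M X Y p" using ab by simp
  qed
  \<comment> \<open>The dual connection has the opposite derivative of the metric, so the
    combination has the factor \<open>(1 + \<alpha>) / 2 - (1 - \<alpha>) / 2 = \<alpha>\<close>,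
    and total symmetry is inherited.\<close>
  have C: "cov_deriv_metric M g ?A X Y Z p = \<alpha> * cov_deriv_metric M g D X Y Z p"
    if U: "openin (mtop M) U" and X: "smooth_vf M U X" and Y: "smooth_vf M U Y" and Z: "smooth_vf M U Z" and p: "p \<in> U"
    for U X Y Z p
  proof -
    note bil = metric_bilinear_on[OF U p]
    have sym: "g p v w = g p w v" for v w using U p openin_subset metric_sym by blast
    have "dir_deriv M (\<lambda>q. g q (Z q) (Y q)) p (X p) = dir_deriv M (\<lambda>q. g q (Y q) (Z q)) p (X p)"
      by (rule dir_deriv_cong[OF U p]) (use U openin_subset metric_sym in blast)
    then have 1: "g p (?D' X Y p) (Z p) = dir_deriv M (\<lambda>q. g q (Y q) (Z q)) p (X p) - g p (Y p) (D X Z p)"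
      using duality[OF U X Z Y p] sym[of "?D' X Y p"] sym[of "Y p"] by simp
    have 2: "g p (Y p) (?D' X Z p) = dir_deriv M (\<lambda>q. g q (Y q) (Z q)) p (X p) - g p (D X Y p) (Z p)"
      using duality[OF U X Y Z p] by simp
    have "cov_deriv_metric M g ?A X Y Z p = dir_deriv M (\<lambda>q. g q (Y q) (Z q)) p (X p)
        - (?a * g p (D X Y p) (Z p) + ?b * g p (?D' X Y p) (Z p)) - (?a * g p (Y p) (D X Z p) + ?b * g p (Y p) (?D' X Z p))"
      unfolding cov_deriv_metric_def A
      by (simp add: bilinear_ladd[OF bil] bilinear_radd[OF bil] bilinear_lmul[OF bil] bilinear_rmul[OF bil])
    then show ?thesis unfolding 1 2 cov_deriv_metric_def by (simp add: field_simps)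
  qed
  have "statistical_manifold M g D" by (rule statistical)
  then show ?thesis
    unfolding statistical_manifold_def
    using aff tor C cov_deriv_sym by (auto simp: C)
qed

text \<open>All conditions are read off on coordinate fields, whose brackets vanish: the torsion
  gives the symmetry of the Christoffel symbols, the curvature gives \<open>flat\<close>, and the
  first symmetry of the derivative of the metric gives \<open>codazzi\<close>.\<close>

lemma flat_hessian_chart:
  assumes flat: "flat_connection M D" and c: "c \<in> atlas M"
  shows "flat_hessian (snd c ` fst c) (christoffel c) (metric_coeff c)"
proof
  let ?F = "coord_field M c"
  note o = chart_openin[OF c] and F = smooth_vf_coord_field[OF c]
  show "open (snd c ` fst c)" by (rule chart_image_open[OF c])
  show "smooth_on (snd c ` fst c) (\<lambda>x. christoffel c x v w)" for v w by (rule smooth_christoffel[OF c])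
  show "smooth_on (snd c ` fst c) (\<lambda>x. metric_coeff c x v w)" for v w by (rule smooth_metric_coeff[OF c])
  fix x assume x: "x \<in> snd c ` fst c"
  then obtain p where p: "p \<in> fst c" "x = snd c p" by blast
  have pt: "p \<in> topspace (mtop M)" by (rule chart_topspace[OF c p(1)])
  have inv: "chart_inv c x = p" using p c by simp
  show "bilinear (christoffel c x)" by (rule bilinear_christoffel[OF c x])
  show "bilinear (metric_coeff c x)" by (rule bilinear_metric_coeff[OF c x])
  show "metric_coeff c x v w = metric_coeff c x w v" for v w
    unfolding metric_coeff_def inv by (rule metric_sym[OF pt])
  have D_sym: "D (?F v) (?F w) p = D (?F w) (?F v) p" for v w
    using torsion[OF o F F p(1)] lie_bracket_coord_field[OF c p(1)] by simp
  then show "christoffel c x v w = christoffel c x w v" for v w by (simp add: christoffel_def inv)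
  fix v w z
  have DD: "comps M c p (D (?F v) (D (?F w) (?F z)) p) = dd (\<lambda>x. christoffel c x w z) x v + christoffel c x v (christoffel c x w z)"
    for v w z
  proof -
    have DF: "smooth_vf M (fst c) (D (?F w) (?F z))" by (rule conn_smooth[OF o F F])
    have s: "smooth_fun M (fst c) (\<lambda>q. comps M c q (D (?F w) (?F z) q))" using smooth_vfD[OF DF c o] by simp
    have "dir_deriv M (\<lambda>q. comps M c q (D (?F w) (?F z) q)) p (?F v p) = dd (\<lambda>x. christoffel c x w z) x v"
      using dir_deriv_coord_field[OF o s p(1) c p(1)] by (simp add: p(2) christoffel_def[abs_def] o_def)
    then show ?thesis
      using conn_local_formula[OF c o F DF p(1) p(1), of v] c p by (simp add: christoffel_def)
  qed
  \<comment> \<open>The bracket is known to vanish only on the domain of \<open>c\<close>, so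
    locality of \<open>D\<close> is needed to replace it by the zero field.\<close>
  have "D (lie_bracket M (?F v) (?F w)) (?F z) p = D (\<lambda>q. 0) (?F z) p"
    by (rule conn_cong[OF o smooth_vf_zero[OF o] F _ refl p(1), symmetric]) (simp add: lie_bracket_coord_field[OF c])
  then have "D (lie_bracket M (?F v) (?F w)) (?F z) p = 0" using conn_zero1[OF o F p(1)] by simp
  moreover have "curvature M D (?F v) (?F w) (?F z) p = 0"
    using flat o F p(1) unfolding flat_connection_def by blast
  ultimately have "D (?F v) (D (?F w) (?F z)) p = D (?F w) (D (?F v) (?F z)) p" by (simp add: curvature_def)
  then show "dd (\<lambda>x. christoffel c x w z) x v + christoffel c x v (christoffel c x w z)
      = dd (\<lambda>x. christoffel c x v z) x w + christoffel c x w (christoffel c x v z)"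
    using DD[of v w z] DD[of w v z] by simp
  have G: "dir_deriv M (\<lambda>q. g q (?F w q) (?F z q)) p (?F v p) = dd (\<lambda>x. metric_coeff c x w z) x v" for v w
    using dir_deriv_coord_field[OF o metric_smooth[OF o F F] p(1) c p(1)] by (simp add: p(2) metric_coeff_def[abs_def] o_def)
  have N: "g p (?F w p) (D (?F v) (?F z) p) = metric_coeff c x w (christoffel c x v z)" for v w
    using p c by (simp add: metric_coeff_def christoffel_def coord_field_comps)
  show "dd (\<lambda>x. metric_coeff c x w z) x v - metric_coeff c x w (christoffel c x v z)
      = dd (\<lambda>x. metric_coeff c x v z) x w - metric_coeff c x v (christoffel c x w z)"
    using cov_deriv_sym(1)[OF o F F F p(1), of v w z] D_sym[of v w] by (simp add: cov_deriv_metric_def G N)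
qed

end

section \<open>Extension of vector fields\<close>

lemma (in mfd) continuous_chart_inv:
  assumes c: "c \<in> atlas M"
  shows "continuous_map (top_of_set (snd c ` fst c)) (mtop M) (chart_inv c)"
proof -
  obtain h where h: "homeomorphic_maps (subtopology (mtop M) (fst c)) (top_of_set (snd c ` fst c)) (snd c) h"
    using chart_homeo[OF c] by (auto simp: homeomorphic_map_maps)
  have "continuous_map (top_of_set (snd c ` fst c)) (mtop M) h"
    using h by (simp add: homeomorphic_maps_def continuous_map_in_subtopology)
  moreover have "h x = chart_inv c x" if "x \<in> topspace (top_of_set (snd c ` fst c))" for x
  proof -
    obtain q where q: "q \<in> fst c" "x = snd c q" using \<open>x \<in> _\<close> by auto
    then have "h x = q" using h topspace_chart[OF c] by (simp add: homeomorphic_maps_def del: topspace_subtopology)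
    then show ?thesis using q c by simp
  qed
  ultimately show ?thesis by (rule continuous_map_eq)
qed

text \<open>A statistical embedding makes assertions only about fields smooth on all of
  \<open>U\<close>, whereas local identities concern fields on smaller sets. A field is cut off by a
  bump function in a chart, keeping its germ at \<open>p\<close>.\<close>

lemma (in mfd) smooth_vf_extend:
  assumes U: "openin (mtop M) U" and U': "openin (mtop M) U'" "U' \<subseteq> U" and X: "smooth_vf M U' X" and p: "p \<in> U'"
  obtains X' where "smooth_vf M U X'" "\<exists>V. openin (mtop M) V \<and> p \<in> V \<and> V \<subseteq> U' \<and> (\<forall>q\<in>V. X' q = X q)"
proof -
  have pt: "p \<in> topspace (mtop M)" using U'(1) p openin_subset by blast
  define c where "c = chart_at M p"
  have c: "c \<in> atlas M" "p \<in> fst c" using chart_at_atlas[OF pt] chart_at_mem[OF pt] by (auto simp: c_def)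
  let ?V = "U' \<inter> fst c"
  have V: "openin (mtop M) ?V" using U'(1) c by (intro openin_Int chart_openin)
  have oV: "open (snd c ` ?V)" by (rule chart_open_image[OF c(1) U'(1)])
  obtain \<epsilon> where \<epsilon>: "\<epsilon> > 0" "cball (snd c p) \<epsilon> \<subseteq> snd c ` ?V"
    using oV p c open_contains_cball by blast
  obtain \<rho> :: "'e \<Rightarrow> real" and \<delta> where \<rho>: "smooth_on UNIV \<rho>" "\<delta> > 0" "\<And>x. x \<in> ball (snd c p) \<delta> \<Longrightarrow> \<rho> x = 1"
    "\<And>x. x \<notin> cball (snd c p) \<epsilon> \<Longrightarrow> \<rho> x = 0"
    using bump_function[OF \<epsilon>(1), of "snd c p"] by blast
  \<comment> \<open>\<open>K\<close> contains the support of the cut-off field. Being compact it is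
    closed in the Hausdorff space, so \<open>U\<close> is covered by \<open>?V\<close> and the
    complement of \<open>K\<close>, and the field is smooth on both.\<close>
  define K where "K = chart_inv c ` cball (snd c p) \<epsilon>"
  note cinv = continuous_chart_inv[OF c(1)]
  have K: "closedin (mtop M) K"
  proof (rule compactin_imp_closedin[OF hausdorff])
    have "compactin (top_of_set (snd c ` fst c)) (cball (snd c p) \<epsilon>)"
      using \<epsilon>(2) by (auto simp: compactin_subtopology)
    then show "compactin (mtop M) K" unfolding K_def using cinv by (rule image_compactin)
  qed
  have KV: "K \<subseteq> ?V" using \<epsilon>(2) c(1) by (auto simp: K_def)
  define X' where "X' q = (if q \<in> ?V then \<rho> (snd c q) *\<^sub>R X q else 0)" for q
  have zero: "X' q = 0" if "q \<notin> K" for q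
  proof (cases "q \<in> ?V")
    case True
    then have "snd c q \<notin> cball (snd c p) \<epsilon>" using that c(1) by (force simp: K_def)
    then show ?thesis using \<rho>(4) by (simp add: X'_def)
  next
    case False
    then show ?thesis unfolding X'_def by (simp only: if_False)
  qed
  have s1: "smooth_vf M ?V X'"
  proof (rule smooth_vf_cong[OF V])
    show "\<rho> (snd c q) *\<^sub>R X q = X' q" if "q \<in> ?V" for q using that by (simp add: X'_def)
    show "smooth_vf M ?V (\<lambda>q. \<rho> (snd c q) *\<^sub>R X q)"
      by (intro smooth_vf_scale[OF V] smooth_fun_compose[OF V smooth_fun_subset[OF smooth_fun_chart[OF c(1)]] open_UNIV _ \<rho>(1)]
          smooth_vf_subset[OF X]) auto
  qed
  have oK: "openin (mtop M) (topspace (mtop M) - K)" using K by (simp add: openin_diff)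
  have s2: "smooth_vf M (topspace (mtop M) - K) X'"
    by (rule smooth_vf_cong[OF oK _ smooth_vf_zero[OF oK]]) (simp add: zero)
  have "smooth_vf M U X'"
  proof (rule smooth_vf_local)
    fix q assume "q \<in> U"
    then have "q \<in> topspace (mtop M)" using U openin_subset by blast
    then have "q \<in> ?V \<or> q \<in> topspace (mtop M) - K" using KV by blast
    then show "\<exists>V. openin (mtop M) V \<and> q \<in> V \<and> smooth_vf M V X'" using V oK s1 s2 by blast
  qed
  moreover have "\<exists>V. openin (mtop M) V \<and> p \<in> V \<and> V \<subseteq> U' \<and> (\<forall>q\<in>V. X' q = X q)"
  proof (intro exI conjI ballI)
    let ?W = "?V \<inter> {q \<in> fst c. snd c q \<in> ball (snd c p) \<delta>}"
    show "openin (mtop M) ?W" by (intro openin_Int[OF V] chart_open_preimage[OF c(1)] open_ball)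
    show "p \<in> ?W" "?W \<subseteq> U'" using p c \<rho>(2) by auto
    show "X' q = X q" if "q \<in> ?W" for q using that \<rho>(3) by (simp add: X'_def)
  qed
  ultimately show ?thesis using that by blast
qed

section \<open>Hessian structures on open subsets of Euclidean space\<close>

text \<open>With a single chart the distinguished chart is the same at every point of
  \<open>S\<close>, so tangent vectors and fields become plain vectors and vector-valued
  functions.\<close>

definition euclidean_mfd :: "'k::euclidean_space set \<Rightarrow> ('k, 'k) manifold" where
  "euclidean_mfd S = \<lparr>mtop = top_of_set S, atlas = {(S, id)}\<rparr>"

definition euclidean_conn :: "('k::euclidean_space, 'k) connection" where
  "euclidean_conn X Y p = dd Y p (X p)"

definition hessian :: "('k::euclidean_space \<Rightarrow> real) \<Rightarrow> ('k, 'k) metric" where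
  "hessian \<Phi> p v w = dd (\<lambda>z. dd \<Phi> z w) p v"

lemma bilinear_hessian:
  assumes "open S" "smooth_on S \<Phi>" "p \<in> S"
  shows "bilinear (hessian \<Phi> p)"
  unfolding bilinear_def hessian_def
  using smooth_on_linear_dd[OF smooth_on_dd[OF assms(2)] assms(3)]
    linear_dd_parameter[OF assms(1,3) smooth_on_linear_dd[OF assms(2)] smooth_on_differentiable[OF smooth_on_dd[OF assms(2)] assms(3)]]
  by auto

lemma second_countable_euclidean: "second_countable (euclidean :: 'k::euclidean_space topology)"
proof -
  obtain B :: "'k set set" where B: "countable B" "topological_basis B" using ex_countable_basis by blast
  have "\<exists>V\<in>B. x \<in> V \<and> V \<subseteq> U" if "open U" "x \<in> U" for U x
    using topological_basisE[OF B(2) that] by metis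
  then show ?thesis
    unfolding second_countable_def using B topological_basis_open[OF B(2)] by (intro exI[of _ B]) simp
qed

lemma smooth_manifold_euclidean:
  assumes S: "open S"
  shows "smooth_manifold (euclidean_mfd S)"
proof -
  have inv: "chart_inv (S, id) x = x" if "x \<in> S" for x :: 'a
    using that by (simp add: chart_inv_def inv_into_f_eq)
  have "smooth_on S (snd (S, id) \<circ> chart_inv (S, id))"
    by (rule smooth_on_cong[OF S _ smooth_on_linear[OF bounded_linear_ident]]) (simp add: inv)
  then show ?thesis
    using S by (auto simp: smooth_manifold_def euclidean_mfd_def Hausdorff_space_subtopology subtopology_subtopology second_countable_subtopology
        second_countable_euclidean)
qed

context
  fixes S :: "'k::euclidean_space set"
  assumes S: "open S"
begin

interpretation E: mfd "euclidean_mfd S" by unfold_locales (rule smooth_manifold_euclidean[OF S])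

section \<open>Manifold notions on an open subset of Euclidean space\<close>

lemma euclidean_openin: "openin (mtop (euclidean_mfd S)) U \<longleftrightarrow> open U \<and> U \<subseteq> S"
  using S by (simp add: euclidean_mfd_def openin_open_eq)

lemma euclidean_chart: "(S, id) \<in> atlas (euclidean_mfd S)"
  by (simp add: euclidean_mfd_def)

lemma euclidean_chart_inv: "x \<in> S \<Longrightarrow> chart_inv (S, id) x = x"
  using E.chart_inv_chart[OF euclidean_chart, of x] by simp

lemma euclidean_chart_at: "p \<in> S \<Longrightarrow> chart_at (euclidean_mfd S) p = (S, id)"
  unfolding chart_at_def euclidean_mfd_def by (rule some_equality) auto

lemma euclidean_comps: "p \<in> S \<Longrightarrow> comps (euclidean_mfd S) (S, id) p v = v"
  using E.comps_chart_at(1)[of p v] by (simp add: euclidean_chart_at) (simp add: euclidean_mfd_def)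

lemma euclidean_coord_field: "p \<in> S \<Longrightarrow> coord_field (euclidean_mfd S) (S, id) v p = v"
  using E.comps_chart_at(2)[of p v] by (simp add: euclidean_chart_at) (simp add: euclidean_mfd_def)

lemma euclidean_dir_deriv: "p \<in> S \<Longrightarrow> dir_deriv (euclidean_mfd S) h p v = dd h p v"
  unfolding dir_deriv_def euclidean_chart_at
  using dd_cong[OF S, of p "h \<circ> chart_inv (S, id)" h] by (simp add: euclidean_chart_inv)

lemma euclidean_smooth_fun:
  assumes "openin (mtop (euclidean_mfd S)) U"
  shows "smooth_fun (euclidean_mfd S) U h \<longleftrightarrow> smooth_on U h"
proof -
  have U: "open U" "U \<subseteq> S" using assms by (auto simp: euclidean_openin)
  have "smooth_fun (euclidean_mfd S) U h \<longleftrightarrow> smooth_on U (h \<circ> chart_inv (S, id))"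
    using U(2) by (simp add: smooth_fun_def euclidean_mfd_def Int_absorb2)
  also have "\<dots> \<longleftrightarrow> smooth_on U h"
  proof -
    have "(h \<circ> chart_inv (S, id)) y = h y" if "y \<in> U" for y using that U(2) euclidean_chart_inv by auto
    then show ?thesis
      using smooth_on_cong[OF U(1), of "h \<circ> chart_inv (S, id)" h] smooth_on_cong[OF U(1), of h "h \<circ> chart_inv (S, id)"] by metis
  qed
  finally show ?thesis .
qed

lemma euclidean_smooth_vf:
  assumes "openin (mtop (euclidean_mfd S)) U"
  shows "smooth_vf (euclidean_mfd S) U X \<longleftrightarrow> smooth_on U X"
proof -
  have U: "open U" "U \<subseteq> S" using assms by (auto simp: euclidean_openin)
  let ?f = "(\<lambda>p. comps (euclidean_mfd S) (S, id) p (X p)) \<circ> chart_inv (S, id)"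
  have eq: "?f x = X x" if "x \<in> U" for x using that U(2) by (auto simp: euclidean_chart_inv euclidean_comps)
  have "smooth_vf (euclidean_mfd S) U X \<longleftrightarrow> smooth_on U ?f"
    using U(2) by (simp add: smooth_vf_def euclidean_mfd_def Int_absorb2)
  also have "\<dots> \<longleftrightarrow> smooth_on U X"
    using smooth_on_cong[OF U(1), of ?f X] smooth_on_cong[OF U(1), of X ?f] eq by auto
  finally show ?thesis .
qed

lemma euclidean_lie_bracket:
  assumes "p \<in> S"
  shows "lie_bracket (euclidean_mfd S) X Y p = dd Y p (X p) - dd X p (Y p)"
proof -
  have "dd (\<lambda>q. comps (euclidean_mfd S) (S, id) q (Y q)) p = dd Y p" for Y
    by (rule dd_cong[OF S assms]) (rule euclidean_comps)
  then show ?thesis using assms by (simp add: lie_bracket_def euclidean_chart_at euclidean_dir_deriv)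
qed

lemma euclidean_affine_connection: "affine_connection (euclidean_mfd S) euclidean_conn"
  unfolding affine_connection_def
proof (intro allI impI conjI ballI; (elim conjE)?)
  fix U X Y assume U: "openin (mtop (euclidean_mfd S)) U" and "smooth_vf (euclidean_mfd S) U X" "smooth_vf (euclidean_mfd S) U Y"
  then have "smooth_on U X" "smooth_on U Y" "open U" by (auto simp: euclidean_smooth_vf euclidean_openin)
  then show "smooth_vf (euclidean_mfd S) U (euclidean_conn X Y)"
    unfolding euclidean_smooth_vf[OF U] euclidean_conn_def by (intro smooth_on_dd_family)
next
  fix U and X X' Y Y' :: "'k \<Rightarrow> 'k" and p
  assume U: "openin (mtop (euclidean_mfd S)) U" and eq: "\<forall>p\<in>U. X p = X' p" "\<forall>p\<in>U. Y p = Y' p" and p: "p \<in> U"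
  then show "euclidean_conn X Y p = euclidean_conn X' Y' p"
    using dd_cong[of U p Y Y'] by (simp add: euclidean_conn_def euclidean_openin)
next
  fix U and X X' Y :: "'k \<Rightarrow> 'k" and p
  assume U: "openin (mtop (euclidean_mfd S)) U" and Y: "smooth_vf (euclidean_mfd S) U Y" and p: "p \<in> U"
  then show "euclidean_conn (\<lambda>q. X q + X' q) Y p = euclidean_conn X Y p + euclidean_conn X' Y p"
    using smooth_on_linear_dd[of U Y p] by (simp add: euclidean_conn_def euclidean_smooth_vf[OF U] linear_add)
next
  fix U and X Y Y' :: "'k \<Rightarrow> 'k" and p
  assume U: "openin (mtop (euclidean_mfd S)) U" and "smooth_vf (euclidean_mfd S) U Y" "smooth_vf (euclidean_mfd S) U Y'" "p \<in> U"
  then show "euclidean_conn X (\<lambda>q. Y q + Y' q) p = euclidean_conn X Y p + euclidean_conn X Y' p"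
    using smooth_on_differentiable[of U Y p] smooth_on_differentiable[of U Y' p] by (simp add: euclidean_conn_def euclidean_smooth_vf[OF U] dd_add)
next
  fix U and h :: "'k \<Rightarrow> real" and X Y :: "'k \<Rightarrow> 'k" and p
  assume U: "openin (mtop (euclidean_mfd S)) U" and Y: "smooth_vf (euclidean_mfd S) U Y" and p: "p \<in> U"
  then show "euclidean_conn (\<lambda>q. h q *\<^sub>R X q) Y p = h p *\<^sub>R euclidean_conn X Y p"
    using smooth_on_linear_dd[of U Y p] by (simp add: euclidean_conn_def euclidean_smooth_vf[OF U] linear_scale)
next
  fix U and h :: "'k \<Rightarrow> real" and X Y :: "'k \<Rightarrow> 'k" and p
  assume U: "openin (mtop (euclidean_mfd S)) U" and h: "smooth_fun (euclidean_mfd S) U h"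
    and Y: "smooth_vf (euclidean_mfd S) U Y" and p: "p \<in> U"
  have pS: "p \<in> S" using U p by (auto simp: euclidean_openin)
  show "euclidean_conn X (\<lambda>q. h q *\<^sub>R Y q) p = dir_deriv (euclidean_mfd S) h p (X p) *\<^sub>R Y p + h p *\<^sub>R euclidean_conn X Y p"
    unfolding euclidean_conn_def euclidean_dir_deriv[OF pS]
    using dd_bilinear[OF bounded_bilinear_scaleR, of h p Y "X p"] smooth_on_differentiable[of U h p] smooth_on_differentiable[of U Y p]
      h Y p by (simp add: euclidean_smooth_fun[OF U] euclidean_smooth_vf[OF U])
qed

text \<open>The second derivatives of \<open>Z\<close> cancel by symmetry, and the terms with
  derivatives of \<open>X\<close> and \<open>Y\<close> are the derivative of \<open>Z\<close> along
  the bracket.\<close>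

lemma euclidean_flat: "flat_connection (euclidean_mfd S) euclidean_conn"
  unfolding flat_connection_def
proof (intro allI impI ballI, elim conjE)
  fix U and X Y Z :: "'k \<Rightarrow> 'k" and p
  assume U: "openin (mtop (euclidean_mfd S)) U" and "smooth_vf (euclidean_mfd S) U X" "smooth_vf (euclidean_mfd S) U Y"
    "smooth_vf (euclidean_mfd S) U Z" and p: "p \<in> U"
  then have s: "smooth_on U X" "smooth_on U Y" "smooth_on U Z" by (auto simp: euclidean_smooth_vf[OF U])
  have U': "open U" "p \<in> S" using U p by (auto simp: euclidean_openin)
  have D2: "dd (\<lambda>q. dd Z q (Y q)) p v = dd (\<lambda>q. dd Z q (Y p)) p v + dd Z p (dd Y p v)" if "smooth_on U Y" for Y v
    by (rule dd_linear_family(1)[OF U'(1) p smooth_on_linear_dd[OF s(3)] smooth_on_differentiable[OF smooth_on_dd[OF s(3)] p]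
          smooth_on_differentiable[OF that p]])
  show "curvature (euclidean_mfd S) euclidean_conn X Y Z p = 0"
    unfolding curvature_def euclidean_conn_def[abs_def] euclidean_lie_bracket[OF U'(2)] D2[OF s(1)] D2[OF s(2)]
      linear_diff[OF smooth_on_linear_dd[OF s(3) p]]
    using symmetric_second_derivative[OF U'(1) s(3) p] by simp
qed

text \<open>For the ordinary derivative, the derivative of a Hessian metric is the third derivative
  of the potential, which is totally symmetric.\<close>

theorem hessian_flat_statistical:
  assumes \<Phi>: "smooth_on S \<Phi>" and pos: "\<And>p v. p \<in> S \<Longrightarrow> v \<noteq> 0 \<Longrightarrow> hessian \<Phi> p v v > 0"
  shows "flat_statistical_manifold (euclidean_mfd S) (hessian \<Phi>) euclidean_conn"
proof -
  have sym: "hessian \<Phi> p v w = hessian \<Phi> p w v" if "p \<in> S" for p v w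
    unfolding hessian_def by (rule symmetric_second_derivative[OF S \<Phi> that])
  have bil: "bilinear (hessian \<Phi> p)" if "p \<in> S" for p by (rule bilinear_hessian[OF S \<Phi> that])
  then have lin: "linear (hessian \<Phi> p v)" "linear (\<lambda>v. hessian \<Phi> p v w)" if "p \<in> S" for p v w
    using that by (auto simp: bilinear_def)
  have sm: "smooth_on S (\<lambda>p. hessian \<Phi> p v w)" for v w
    unfolding hessian_def by (intro smooth_on_dd \<Phi>)
  have sm2: "smooth_on U (\<lambda>p. hessian \<Phi> p v (Y p))" and sm3: "smooth_on U (\<lambda>p. hessian \<Phi> p (X p) (Y p))"
    if "open U" "U \<subseteq> S" "smooth_on U X" "smooth_on U Y" for U v X Y
  proof -
    have linU: "linear (hessian \<Phi> p v)" "linear (\<lambda>v. hessian \<Phi> p v w)" if "p \<in> U" for p v w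
      using lin \<open>U \<subseteq> S\<close> that by blast+
    show s: "smooth_on U (\<lambda>p. hessian \<Phi> p v (Y p))" for v
      by (rule smooth_on_linear_family[OF that(1) linU(1) smooth_on_subset[OF sm that(2)] that(4)])
    show "smooth_on U (\<lambda>p. hessian \<Phi> p (X p) (Y p))"
      by (rule smooth_on_linear_family[OF that(1), of "\<lambda>p v. hessian \<Phi> p v (Y p)", OF linU(2) s that(3)])
  qed
  have riem: "riemannian_metric (euclidean_mfd S) (hessian \<Phi>)"
    unfolding riemannian_metric_def
  proof (intro conjI ballI allI impI)
    fix p v w assume "p \<in> topspace (mtop (euclidean_mfd S))"
    then have p: "p \<in> S" by (simp add: euclidean_mfd_def)
    show "bilinear (hessian \<Phi> p)" "hessian \<Phi> p v w = hessian \<Phi> p w v" using bil[OF p] sym[OF p] by auto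
    show "0 < hessian \<Phi> p v v" if "v \<noteq> 0" using pos[OF p that] .
  next
    fix U X Y
    assume a: "openin (mtop (euclidean_mfd S)) U \<and> smooth_vf (euclidean_mfd S) U X \<and> smooth_vf (euclidean_mfd S) U Y"
    then have U: "openin (mtop (euclidean_mfd S)) U" by blast
    show "smooth_fun (euclidean_mfd S) U (\<lambda>p. hessian \<Phi> p (X p) (Y p))"
      using sm3[of U X Y] a U by (simp add: euclidean_smooth_fun[OF U] euclidean_smooth_vf[OF U] euclidean_openin)
  qed
  have tor: "torsion_free (euclidean_mfd S) euclidean_conn"
    by (auto simp: torsion_free_def euclidean_openin euclidean_conn_def euclidean_lie_bracket subset_iff)
  have cov: "cov_deriv_metric (euclidean_mfd S) (hessian \<Phi>) euclidean_conn X Y Z p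
      = dd (\<lambda>q. hessian \<Phi> q (Y p) (Z p)) p (X p)"
    if U: "openin (mtop (euclidean_mfd S)) U" and "smooth_vf (euclidean_mfd S) U X" "smooth_vf (euclidean_mfd S) U Y"
      "smooth_vf (euclidean_mfd S) U Z" and p: "p \<in> U" for U X Y Z p
  proof -
    have s: "smooth_on U X" "smooth_on U Y" "smooth_on U Z" using that by (auto simp: euclidean_smooth_vf[OF U])
    have U': "open U" "U \<subseteq> S" using U by (auto simp: euclidean_openin)
    have pS: "p \<in> S" using U' p by blast
    have "dd (\<lambda>q. hessian \<Phi> q (Y q) (Z q)) p (X p)
        = dd (\<lambda>q. hessian \<Phi> q (Y p) (Z q)) p (X p) + hessian \<Phi> p (dd Y p (X p)) (Z p)"
      by (rule dd_linear_family(1)[OF U'(1) p, of "\<lambda>q v. hessian \<Phi> q v (Z q)"])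
        (use lin U' smooth_on_differentiable[OF sm2[OF U' s(1,3)] p] smooth_on_differentiable[OF s(2) p] in auto)
    also have "dd (\<lambda>q. hessian \<Phi> q (Y p) (Z q)) p (X p)
        = dd (\<lambda>q. hessian \<Phi> q (Y p) (Z p)) p (X p) + hessian \<Phi> p (Y p) (dd Z p (X p))"
      by (rule dd_linear_family(1)[OF U'(1) p, of "\<lambda>q. hessian \<Phi> q (Y p)"])
        (use lin U' smooth_on_differentiable[OF sm pS] smooth_on_differentiable[OF s(3) p] in auto)
    finally show ?thesis
      by (simp add: cov_deriv_metric_def euclidean_conn_def euclidean_dir_deriv[OF pS])
  qed
  have third1: "dd (\<lambda>q. hessian \<Phi> q v w) p u = dd (\<lambda>q. hessian \<Phi> q u w) p v" if "p \<in> S" for p u v w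
    unfolding hessian_def by (rule symmetric_second_derivative[OF S smooth_on_dd[OF \<Phi>] that])
  have third2: "dd (\<lambda>q. hessian \<Phi> q v w) p u = dd (\<lambda>q. hessian \<Phi> q w v) p u" if "p \<in> S" for p u v w
    by (rule dd_cong[OF S that, THEN fun_cong]) (rule sym)
  show ?thesis
    unfolding flat_statistical_manifold_def statistical_manifold_def
  proof (intro conjI allI impI ballI smooth_manifold_euclidean[OF S] riem euclidean_affine_connection tor euclidean_flat; elim conjE)
    fix U X Y Z p
    assume U: "openin (mtop (euclidean_mfd S)) U" and X: "smooth_vf (euclidean_mfd S) U X"
      and Y: "smooth_vf (euclidean_mfd S) U Y" and Z: "smooth_vf (euclidean_mfd S) U Z" and p: "p \<in> U"
    have pS: "p \<in> S" using U p by (auto simp: euclidean_openin)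
    show "cov_deriv_metric (euclidean_mfd S) (hessian \<Phi>) euclidean_conn X Y Z p
        = cov_deriv_metric (euclidean_mfd S) (hessian \<Phi>) euclidean_conn Y X Z p"
      unfolding cov[OF U X Y Z p] cov[OF U Y X Z p] by (rule third1[OF pS])
    show "cov_deriv_metric (euclidean_mfd S) (hessian \<Phi>) euclidean_conn X Y Z p
        = cov_deriv_metric (euclidean_mfd S) (hessian \<Phi>) euclidean_conn X Z Y p"
      unfolding cov[OF U X Y Z p] cov[OF U X Z Y p] by (rule third2[OF pS])
  qed
qed

end

section \<open>Affine coordinates on flat statistical manifolds\<close>

locale flat_stat = stat M g D for M :: "('a, 'e::euclidean_space) manifold" and g D +
  assumes flat: "flat_connection M D"
begin

text \<open>The coordinate result transported to the manifold. The last clause says that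
  \<open>u\<close> is affine: its differential carries \<open>D X Y\<close> to the iterated
  derivative of \<open>u\<close>. The continuous inverse \<open>k\<close> is kept because it later
  shows that the new map is a topological embedding.\<close>

theorem affine_map:
  assumes s0: "s0 \<in> topspace (mtop M)"
  obtains A W u k and \<Psi> :: "'e \<Rightarrow> real" where "openin (mtop M) A" "s0 \<in> A" "open W" "u ` A \<subseteq> W" "smooth_fun M A u"
    "smooth_on W \<Psi>" "continuous_map (top_of_set W) (mtop M) k" "\<And>q. q \<in> A \<Longrightarrow> k (u q) = q"
    "\<And>q v w. q \<in> A \<Longrightarrow> g q v w = dd (\<lambda>y. riesz (dd \<Psi> y)) (u q) (dir_deriv M u q v) \<bullet> dir_deriv M u q w"
    "\<And>q a. q \<in> A \<Longrightarrow> \<exists>v. dir_deriv M u q v = a"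
    "\<And>V X Y p. openin (mtop M) V \<Longrightarrow> V \<subseteq> A \<Longrightarrow> smooth_vf M V X \<Longrightarrow> smooth_vf M V Y \<Longrightarrow> p \<in> V
      \<Longrightarrow> dir_deriv M u p (D X Y p) = dir_deriv M (\<lambda>q. dir_deriv M u q (Y q)) p (X p)"
proof -
  define c where "c = chart_at M s0"
  have c: "c \<in> atlas M" "s0 \<in> fst c" using chart_at_atlas[OF s0] chart_at_mem[OF s0] by (auto simp: c_def)
  interpret H: flat_hessian "snd c ` fst c" "christoffel c" "metric_coeff c"
    by (rule flat_hessian_chart[OF flat c(1)])
  obtain V W h \<phi> \<Psi> where V: "open V" "snd c s0 \<in> V" "V \<subseteq> snd c ` fst c" "open W" "homeomorphism V W h \<phi>"
    "smooth_on V h" "smooth_on W \<phi>" "\<And>x. x \<in> V \<Longrightarrow> bij (dd h x)" "smooth_on W (\<Psi> :: 'e \<Rightarrow> real)"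
    and ddh: "\<And>x v w. x \<in> V \<Longrightarrow> dd (\<lambda>x. dd h x w) x v = dd h x (christoffel c x v w)"
    and Gh: "\<And>x v w. x \<in> V \<Longrightarrow> metric_coeff c x v w = dd (\<lambda>y. dd \<Psi> y (dd h x w)) (h x) (dd h x v)"
    using H.affine_coordinates[OF imageI[OF c(2), of "snd c"]] by blast
  have hV: "h ` V \<subseteq> W" "\<phi> ` W \<subseteq> V" "\<And>x. x \<in> V \<Longrightarrow> \<phi> (h x) = x" using V(5) by (auto simp: homeomorphism_def)
  define A where "A = {q \<in> fst c. snd c q \<in> V}"
  define u where "u q = h (snd c q)" for q
  have A: "openin (mtop M) A" unfolding A_def by (rule chart_open_preimage[OF c(1) V(1)])
  have Ac: "q \<in> fst c" "snd c q \<in> V" if "q \<in> A" for q using that by (auto simp: A_def)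
  have sc: "smooth_fun M A (snd c)" by (rule smooth_fun_subset[OF smooth_fun_chart[OF c(1)]]) (auto simp: A_def)
  have smu: "smooth_fun M A u"
    unfolding u_def by (rule smooth_fun_compose[OF A sc V(1) _ V(6)]) (auto simp: A_def)
  have du: "dir_deriv M u q v = dd h (snd c q) (comps M c q v)" if "q \<in> A" for q v
    unfolding u_def dir_deriv_compose[OF A that sc smooth_on_differentiable[OF V(6) Ac(2)[OF that]]]
    by (simp add: dir_deriv_chart_map[OF c(1) Ac(1)[OF that]])
  have kc: "continuous_map (top_of_set W) (mtop M) (chart_inv c \<circ> \<phi>)"
  proof (rule continuous_map_compose[OF _ continuous_chart_inv[OF c(1)]])
    show "continuous_map (top_of_set W) (top_of_set (snd c ` fst c)) \<phi>"
      using smooth_on_continuous[OF V(7)] hV(2) V(3) by auto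
  qed
  have k: "(chart_inv c \<circ> \<phi>) (u q) = q" if "q \<in> A" for q
    using Ac[OF that] c(1) by (simp add: u_def hV(3))
  have G: "g q v w = dd (\<lambda>y. riesz (dd \<Psi> y)) (u q) (dir_deriv M u q v) \<bullet> dir_deriv M u q w" if q: "q \<in> A" for q v w
  proof -
    have "h (snd c q) \<in> W" using hV(1) Ac(2)[OF q] by blast
    then show ?thesis
      using metric_coeff_comps[OF c(1) Ac(1)[OF q], of v w] Gh[OF Ac(2)[OF q]] gradient_potential(3)[OF V(9,4)]
      by (simp add: du[OF q] u_def)
  qed
  have surj: "\<exists>v. dir_deriv M u q v = a" if q: "q \<in> A" for q a
  proof -
    obtain b where "dd h (snd c q) b = a" using V(8)[OF Ac(2)[OF q]] by (metis bij_pointE)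
    then show ?thesis using comps_coord_field_same[OF c(1) Ac(1)[OF q], of b] du[OF q] by metis
  qed
  have aff: "dir_deriv M u p (D X Y p) = dir_deriv M (\<lambda>q. dir_deriv M u q (Y q)) p (X p)"
    if O: "openin (mtop M) O'" "O' \<subseteq> A" and X: "smooth_vf M O' X" and Y: "smooth_vf M O' Y" and p: "p \<in> O'" for O' X Y p
  proof -
    have pA: "p \<in> A" using O p by blast
    have Oc: "O' \<inter> fst c = O'" using O(2) by (auto simp: A_def)
    have sY: "smooth_fun M O' (\<lambda>q. comps M c q (Y q))" using smooth_vfD[OF Y c(1) O(1)] Oc by simp
    have "dir_deriv M (\<lambda>q. dir_deriv M u q (Y q)) p (X p) = dir_deriv M (\<lambda>q. dd h (snd c q) (comps M c q (Y q))) p (X p)"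
      by (rule dir_deriv_cong[OF O(1) p]) (use du O(2) in blast)
    also have "\<dots> = dd (\<lambda>x. dd h x (comps M c p (Y p))) (snd c p) (dir_deriv M (snd c) p (X p))
        + dd h (snd c p) (dir_deriv M (\<lambda>q. comps M c q (Y q)) p (X p))"
      by (rule dir_deriv_dd[OF O(1) p smooth_fun_subset[OF sc O(2)] V(1) _ V(6) sY]) (use O(2) in \<open>auto simp: A_def\<close>)
    \<comment> \<open>By \<open>ddh\<close> the second derivative of \<open>h\<close> is its first
      derivative composed with the Christoffel symbols, so the two summands are the image of the
      local formula for \<open>D X Y\<close>.\<close>
    also have "\<dots> = dd h (snd c p) (comps M c p (D X Y p))"
      unfolding conn_local_formula[OF c(1) O(1) X Y p Ac(1)[OF pA]] dir_deriv_chart_map[OF c(1) Ac(1)[OF pA]]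
        ddh[OF Ac(2)[OF pA]] linear_add[OF smooth_on_linear_dd[OF V(6) Ac(2)[OF pA]]] by (rule add.commute)
    finally show ?thesis by (simp add: du[OF pA])
  qed
  show ?thesis
    by (rule that[OF A _ V(4) _ smu V(9) kc k G surj aff]) (use c V(2) hV(1) in \<open>auto simp: A_def u_def\<close>)
qed

end

section \<open>Statistical embeddings\<close>

context mfd
begin

lemma smooth_fun_open_preimage:
  assumes U: "openin (mtop M) U" and h: "smooth_fun M U h" and T: "open T"
  shows "openin (mtop M) {p \<in> U. h p \<in> T}"
proof (subst openin_subopen, intro ballI)
  fix p assume p: "p \<in> {p \<in> U. h p \<in> T}"
  then have pt: "p \<in> topspace (mtop M)" using U openin_subset by blast
  define c where "c = chart_at M p"
  have c: "c \<in> atlas M" "p \<in> fst c" using chart_at_atlas[OF pt] chart_at_mem[OF pt] by (auto simp: c_def)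
  have o: "open (snd c ` (U \<inter> fst c))" by (rule chart_open_image[OF c(1) U])
  define R where "R = (h \<circ> chart_inv c) -` T \<inter> snd c ` (U \<inter> fst c)"
  have "open R" unfolding R_def
    using smooth_on_continuous[OF smooth_funD[OF h c(1)]] o T by (simp add: continuous_on_open_vimage o_def)
  then have "openin (mtop M) {q \<in> fst c. snd c q \<in> R}" by (rule chart_open_preimage[OF c(1)])
  moreover have "{q \<in> fst c. snd c q \<in> R} \<subseteq> {p \<in> U. h p \<in> T}"
  proof
    fix q assume q: "q \<in> {q \<in> fst c. snd c q \<in> R}"
    then have "chart_inv c (snd c q) = q" using c(1) by simp
    moreover have "chart_inv c (snd c q) \<in> U \<inter> fst c"
      by (rule chart_inv_in[OF _ _ c(1)]) (use q in \<open>auto simp: R_def\<close>)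
    ultimately show "q \<in> {p \<in> U. h p \<in> T}" using q by (simp add: R_def)
  qed
  moreover have "p \<in> {q \<in> fst c. snd c q \<in> R}" using p c by (auto simp: R_def)
  ultimately show "\<exists>T'. openin (mtop M) T' \<and> p \<in> T' \<and> T' \<subseteq> {p \<in> U. h p \<in> T}" by blast
qed

lemma smooth_fun_continuous_map:
  assumes "openin (mtop M) U" "smooth_fun M U h"
  shows "continuous_map (subtopology (mtop M) U) euclidean h"
proof -
  have "topspace (subtopology (mtop M) U) = U" using openin_subset[OF assms(1)] by auto
  moreover have "openin (subtopology (mtop M) U) {p \<in> U. h p \<in> T}" if "open T" for T
    using smooth_fun_open_preimage[OF assms that] by (auto simp: openin_open_subtopology[OF assms(1)])
  ultimately show ?thesis by (auto simp: continuous_map_def)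
qed

text \<open>Converts the conditions on fields in the definition of a statistical embedding into
  conditions on single tangent vectors.\<close>

lemma smooth_vf_with_value:
  assumes U: "openin (mtop M) U" and p: "p \<in> U"
  obtains X where "smooth_vf M U X" "X p = v"
proof -
  have pt: "p \<in> topspace (mtop M)" using p openin_subset[OF U] by blast
  define c where "c = chart_at M p"
  have c: "c \<in> atlas M" "p \<in> fst c" using chart_at_atlas[OF pt] chart_at_mem[OF pt] by (auto simp: c_def)
  have V: "openin (mtop M) (U \<inter> fst c)" "U \<inter> fst c \<subseteq> U" "p \<in> U \<inter> fst c"
    using openin_Int[OF U chart_openin[OF c(1)]] p c by auto
  have F: "smooth_vf M (U \<inter> fst c) (coord_field M c v)"
    by (rule smooth_vf_subset[OF smooth_vf_coord_field[OF c(1)]]) auto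
  obtain X where X: "smooth_vf M U X"
      "\<exists>W. openin (mtop M) W \<and> p \<in> W \<and> W \<subseteq> U \<inter> fst c \<and> (\<forall>q\<in>W. X q = coord_field M c v q)"
    by (rule smooth_vf_extend[OF U V(1,2) F V(3)], rule that)
  then have "X p = coord_field M c v p" by blast
  then show ?thesis using that X(1) comps_chart_at(2)[OF pt, of v] by (simp add: c_def)
qed

end

locale stat_embedding = M: stat M g D + S: flat_stat S G E
  for M :: "('a, 'e::euclidean_space) manifold" and g D
    and S :: "('s, 'n::euclidean_space) manifold" and G E +
  fixes U and f :: "'a \<Rightarrow> 's"
  assumes open_U: "openin (mtop M) U" and embedding: "statistical_embedding M g D U S G E f"
begin

section \<open>Pulling functions and connections back along the embedding\<close>

lemma smooth_f: "smooth_map M U S f"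
  and embedding_f: "embedding_map (subtopology (mtop M) U) (mtop S) f"
  using embedding by (auto simp: statistical_embedding_def smooth_embedding_def)

lemma f_in: "p \<in> U \<Longrightarrow> f p \<in> topspace (mtop S)"
  using smooth_f openin_subset[OF open_U] unfolding smooth_map_def continuous_map_def by auto

lemma f_preimage_open: "openin (mtop S) A \<Longrightarrow> openin (mtop M) {p \<in> U. f p \<in> A}"
proof -
  assume "openin (mtop S) A"
  then have "openin (subtopology (mtop M) U) {p \<in> topspace (subtopology (mtop M) U). f p \<in> A}"
    using smooth_f openin_continuous_map_preimage unfolding smooth_map_def by blast
  moreover have "topspace (subtopology (mtop M) U) = U" using openin_subset[OF open_U] by auto
  ultimately show ?thesis using openin_trans_full[OF _ open_U] by metis
qed

context
  fixes d assumes d: "d \<in> atlas S"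
begin

lemma smooth_fun_chart_f: "smooth_fun M {p \<in> U. f p \<in> fst d} (\<lambda>p. snd d (f p))"
  unfolding smooth_fun_def
proof
  fix c assume c: "c \<in> atlas M"
  have "{p \<in> U. f p \<in> fst d} \<inter> fst c = {p \<in> U \<inter> fst c. f p \<in> fst d}" by blast
  then show "smooth_on (snd c ` ({p \<in> U. f p \<in> fst d} \<inter> fst c)) ((\<lambda>p. snd d (f p)) \<circ> chart_inv c)"
    using smooth_f c d by (simp add: smooth_map_def o_def)
qed

lemma dir_deriv_chart_f:
  assumes "p \<in> U" "f p \<in> fst d"
  shows "dir_deriv M (\<lambda>q. snd d (f q)) p v = comps S d (f p) (differential M S f p v)"
proof -
  define e where "e = chart_at S (f p)"
  have e: "e \<in> atlas S" "f p \<in> fst e"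
    using S.chart_at_atlas[OF f_in[OF assms(1)]] S.chart_at_mem[OF f_in[OF assms(1)]] by (auto simp: e_def)
  let ?V = "{p \<in> U. f p \<in> fst d \<inter> fst e}"
  have V: "openin (mtop M) ?V" "p \<in> ?V"
    using f_preimage_open[OF openin_Int[OF S.chart_openin[OF d] S.chart_openin[OF e(1)]]] assms e by auto
  have sV: "smooth_fun M ?V (\<lambda>q. snd e (f q))"
    by (rule M.smooth_fun_subset[of "{p \<in> U. f p \<in> fst e}"])
      (use stat_embedding.smooth_fun_chart_f[OF stat_embedding_axioms e(1)] in auto)
  have "dir_deriv M (\<lambda>q. snd d (f q)) p v = dir_deriv M (\<lambda>q. (snd d \<circ> chart_inv e) (snd e (f q))) p v"
    by (rule M.dir_deriv_cong[OF V]) (use e in auto)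
  also have "\<dots> = dd (snd d \<circ> chart_inv e) (snd e (f p)) (dir_deriv M (\<lambda>q. snd e (f q)) p v)"
    by (rule M.dir_deriv_compose[OF V sV S.transition_differentiable]) (use assms d e in auto)
  also have "\<dots> = comps S d (f p) (differential M S f p v)"
    by (simp add: comps_def coord_change_def differential_def e_def o_def)
  finally show ?thesis .
qed

end

lemma smooth_fun_comp_f:
  assumes A: "openin (mtop S) A" and h: "smooth_fun S A (h :: 's \<Rightarrow> 'd::euclidean_space)"
  shows "smooth_fun M {p \<in> U. f p \<in> A} (\<lambda>p. h (f p))"
    and "p \<in> U \<Longrightarrow> f p \<in> A \<Longrightarrow> dir_deriv M (\<lambda>p. h (f p)) p v = dir_deriv S h (f p) (differential M S f p v)"
proof -
  have loc: "\<exists>V. openin (mtop M) V \<and> p \<in> V \<and> smooth_fun M V (\<lambda>p. h (f p)) \<and>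
      (\<forall>v. dir_deriv M (\<lambda>p. h (f p)) p v = dir_deriv S h (f p) (differential M S f p v))" if p: "p \<in> U" "f p \<in> A" for p
  proof -
    define d where "d = chart_at S (f p)"
    have d: "d \<in> atlas S" "f p \<in> fst d"
      using S.chart_at_atlas[OF f_in[OF p(1)]] S.chart_at_mem[OF f_in[OF p(1)]] by (auto simp: d_def)
    let ?V = "{p \<in> U. f p \<in> A \<inter> fst d}"
    have V: "openin (mtop M) ?V" "p \<in> ?V"
      using f_preimage_open[OF openin_Int[OF A S.chart_openin[OF d(1)]]] p d by auto
    have sd: "smooth_fun M ?V (\<lambda>q. snd d (f q))"
      by (rule M.smooth_fun_subset[OF smooth_fun_chart_f[OF d(1)]]) auto
    note oT = S.chart_open_image[OF d(1) A]
    have eq: "(h \<circ> chart_inv d) (snd d (f q)) = h (f q)" if "q \<in> ?V" for q using that d(1) by auto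
    have "smooth_fun M ?V (\<lambda>q. (h \<circ> chart_inv d) (snd d (f q)))"
      by (rule M.smooth_fun_compose[OF V(1) sd oT _ S.smooth_funD[OF h d(1)]]) auto
    then have 1: "smooth_fun M ?V (\<lambda>q. h (f q))" by (rule M.smooth_fun_cong[OF V(1), rotated]) (rule eq)
    have "dir_deriv M (\<lambda>q. h (f q)) p v = dir_deriv S h (f p) (differential M S f p v)" for v
    proof -
      have "dir_deriv M (\<lambda>q. h (f q)) p v = dir_deriv M (\<lambda>q. (h \<circ> chart_inv d) (snd d (f q))) p v"
        by (rule M.dir_deriv_cong[OF V]) (rule eq[symmetric])
      also have "\<dots> = dd (h \<circ> chart_inv d) (snd d (f p)) (dir_deriv M (\<lambda>q. snd d (f q)) p v)"
        by (rule M.dir_deriv_compose[OF V sd S.smooth_fun_differentiable[OF A h p(2) d]])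
      finally show ?thesis
        by (simp add: dir_deriv_chart_f[OF d(1) p(1) d(2)] S.dir_deriv_chart[OF A h p(2) d])
    qed
    then show ?thesis using V 1 by blast
  qed
  show "smooth_fun M {p \<in> U. f p \<in> A} (\<lambda>p. h (f p))"
    by (rule M.smooth_fun_local) (use loc in blast)
  show "p \<in> U \<Longrightarrow> f p \<in> A \<Longrightarrow> dir_deriv M (\<lambda>p. h (f p)) p v = dir_deriv S h (f p) (differential M S f p v)"
    using loc by blast
qed

text \<open>An affine map sends the pulled-back derivative of \<open>f_* Y\<close> along
  \<open>X\<close> to the plain iterated derivative of \<open>u\<close> composed with
  \<open>f\<close>. The Christoffel term of the pullback becomes exactly the second-derivative term
  of the chain rule.\<close>

lemma dir_deriv_pullback:
  assumes A: "openin (mtop S) A" and u: "smooth_fun S A (u :: 's \<Rightarrow> 'd::euclidean_space)"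
    and aff: "\<And>V X Y p. openin (mtop S) V \<Longrightarrow> V \<subseteq> A \<Longrightarrow> smooth_vf S V X \<Longrightarrow> smooth_vf S V Y \<Longrightarrow> p \<in> V
      \<Longrightarrow> dir_deriv S u p (E X Y p) = dir_deriv S (\<lambda>q. dir_deriv S u q (Y q)) p (X p)"
    and X: "smooth_vf M U X" and Y: "smooth_vf M U Y" and p: "p \<in> U" "f p \<in> A"
  shows "dir_deriv S u (f p) (pullback_connection M S E f X (\<lambda>q. differential M S f q (Y q)) p)
       = dir_deriv M (\<lambda>q. dir_deriv M (\<lambda>q. u (f q)) q (Y q)) p (X p)"
proof -
  define d where "d = chart_at S (f p)"
  note fp = f_in[OF p(1)]
  have d: "d \<in> atlas S" "f p \<in> fst d" using S.chart_at_atlas[OF fp] S.chart_at_mem[OF fp] by (auto simp: d_def)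
  have cid: "comps S d (f p) v = v" for v using S.comps_chart_at(1)[OF fp] by (simp add: d_def)
  let ?W = "A \<inter> fst d" and ?V = "{p \<in> U. f p \<in> A \<inter> fst d}"
  have W: "openin (mtop S) ?W" by (rule openin_Int[OF A S.chart_openin[OF d(1)]])
  have V: "openin (mtop M) ?V" "p \<in> ?V" using f_preimage_open[OF W] p d by auto
  let ?T = "snd d ` (A \<inter> fst d)" and ?ud = "u \<circ> chart_inv d"
  have T: "open ?T" by (rule S.chart_open_image[OF d(1) A])
  have ud: "smooth_on ?T ?ud" by (rule S.smooth_funD[OF u d(1)])
  have sd: "smooth_fun M ?V (\<lambda>q. snd d (f q))"
    by (rule M.smooth_fun_subset[OF smooth_fun_chart_f[OF d(1)]]) auto
  define w where "w q = comps S d (f q) (differential M S f q (Y q))" for q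
  have w: "smooth_fun M ?V w"
  proof (rule M.smooth_fun_cong[OF V(1)])
    show "smooth_fun M ?V (\<lambda>q. dir_deriv M (\<lambda>q. snd d (f q)) q (Y q))"
      by (rule M.smooth_fun_dir_deriv[OF V(1) sd M.smooth_vf_subset[OF Y]]) auto
    show "dir_deriv M (\<lambda>q. snd d (f q)) q (Y q) = w q" if "q \<in> ?V" for q
      using that dir_deriv_chart_f[OF d(1), of q] by (simp add: w_def)
  qed
  have wp: "w p = differential M S f p (Y p)" by (simp add: w_def cid)
  let ?a = "differential M S f p (X p)" and ?b = "differential M S f p (Y p)"
  have du: "dir_deriv S u (f p) v = dd ?ud (snd d (f p)) v" for v
    using S.dir_deriv_chart[OF A u p(2) d] by (simp add: cid)
  \<comment> \<open>Affinity is applied to fields with constant components in \<open>d\<close>;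
    along these the iterated derivative is the coordinate second derivative of
    \<open>u\<close>.\<close>
  have Hess: "dir_deriv S u (f p) (E (coord_field S d ?a) (coord_field S d ?b) (f p))
      = dd (\<lambda>x. dd ?ud x ?b) (snd d (f p)) ?a"
  proof -
    have F: "smooth_vf S ?W (coord_field S d v)" for v
      by (rule S.smooth_vf_subset[OF S.smooth_vf_coord_field[OF d(1)]]) auto
    have fW: "f p \<in> ?W" using p d by blast
    have "dir_deriv S u (f p) (E (coord_field S d ?a) (coord_field S d ?b) (f p))
        = dir_deriv S (\<lambda>q. dir_deriv S u q (coord_field S d ?b q)) (f p) (coord_field S d ?a (f p))"
      by (rule aff[OF W _ F F fW]) auto
    also have "\<dots> = dd ((\<lambda>q. dir_deriv S u q (coord_field S d ?b q)) \<circ> chart_inv d) (snd d (f p)) ?a"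
      by (rule S.dir_deriv_coord_field[OF W S.smooth_fun_dir_deriv[OF W S.smooth_fun_subset[OF u] F] fW d]) auto
    also have "\<dots> = dd (\<lambda>x. dd ?ud x ?b) (snd d (f p)) ?a"
    proof (rule dd_cong[OF T, THEN fun_cong])
      show "snd d (f p) \<in> ?T" using fW by blast
      fix x assume "x \<in> ?T"
      then obtain q where q: "q \<in> A" "q \<in> fst d" "x = snd d q" by blast
      then show "((\<lambda>q. dir_deriv S u q (coord_field S d ?b q)) \<circ> chart_inv d) x = dd ?ud x ?b"
        using S.dir_deriv_coord_field[OF A u q(1) d(1) q(2)] d(1) by simp
    qed
    finally show ?thesis .
  qed
  have pb: "pullback_connection M S E f X (\<lambda>q. differential M S f q (Y q)) p
      = dir_deriv M w p (X p) + E (coord_field S d ?a) (coord_field S d ?b) (f p)"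
    by (simp add: pullback_connection_def Let_def d_def w_def[abs_def])
  have lin: "linear (dir_deriv S u (f p))" by (rule S.linear_dir_deriv[OF A p(2) u])
  have "dir_deriv M (\<lambda>q. dir_deriv M (\<lambda>q. u (f q)) q (Y q)) p (X p) = dir_deriv M (\<lambda>q. dd ?ud (snd d (f q)) (w q)) p (X p)"
  proof (rule M.dir_deriv_cong[OF V])
    fix q assume q: "q \<in> ?V"
    then have q: "q \<in> U" "f q \<in> A" "f q \<in> fst d" by auto
    show "dir_deriv M (\<lambda>q. u (f q)) q (Y q) = dd ?ud (snd d (f q)) (w q)"
      unfolding smooth_fun_comp_f(2)[OF A u q(1,2)] S.dir_deriv_chart[OF A u q(2) d(1) q(3)] by (simp add: w_def)
  qed
  also have "\<dots> = dd (\<lambda>x. dd ?ud x (w p)) (snd d (f p)) (dir_deriv M (\<lambda>q. snd d (f q)) p (X p))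
      + dd ?ud (snd d (f p)) (dir_deriv M w p (X p))"
    by (rule M.dir_deriv_dd[OF V sd T _ ud w]) auto
  also have "\<dots> = dir_deriv S u (f p) (pullback_connection M S E f X (\<lambda>q. differential M S f q (Y q)) p)"
    unfolding pb linear_add[OF lin] Hess du[symmetric] wp dir_deriv_chart_f[OF d(1) p(1) d(2)] cid by (rule add.commute)
  finally show ?thesis by simp
qed

lemma metric_embedding:
  assumes p: "p \<in> U"
  shows "g p v w = G (f p) (differential M S f p v) (differential M S f p w)"
proof -
  obtain X where "smooth_vf M U X" "X p = v" by (rule M.smooth_vf_with_value[OF open_U p])
  moreover obtain Y where "smooth_vf M U Y" "Y p = w" by (rule M.smooth_vf_with_value[OF open_U p])
  ultimately show ?thesis using embedding p unfolding statistical_embedding_def by blast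
qed

lemma connection_embedding:
  assumes X: "smooth_vf M U X" and Y: "smooth_vf M U Y" and p: "p \<in> U"
  shows "g p (D X Y p) z = G (f p) (pullback_connection M S E f X (\<lambda>q. differential M S f q (Y q)) p) (differential M S f p z)"
proof -
  obtain Z where "smooth_vf M U Z" "Z p = z" by (rule M.smooth_vf_with_value[OF open_U p])
  then show ?thesis using embedding X Y p unfolding statistical_embedding_def by blast
qed

text \<open>From here on the ambient manifold enters only through \<open>u\<close>, the potential
  and the map \<open>k\<close> that recovers \<open>f\<close>; the metric and the connection of
  \<open>M\<close> are expressed by derivatives on \<open>M\<close> itself.\<close>

theorem local_potentials:
  assumes x: "x \<in> U"
  obtains N W u k and \<Psi> :: "'n \<Rightarrow> real" where "openin (mtop M) N" "N \<subseteq> U" "x \<in> N" "open W" "u ` N \<subseteq> W"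
    "smooth_fun M N u" "smooth_on W \<Psi>" "continuous_map (top_of_set W) (mtop S) k" "\<And>p. p \<in> N \<Longrightarrow> k (u p) = f p"
    "\<And>a. a \<noteq> 0 \<Longrightarrow> dd (\<lambda>y. riesz (dd \<Psi> y)) (u x) a \<bullet> a > 0"
    "\<And>p v w. p \<in> N \<Longrightarrow> g p v w = dd (\<lambda>y. riesz (dd \<Psi> y)) (u p) (dir_deriv M u p v) \<bullet> dir_deriv M u p w"
    "\<And>V X Y z p. openin (mtop M) V \<Longrightarrow> V \<subseteq> N \<Longrightarrow> smooth_vf M V X \<Longrightarrow> smooth_vf M V Y \<Longrightarrow> p \<in> V
      \<Longrightarrow> g p (D X Y p) z
        = dd (\<lambda>y. riesz (dd \<Psi> y)) (u p) (dir_deriv M u p z) \<bullet> dir_deriv M (\<lambda>q. dir_deriv M u q (Y q)) p (X p)"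
proof -
  obtain A W u k and \<Psi> :: "'n \<Rightarrow> real" where A: "openin (mtop S) A" "f x \<in> A" "open W" "u ` A \<subseteq> W" "smooth_fun S A u"
    "smooth_on W \<Psi>" "continuous_map (top_of_set W) (mtop S) k" "\<And>q. q \<in> A \<Longrightarrow> k (u q) = q"
    and G: "\<And>q v w. q \<in> A \<Longrightarrow> G q v w = dd (\<lambda>y. riesz (dd \<Psi> y)) (u q) (dir_deriv S u q v) \<bullet> dir_deriv S u q w"
    and surj: "\<And>q a. q \<in> A \<Longrightarrow> \<exists>v. dir_deriv S u q v = a"
    and aff: "\<And>V X Y p. openin (mtop S) V \<Longrightarrow> V \<subseteq> A \<Longrightarrow> smooth_vf S V X \<Longrightarrow> smooth_vf S V Y \<Longrightarrow> p \<in> V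
      \<Longrightarrow> dir_deriv S u p (E X Y p) = dir_deriv S (\<lambda>q. dir_deriv S u q (Y q)) p (X p)"
    by (rule S.affine_map[OF f_in[OF x]], rule that)
  let ?N = "{p \<in> U. f p \<in> A}" and ?\<eta> = "\<lambda>y. riesz (dd \<Psi> y)" and ?u = "\<lambda>p. u (f p)"
  note \<eta> = gradient_potential[OF A(6,3)]
  have N: "openin (mtop M) ?N" by (rule f_preimage_open[OF A(1)])
  have su: "smooth_fun M ?N ?u" by (rule smooth_fun_comp_f(1)[OF A(1,5)])
  have du: "dir_deriv M ?u p v = dir_deriv S u (f p) (differential M S f p v)" if "p \<in> ?N" for p v
    using that smooth_fun_comp_f(2)[OF A(1,5)] by blast
  have uW: "u q \<in> W" if "q \<in> A" for q using A(4) that by blast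
  \<comment> \<open>Positivity is required for every \<open>a\<close>, not only for images of
    vectors tangent to \<open>M\<close>; the differential of \<open>u\<close> on the ambient
    manifold is onto, and \<open>G\<close> is positive on all its tangent vectors.\<close>
  have pos: "dd ?\<eta> (?u x) a \<bullet> a > 0" if "a \<noteq> 0" for a
  proof -
    obtain v where v: "dir_deriv S u (f x) v = a" using surj[OF A(2)] by blast
    then have "v \<noteq> 0" using that linear_0[OF S.linear_dir_deriv[OF A(1,2,5)]] by auto
    then show ?thesis using S.metric_pos[OF f_in[OF x], of v] by (simp add: G[OF A(2)] v)
  qed
  have g: "g p v w = dd ?\<eta> (?u p) (dir_deriv M ?u p v) \<bullet> dir_deriv M ?u p w" if "p \<in> ?N" for p v w
    using that by (simp add: metric_embedding G du)
  have gD: "g p (D X Y p) z = dd ?\<eta> (?u p) (dir_deriv M ?u p z) \<bullet> dir_deriv M (\<lambda>q. dir_deriv M ?u q (Y q)) p (X p)"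
    if V: "openin (mtop M) V" "V \<subseteq> ?N" and X: "smooth_vf M V X" and Y: "smooth_vf M V Y" and p: "p \<in> V" for V X Y p z
  proof -
    have pN: "p \<in> U" "f p \<in> A" using V(2) p by auto
    have VU: "V \<subseteq> U" using V(2) by blast
    \<comment> \<open>\<open>X\<close> and \<open>Y\<close> are smooth only on \<open>V\<close>, so
      they are extended to \<open>U\<close> before the embedding condition is used. Both sides of
      the claim depend only on the germs at \<open>p\<close>, hence the intersection
      \<open>?O\<close> below.\<close>
    obtain X' where X1: "smooth_vf M U X'" "\<exists>W. openin (mtop M) W \<and> p \<in> W \<and> W \<subseteq> V \<and> (\<forall>q\<in>W. X' q = X q)"
      by (rule M.smooth_vf_extend[OF open_U V(1) VU X p], rule that)
    from X1(2) obtain VX where VX: "openin (mtop M) VX \<and> p \<in> VX \<and> VX \<subseteq> V \<and> (\<forall>q\<in>VX. X' q = X q)" ..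
    have X': "smooth_vf M U X'" "openin (mtop M) VX" "p \<in> VX" "VX \<subseteq> V" "\<And>q. q \<in> VX \<Longrightarrow> X' q = X q"
      using X1(1) VX by auto
    obtain Y' where Y1: "smooth_vf M U Y'" "\<exists>W. openin (mtop M) W \<and> p \<in> W \<and> W \<subseteq> V \<and> (\<forall>q\<in>W. Y' q = Y q)"
      by (rule M.smooth_vf_extend[OF open_U V(1) VU Y p], rule that)
    from Y1(2) obtain VY where VY: "openin (mtop M) VY \<and> p \<in> VY \<and> VY \<subseteq> V \<and> (\<forall>q\<in>VY. Y' q = Y q)" ..
    have Y': "smooth_vf M U Y'" "openin (mtop M) VY" "p \<in> VY" "VY \<subseteq> V" "\<And>q. q \<in> VY \<Longrightarrow> Y' q = Y q"
      using Y1(1) VY by auto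
    let ?O = "VX \<inter> VY"
    have O: "openin (mtop M) ?O" "p \<in> ?O" using X' Y' by auto
    have "?O \<subseteq> U" using X'(4) VU by blast
    then have sO: "smooth_vf M ?O X'" "smooth_vf M ?O Y'"
      using M.smooth_vf_subset[OF X'(1)] M.smooth_vf_subset[OF Y'(1)] by auto
    have "D X Y p = D X' Y' p"
      using M.conn_cong[OF O(1) sO, of X Y p] X'(5) Y'(5) O(2) by simp
    let ?pb = "pullback_connection M S E f X' (\<lambda>q. differential M S f q (Y' q)) p"
    have "g p (D X' Y' p) z = G (f p) ?pb (differential M S f p z)"
      by (rule connection_embedding[OF X'(1) Y'(1) pN(1)])
    \<comment> \<open>\<open>G\<close> applies the derivative of \<eta> to the image of the
      pulled-back vector; symmetry moves it to the factor of \<open>z\<close>, leaving the first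
      slot free for \<open>dir_deriv_pullback\<close>.\<close>
    also have "\<dots> = dd ?\<eta> (?u p) (dir_deriv M ?u p z) \<bullet> dir_deriv S u (f p) ?pb"
      using V(2) p by (simp add: G[OF pN(2)] \<eta>(4)[OF uW[OF pN(2)]] du subset_iff)
    also have "dir_deriv S u (f p) ?pb = dir_deriv M (\<lambda>q. dir_deriv M ?u q (Y' q)) p (X' p)"
      by (rule dir_deriv_pullback[OF A(1,5) aff X'(1) Y'(1) pN])
    also have "\<dots> = dir_deriv M (\<lambda>q. dir_deriv M ?u q (Y q)) p (X p)"
      using M.dir_deriv_cong[OF O, of "\<lambda>q. dir_deriv M ?u q (Y' q)" "\<lambda>q. dir_deriv M ?u q (Y q)"] X'(3,5) Y'(5) by simp
    finally show ?thesis using \<open>D X Y p = D X' Y' p\<close> by simp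
  qed
  show ?thesis
    by (rule that[OF N _ _ A(3) _ su A(6,7) _ pos g gD]) (use A x in auto)
qed

end

section \<open>Recognizing topological embeddings\<close>

lemma embedding_map_restrict:
  assumes "embedding_map X Z f"
  shows "embedding_map (subtopology X U) Z f"
proof -
  have "embedding_map (subtopology X U) X id"
    using subtopology_restrict[of X U] by (simp add: embedding_map_def)
  from embedding_map_compose[OF this assms] show ?thesis by simp
qed

text \<open>The inverse of \<open>F\<close> on its image is the inverse of the embedding
  \<open>f\<close> after \<open>k\<close>, and both are continuous. Thus \<open>F\<close> is an
  embedding because a continuous function of its values already is one.\<close>

lemma embedding_map_left_factor:
  assumes F: "continuous_map X Y F" and f: "embedding_map X Z f"
    and k: "continuous_map (subtopology Y (F ` topspace X)) Z k" and kF: "\<And>p. p \<in> topspace X \<Longrightarrow> k (F p) = f p"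
  shows "embedding_map X Y F"
proof -
  obtain f' where f': "homeomorphic_maps X (subtopology Z (f ` topspace X)) f f'"
    using f by (auto simp: embedding_map_def homeomorphic_map_maps)
  have FY: "F ` topspace X \<subseteq> topspace Y" using F by (auto simp: continuous_map_def)
  have "continuous_map (subtopology Y (F ` topspace X)) (subtopology Z (f ` topspace X)) k"
    using k kF by (auto simp: continuous_map_in_subtopology)
  then have "continuous_map (subtopology Y (F ` topspace X)) X (f' \<circ> k)"
    using f' by (auto simp: homeomorphic_maps_def intro: continuous_map_compose)
  moreover have "f' (k (F p)) = p" if "p \<in> topspace X" for p
    using f' kF that by (simp add: homeomorphic_maps_def)
  ultimately have "homeomorphic_maps X (subtopology Y (F ` topspace X)) F (f' \<circ> k)"
    using F FY by (auto simp: homeomorphic_maps_def continuous_map_in_subtopology)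
  then show ?thesis by (auto simp: embedding_map_def homeomorphic_map_maps)
qed

context mfd
begin

lemma smooth_fun_Pair:
  assumes "openin (mtop M) U" "smooth_fun M U h" "smooth_fun M U k"
  shows "smooth_fun M U (\<lambda>p. (h p, k p))"
  unfolding smooth_fun_def
proof
  fix c assume c: "c \<in> atlas M"
  from smooth_on_Pair[OF chart_open_image[OF c assms(1)] smooth_funD[OF assms(2) c] smooth_funD[OF assms(3) c]]
  show "smooth_on (snd c ` (U \<inter> fst c)) ((\<lambda>p. (h p, k p)) \<circ> chart_inv c)" by (simp add: o_def)
qed

lemma dir_deriv_Pair:
  assumes U: "openin (mtop M) U" "p \<in> U" and h: "smooth_fun M U h" and k: "smooth_fun M U k"
  shows "dir_deriv M (\<lambda>q. (h q, k q)) p v = (dir_deriv M h p v, dir_deriv M k p v)"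
proof -
  have p: "p \<in> topspace (mtop M)" using U openin_subset by blast
  note c = chart_at_atlas[OF p] chart_at_mem[OF p]
  show ?thesis
    using has_derivative_Pair[OF has_derivative_dd[OF smooth_fun_differentiable[OF U(1) h U(2) c]]
        has_derivative_dd[OF smooth_fun_differentiable[OF U(1) k U(2) c]], THEN dd_eq]
    by (simp add: dir_deriv_def o_def)
qed

end

section \<open>Embedding of the alpha-connections\<close>

text \<open>\<open>M\<close> is mapped into the graph of the gradient map. For the metric both
  arguments of the Hessian are tangent to the graph; for the connection only the second is, and
  there the two ambient directions contribute the original and the dual connection.\<close>

theorem (in stat_embedding) alpha_embedding:
  assumes x: "x \<in> U" and dim: "DIM('k::euclidean_space) = 2 * DIM('n)"
  shows "\<exists>U' (S' :: ('k, 'k) manifold) G' E' F. openin (mtop M) U' \<and> x \<in> U' \<and> flat_statistical_manifold S' G' E' \<and>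
    statistical_embedding M g (alpha_connection \<alpha> M g D) U' S' G' E' F"
proof -
  define \<beta> where "\<beta> = (1 - \<alpha>) / 2"
  obtain N W u k and \<Psi> :: "'n \<Rightarrow> real" where N: "openin (mtop M) N" "N \<subseteq> U" "x \<in> N" and W: "open W" "u ` N \<subseteq> W"
    and su: "smooth_fun M N u" and \<Psi>: "smooth_on W \<Psi>"
    and k: "continuous_map (top_of_set W) (mtop S) k" "\<And>p. p \<in> N \<Longrightarrow> k (u p) = f p"
    and pos: "\<And>a. a \<noteq> 0 \<Longrightarrow> dd (\<lambda>y. riesz (dd \<Psi> y)) (u x) a \<bullet> a > 0"
    and gN: "\<And>p v w. p \<in> N \<Longrightarrow> g p v w = dd (\<lambda>y. riesz (dd \<Psi> y)) (u p) (dir_deriv M u p v) \<bullet> dir_deriv M u p w"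
    and gD: "\<And>V X Y z p. openin (mtop M) V \<Longrightarrow> V \<subseteq> N \<Longrightarrow> smooth_vf M V X \<Longrightarrow> smooth_vf M V Y \<Longrightarrow> p \<in> V
      \<Longrightarrow> g p (D X Y p) z
        = dd (\<lambda>y. riesz (dd \<Psi> y)) (u p) (dir_deriv M u p z) \<bullet> dir_deriv M (\<lambda>q. dir_deriv M u q (Y q)) p (X p)"
    by (rule local_potentials[OF x], rule that)
  define \<eta> where "\<eta> = (\<lambda>y. riesz (dd \<Psi> y))"
  have \<eta>_eq: "riesz (dd \<Psi> y) = \<eta> y" for y by (simp add: \<eta>_def)
  note \<eta> = gradient_potential[OF \<Psi> W(1), unfolded \<eta>_eq]
  note gN = gN[unfolded \<eta>_eq] and gD = gD[unfolded \<eta>_eq] and pos = pos[unfolded \<eta>_eq]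
  have uW: "u p \<in> W" if "p \<in> N" for p using W(2) that by blast
  define v where "v p = \<eta> (u p)" for p
  have sv: "smooth_fun M N v" unfolding v_def by (rule M.smooth_fun_compose[OF N(1) su W \<eta>(1)])
  have dv: "dir_deriv M v p a = dd \<eta> (u p) (dir_deriv M u p a)" if "p \<in> N" for p a
    unfolding v_def by (rule M.dir_deriv_compose[OF N(1) that su smooth_on_differentiable[OF \<eta>(1) uW[OF that]]])
  have \<eta>_sym: "dd \<eta> (u p) a \<bullet> b = dd \<eta> (u p) b \<bullet> a" if "p \<in> N" for p a b by (rule \<eta>(4)[OF uW[OF that]])

  \<comment> \<open>The model space \<open>'k\<close> is an arbitrary type of the right dimension,
    so the doubled space is identified with it by a linear isomorphism, and \<open>P1\<close>,
    \<open>P2\<close> play the role of the projections.\<close>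
  obtain J :: "'n \<times> 'n \<Rightarrow> 'k" and J' where J: "linear J" "linear J'" "\<And>y. J' (J y) = y" "\<And>z. J (J' z) = z"
    using isomorphisms_UNIV_UNIV[where 'M="'n \<times> 'n" and 'N='k] dim by (metis DIM_prod mult_2)
  define P1 P2 where "P1 z = fst (J' z)" and "P2 z = snd (J' z)" for z
  have P: "linear P1" "linear P2" "P1 (J (a, b)) = a" "P2 (J (a, b)) = b" for a b
    using J by (auto simp: P1_def P2_def linear_iff)
  have P_inj: "z = 0" if "P1 z = 0" "P2 z = 0" for z
    using that J(4)[of z] linear_0[OF J(1)] by (simp add: P1_def P2_def prod_eq_iff[symmetric] zero_prod_def)
      (metis prod.collapse)
  define F where "F p = J (u p, v p)" for p
  have PF: "P1 (F p) = u p" "P2 (F p) = v p" for p by (simp_all add: F_def P)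
  obtain O' \<Phi> K where O': "open O'" "F x \<in> O'" "P1 ` O' \<subseteq> W" and \<Phi>: "smooth_on O' \<Phi>"
    and \<Phi>_pos: "\<And>z a. z \<in> O' \<Longrightarrow> a \<noteq> 0 \<Longrightarrow> dd (\<lambda>z. dd \<Phi> z a) z a > 0"
    and \<Phi>_hess: "\<And>z a b. z \<in> O' \<Longrightarrow> P2 z = \<eta> (P1 z) \<Longrightarrow> dd (\<lambda>z. dd \<Phi> z b) z a =
       (1 - 2 * \<beta>) * (dd \<eta> (P1 z) (P1 a) \<bullet> P1 b) + \<beta> * (P1 a \<bullet> P2 b + P1 b \<bullet> P2 a)
       + K * ((P2 a - dd \<eta> (P1 z) (P1 a)) \<bullet> (P2 b - dd \<eta> (P1 z) (P1 b)))"
  proof (rule doubled_potential[OF W(1) \<Psi> P(1,2) P_inj, of "F x" \<beta>, unfolded \<eta>_eq])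
    show "P1 (F x) \<in> W" "P2 (F x) = \<eta> (P1 (F x))" using uW[OF N(3)] by (simp_all add: PF v_def)
    show "0 < dd \<eta> (P1 (F x)) a \<bullet> a" if "a \<noteq> 0" for a using pos[OF that] by (simp add: PF)
  qed (assumption | rule that)+
  let ?S = "euclidean_mfd O'"
  interpret E: mfd ?S by unfold_locales (rule smooth_manifold_euclidean[OF O'(1)])

  have bJ: "bounded_linear J" using J(1) linear_conv_bounded_linear by blast
  have sF: "smooth_fun M N F"
    unfolding F_def by (intro M.smooth_fun_linear[OF N(1) bJ] M.smooth_fun_Pair[OF N(1)] su sv)
  \<comment> \<open>The Hessian is known to be positive definite only on a neighbourhood of
    \<open>F x\<close>, and the domain shrinks accordingly.\<close>
  define U' where "U' = {p \<in> N. F p \<in> O'}"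
  have U': "openin (mtop M) U'" "x \<in> U'" "U' \<subseteq> N"
    using M.smooth_fun_open_preimage[OF N(1) sF O'(1)] N(3) O'(2) by (auto simp: U'_def)
  have U'N: "p \<in> N" "F p \<in> O'" if "p \<in> U'" for p using that by (auto simp: U'_def)
  have s': "smooth_fun M U' u" "smooth_fun M U' v" "smooth_fun M U' F" using M.smooth_fun_subset U'(3) su sv sF by blast+
  have dJ: "dir_deriv M (\<lambda>q. J (h q, l q)) p a = J (dir_deriv M h p a, dir_deriv M l p a)"
    if "p \<in> U'" "smooth_fun M U' h" "smooth_fun M U' l" for p a h l
    by (simp add: M.dir_deriv_linear[OF U'(1) that(1) bJ M.smooth_fun_Pair[OF U'(1) that(2,3)]]
        M.dir_deriv_Pair[OF U'(1) that])
  have dF: "dir_deriv M F p a = J (dir_deriv M u p a, dir_deriv M v p a)" if "p \<in> U'" for p a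
    unfolding F_def by (rule dJ[OF that s'(1,2)])
  have diffF: "differential M ?S F p a = dir_deriv M F p a" if "p \<in> U'" for p a
    by (simp add: differential_def euclidean_chart_at[OF O'(1) U'N(2)[OF that]])
  have hess: "hessian \<Phi> (F p) (J (a1, a2)) (J (b1, b2)) = (1 - 2 * \<beta>) * (dd \<eta> (u p) a1 \<bullet> b1) + \<beta> * (a1 \<bullet> b2 + b1 \<bullet> a2)
       + K * ((a2 - dd \<eta> (u p) a1) \<bullet> (b2 - dd \<eta> (u p) b1))" if "p \<in> U'" for p a1 a2 b1 b2
    unfolding hessian_def using \<Phi>_hess[OF U'N(2)[OF that], of "J (b1, b2)" "J (a1, a2)"] by (simp add: PF P v_def)

  \<comment> \<open>Both vectors are tangent to the graph, so the \<open>K\<close>-term vanishes,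
    and the remaining weights add up to \<open>(1 - 2\<beta>) + 2\<beta> = 1\<close>.\<close>
  have metric: "g p a b = hessian \<Phi> (F p) (differential M ?S F p a) (differential M ?S F p b)" if p: "p \<in> U'" for p a b
    unfolding diffF[OF p] dF[OF p] hess[OF p] dv[OF U'N(1)[OF p]]
    using \<eta>_sym[OF U'N(1)[OF p], of "dir_deriv M u p b" "dir_deriv M u p a"]
    by (simp add: gN[OF U'N(1)[OF p]] inner_commute algebra_simps)

  have dual: "g p (dual_connection M g D X Y p) z = dir_deriv M (\<lambda>q. dir_deriv M v q (Y q)) p (X p) \<bullet> dir_deriv M u p z"
    if X: "smooth_vf M U' X" and Y: "smooth_vf M U' Y" and p: "p \<in> U'" for X Y p z
  proof -
    obtain Z where Z: "smooth_vf M U' Z" "Z p = z" by (rule M.smooth_vf_with_value[OF U'(1) p])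
    have pt: "p \<in> topspace (mtop M)" using p U'(1) openin_subset by blast
    \<comment> \<open>The product rule for \<open>g(Z, Y)\<close>, written as
      \<open>Y\<eta> \<bullet> Zu\<close>: the term with \<open>XZu\<close> is
      \<open>g(D X Z, Y)\<close>, so duality leaves the term with \<open>XY\<eta>\<close> for the
      dual connection.\<close>
    have "dir_deriv M (\<lambda>q. g q (Z q) (Y q)) p (X p) = dir_deriv M (\<lambda>q. dir_deriv M v q (Y q) \<bullet> dir_deriv M u q (Z q)) p (X p)"
    proof (rule M.dir_deriv_cong[OF U'(1) p])
      fix q assume q: "q \<in> U'"
      then have "q \<in> topspace (mtop M)" using U'(1) openin_subset by blast
      then show "g q (Z q) (Y q) = dir_deriv M v q (Y q) \<bullet> dir_deriv M u q (Z q)"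
        using M.metric_sym[of q "Z q" "Y q"] gN[OF U'N(1)[OF q]] dv[OF U'N(1)[OF q]] by simp
    qed
    also have "\<dots> = dir_deriv M v p (Y p) \<bullet> dir_deriv M (\<lambda>q. dir_deriv M u q (Z q)) p (X p)
        + dir_deriv M (\<lambda>q. dir_deriv M v q (Y q)) p (X p) \<bullet> dir_deriv M u p (Z p)"
      by (intro M.dir_deriv_bilinear[OF U'(1) p bounded_bilinear_inner] M.smooth_fun_dir_deriv[OF U'(1)] s' Y Z)
    also have "dir_deriv M v p (Y p) \<bullet> dir_deriv M (\<lambda>q. dir_deriv M u q (Z q)) p (X p) = g p (D X Z p) (Y p)"
      by (simp add: gD[OF U'(1,3) X Z(1) p] dv[OF U'N(1)[OF p]])
    finally show ?thesis
      using M.duality[OF U'(1) X Z(1) Y p] M.metric_sym[OF pt, of z "dual_connection M g D X Y p"] Z(2) by simp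
  qed
  have alpha: "g p (alpha_connection \<alpha> M g D X Y p) z = hessian \<Phi> (F p)
      (pullback_connection M ?S euclidean_conn F X (\<lambda>q. differential M ?S F q (Y q)) p) (differential M ?S F p z)"
    if X: "smooth_vf M U' X" and Y: "smooth_vf M U' Y" and p: "p \<in> U'" for X Y p z
  proof -
    note Fp = U'N(2)[OF p] and pN = U'N(1)[OF p]
    let ?XYu = "dir_deriv M (\<lambda>q. dir_deriv M u q (Y q)) p (X p)" and ?XYv = "dir_deriv M (\<lambda>q. dir_deriv M v q (Y q)) p (X p)"
    \<comment> \<open>Fields with constant components are constant on \<open>O'\<close>, so the
      Christoffel term of the pulled-back connection vanishes and only the derivative of the
      components remains.\<close>
    have "euclidean_conn (coord_field ?S (O', id) a) (coord_field ?S (O', id) b) (F p) = 0" for a b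
      unfolding euclidean_conn_def
      using dd_cong[OF O'(1) Fp, of "coord_field ?S (O', id) b" "\<lambda>_. b"] euclidean_coord_field[OF O'(1)] by simp
    then have "pullback_connection M ?S euclidean_conn F X (\<lambda>q. differential M ?S F q (Y q)) p
        = dir_deriv M (\<lambda>q. comps ?S (O', id) (F q) (differential M ?S F q (Y q))) p (X p)"
      by (simp add: pullback_connection_def euclidean_chart_at[OF O'(1) Fp])
    also have "\<dots> = dir_deriv M (\<lambda>q. J (dir_deriv M u q (Y q), dir_deriv M v q (Y q))) p (X p)"
      by (rule M.dir_deriv_cong[OF U'(1) p]) (simp add: euclidean_comps[OF O'(1) U'N(2)] diffF dF)
    also have "\<dots> = J (?XYu, ?XYv)"
      by (intro dJ[OF p] M.smooth_fun_dir_deriv[OF U'(1)] s' Y)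
    finally have pb: "pullback_connection M ?S euclidean_conn F X (\<lambda>q. differential M ?S F q (Y q)) p = J (?XYu, ?XYv)" .
    have pt: "p \<in> topspace (mtop M)" using p U'(1) openin_subset by blast
    note bil = M.metric_bilinear[OF pt]
    have "(1 + \<alpha>) / 2 = 1 - \<beta>" by (simp add: \<beta>_def field_simps)
    then have "g p (alpha_connection \<alpha> M g D X Y p) z = (1 - \<beta>) * g p (D X Y p) z + \<beta> * g p (dual_connection M g D X Y p) z"
      by (simp add: alpha_connection_def bilinear_ladd[OF bil] bilinear_lmul[OF bil] \<beta>_def)
    also have "\<dots> = (1 - \<beta>) * (dd \<eta> (u p) (dir_deriv M u p z) \<bullet> ?XYu) + \<beta> * (?XYv \<bullet> dir_deriv M u p z)"
      unfolding gD[OF U'(1,3) X Y p] dual[OF X Y p] ..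
    \<comment> \<open>The first argument need not be tangent to the graph, but the second is, which
      kills the \<open>K\<close>-term. The coefficient of \<open>XYu \<bullet> Z\<eta>\<close>
      becomes \<open>(1 - 2\<beta>) + \<beta> = 1 - \<beta>\<close>, that of
      \<open>XY\<eta> \<bullet> Zu\<close> is \<beta>.\<close>
    also have "\<dots> = hessian \<Phi> (F p) (J (?XYu, ?XYv)) (J (dir_deriv M u p z, dd \<eta> (u p) (dir_deriv M u p z)))"
      unfolding hess[OF p] \<eta>_sym[OF pN, of ?XYu]
      by (simp add: inner_commute algebra_simps)
    finally show ?thesis unfolding pb diffF[OF p] dF[OF p] dv[OF pN] .
  qed

  have tU': "topspace (subtopology (mtop M) U') = U'" using openin_subset[OF U'(1)] by auto
  have cont: "continuous_map (subtopology (mtop M) U') (mtop ?S) F"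
    using M.smooth_fun_continuous_map[OF U'(1) s'(3)] U'N(2)
    by (auto simp: euclidean_mfd_def continuous_map_in_subtopology)
  have "smooth_map M U' ?S F"
    unfolding smooth_map_def
  proof (intro conjI cont ballI)
    fix c d assume c: "c \<in> atlas M" and d: "d \<in> atlas ?S"
    have "{p \<in> U' \<inter> fst c. F p \<in> fst d} = U' \<inter> fst c" using d U'N(2) by (auto simp: euclidean_mfd_def)
    then show "smooth_on (snd c ` {p \<in> U' \<inter> fst c. F p \<in> fst d}) (snd d \<circ> F \<circ> chart_inv c)"
      using M.smooth_funD[OF s'(3) c] d by (simp add: euclidean_mfd_def)
  qed
  \<comment> \<open>Immersion follows from isometry: a vector in the kernel of the differential
    would have length zero for \<open>g\<close>.\<close>
  moreover have "inj (differential M ?S F p)" if p: "p \<in> U'" for p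
  proof -
    have e: "differential M ?S F p = dir_deriv M F p" using diffF[OF p] by blast
    have pt: "p \<in> topspace (mtop M)" using p U'(1) openin_subset by blast
    have "a = 0" if "dir_deriv M F p a = 0" for a
    proof (rule ccontr)
      assume "a \<noteq> 0"
      then have "0 < g p a a" by (rule M.metric_pos[OF pt])
      also have "g p a a = hessian \<Phi> (F p) 0 0" using metric[OF p, of a a] diffF[OF p] that by simp
      also have "\<dots> = 0" by (rule bilinear_lzero[OF bilinear_hessian[OF O'(1) \<Phi> U'N(2)[OF p]]])
      finally show False by simp
    qed
    then show ?thesis
      unfolding e linear_injective_0[OF M.linear_dir_deriv[OF U'(1) p s'(3)]] by blast
  qed
  \<comment> \<open>The first projection of \<open>F\<close> is \<open>u\<close>, from which
    \<open>k\<close> recovers the given embedding \<open>f\<close>; hence \<open>F\<close> inherits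
    from \<open>f\<close> the property of being a homeomorphism onto its image.\<close>
  moreover have "embedding_map (subtopology (mtop M) U') (mtop ?S) F"
  proof (rule embedding_map_left_factor[OF cont])
    have "subtopology (subtopology (mtop M) U) U' = subtopology (mtop M) U'"
      using U'(3) N(2) by (simp add: subtopology_subtopology Int_absorb1 order_trans)
    then show "embedding_map (subtopology (mtop M) U') (mtop S) f"
      using embedding_map_restrict[OF embedding_f, of U'] by simp
    have "continuous_on (F ` U') P1" using P(1) linear_continuous_on linear_conv_bounded_linear by blast
    moreover have "P1 ` F ` U' \<subseteq> W" using uW U'N(1) by (auto simp: PF)
    ultimately have "continuous_map (top_of_set (F ` U')) (top_of_set W) P1" by auto
    then have "continuous_map (top_of_set (F ` U')) (mtop S) (k \<circ> P1)"
      using k(1) by (rule continuous_map_compose)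
    moreover have "subtopology (mtop ?S) (F ` U') = top_of_set (F ` U')"
      using U'N(2) by (auto simp: euclidean_mfd_def subtopology_subtopology Int_absorb1 image_subset_iff)
    ultimately show "continuous_map (subtopology (mtop ?S) (F ` topspace (subtopology (mtop M) U'))) (mtop S) (k \<circ> P1)"
      unfolding tU' by simp
    show "(k \<circ> P1) (F p) = f p" if "p \<in> topspace (subtopology (mtop M) U')" for p
      using k(2) U'N(1) that unfolding tU' by (simp add: PF)
  qed
  ultimately have "statistical_embedding M g (alpha_connection \<alpha> M g D) U' ?S (hessian \<Phi>) euclidean_conn F"
    unfolding statistical_embedding_def smooth_embedding_def using metric alpha by blast
  moreover have "flat_statistical_manifold ?S (hessian \<Phi>) euclidean_conn"
    by (rule hessian_flat_statistical[OF O'(1) \<Phi>]) (use \<Phi>_pos in \<open>simp add: hessian_def\<close>)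
  ultimately show ?thesis using U'(1,2) by blast
qed

theorem proposition2p3:
  fixes M :: "('a, 'e::euclidean_space) manifold"
    and g :: "('a, 'e) metric"
    and D :: "('a, 'e) connection"
    and N :: nat
  assumes "statistical_manifold M g D"
    and "locally_embeddable TYPE(('s, 'n::euclidean_space) manifold) N M g D"
    and "DIM('k::euclidean_space) = 2 * N"
  shows "\<forall>\<alpha>::real. locally_embeddable TYPE(('k, 'k) manifold) (2 * N) M g (alpha_connection \<alpha> M g D)"
  unfolding locally_embeddable_def
proof (intro allI conjI ballI)
  fix \<alpha> :: real
  interpret M: stat M g D by unfold_locales (rule assms(1))
  show "statistical_manifold M g (alpha_connection \<alpha> M g D)" by (rule M.statistical_alpha)
  show "DIM('k) = 2 * N" by (rule assms(3))
  fix x assume x: "x \<in> topspace (mtop M)"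
  have N: "DIM('n) = N" using assms(2) by (simp add: locally_embeddable_def)
  obtain U and S :: "('s, 'n) manifold" and G E f where U: "openin (mtop M) U" "x \<in> U"
    and S: "flat_statistical_manifold S G E" and f: "statistical_embedding M g D U S G E f"
    using assms(2) x unfolding locally_embeddable_def by blast
  interpret stat_embedding M g D S G E U f
    using U(1) S f by unfold_locales (simp_all add: flat_statistical_manifold_def)
  show "\<exists>U (S :: ('k, 'k) manifold) G E f. openin (mtop M) U \<and> x \<in> U \<and> flat_statistical_manifold S G E \<and>
      statistical_embedding M g (alpha_connection \<alpha> M g D) U S G E f"
    by (rule alpha_embedding[OF U(2)]) (simp add: assms(3) N)
qed

end
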